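(* Let $\ell\in\mathbb N$, $\varrho>1$, $f,g$ real symmetric $\ell\times\ell$ matrices, $I\subseteq\mathbb R$ an interval and $T>0$ with $[0,T]\subseteq I$. Assume that $f$ is $\varrho$-strongly gathering, that $g$ is compatible with $f$ on $I$, and that $f\ge0$, $g\ge0$ (positive semidefinite). Let $N>\ell$ and consider the $N$-player game on $[0,T]$ with dynamics $$dX_t=\alpha(t,X_t)\,dt+\sqrt2\,dB_t,\quad t\in[0,T],\qquad X_0=x_0\in(\mathbb R^d)^N,$$ and costs $$J^i(\alpha)=\tfrac12\,\mathbb E\Big[\int_0^T\big(|\alpha^i(t,X_t)|^2+\langle F^iX_t,X_t\rangle\big)\,dt+\langle G^iX_T,X_T\rangle\Big],\qquad i\in\{0,\dots,N-1\}.$$ Let $c=(c_{hk})_{h,k\in\mathbb N}$, $c_{hk}=c_{kh}$, be the solution on $[0,T]$ of $$-\dot c_{hk}-c_{0h}c_{0k}+\sum_{j=0}^hc_{0,h-j}c_{jk}+\sum_{j=0}^kc_{0,k-j}c_{jh}=f_{hk},\qquad c_{hk}(T)=g_{hk},$$ and define the control $\alpha^*$ by $$-\alpha^{*i}(t,x^0,\dots,x^{N-1})=\sum_{j=0}^{N-i-1}c_{0j}(t)\,x^{j+i}+\sum_{j=N-i}^{N-1}c_{0j}(t)\,x^{j+i-N},\qquad i\in\{0,\dots,N-1\}.$$ Then, for any $R\ge0$, any admissible $L$, any $i\in\{0,\dots,N-1\}$ and any $\psi:[0,T]\times(\mathbb R^d)^N\to\mathbb R^d$ with $(\alpha^{*,-i},\psi)\in\mathcal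 A_{R,L}$, $$J^i(\alpha^* )\le J^i((\alpha^{*,-i},\psi))+\hat C\big(\delta^M+(\delta^{-M}+N)\delta^N\big)\qquad\forall\,\delta\in(\varrho^{-1},1),\ \forall\,M\ge\ell,$$ where the constant $\hat C$ is a locally bounded function of $R$, $L$, $T$ and $\delta$, directly proportional to $1+|x_0|^2$.
   Context: Matrix entries are indexed from $0$; $f,g$ are extended by zero, $f_{hk}=g_{hk}=0$ if $(h,k)\notin\{0,\dots,\ell-1\}^2$. Let $\mathbb D$ be the open unit disc, $\varphi(z,w)=\sum_{h,k=0}^{\ell-1}f_{hk}z^hw^k$, $\Psi(z,w)=\sum_{h,k=0}^{\ell-1}g_{hk}z^hw^k$. The matrix $f$ is $\varrho$-strongly gathering if $\varphi(z,0)\notin(-\infty,0)$ for all $|z|\le\varrho$. With $\xi=\sqrt{\varphi(\cdot,0)}$ (principal branch) and $\Psi_0=\Psi(\cdot,0)$, $g$ is compatible with $f$ on $I$ if $\inf_{t\in I}|\Psi_0(z)\tanh(t\xi(z))+\xi(z)|>0$ for every $z\in\varrho\mathbb D$. Game data: $B=(B^0,\dots,B^{N-1})$ with independent $\mathbb R^d$-valued Brownian motions; $F^i=f^i\otimes I_d$, $G^i=g^i\otimes I_d$, where the symmetric $N\times N$ matrices $f^i,g^i$ are shift-invariant with $f^0=f$, $g^0=g$ (extended by zero), i.e. $f^i_{hk}=f_{[h-i]_N,[k-i]_N}$ and $g^i_{hk}=g_{[h-i]_N,[k-i]_N}$, with $[a]_N\in\{0,\dots,N-1\}$ the residue of $a$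 modulo $N$. Controls: for $R,L\ge0$, $\mathcal A_{R,L}$ is the set of feedback controls $\alpha:[0,T]\times(\mathbb R^d)^N\to(\mathbb R^d)^N$ with $|\alpha(t,0)|\le R$ and $|\alpha(t,x)-\alpha(t,y)|\le L|x-y|$ for all $t\in[0,T]$ and $x,y\in(\mathbb R^d)^N$. The Lipschitz constant $L$ is admissible if $L\ge\|c_{0\cdot}\|_{C^0([0,T];\ell^1(\mathbb N))}$. $(\alpha^{*,-i},\psi)$ denotes the control all of whose components are those of $\alpha^*$ except the $i$-th, which is $\psi$. In each $J^i(\alpha)$, $X$ is the solution of the SDE driven by $\alpha$. *)

theory Defs
  imports "HOL-Probability.Probability"
begin

section \<open>Gathering and compatible matrices\<close>

text \<open>
  An \<open>l \<times> l\<close> matrix is a function on all of \<open>nat \<times> nat\<close> vanishing outside \<open>{..<l} \<times> {..<l}\<close>,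
  so the extension by zero is built in.
\<close>

definition sym_matrix :: "nat \<Rightarrow> (nat \<Rightarrow> nat \<Rightarrow> real) \<Rightarrow> bool" where
  "sym_matrix l a \<longleftrightarrow>
     (\<forall>h k. a h k = a k h) \<and> (\<forall>h k. \<not> (h < l \<and> k < l) \<longrightarrow> a h k = 0)"

definition pos_semidef :: "nat \<Rightarrow> (nat \<Rightarrow> nat \<Rightarrow> real) \<Rightarrow> bool" where
  "pos_semidef l a \<longleftrightarrow> (\<forall>v :: nat \<Rightarrow> real. 0 \<le> (\<Sum>h<l. \<Sum>k<l. a h k * v h * v k))"

definition gen_fun :: "nat \<Rightarrow> (nat \<Rightarrow> nat \<Rightarrow> real) \<Rightarrow> complex \<Rightarrow> complex \<Rightarrow> complex" where
  "gen_fun l a z w = (\<Sum>h<l. \<Sum>k<l. of_real (a h k) * z ^ h * w ^ k)"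

definition strongly_gathering :: "nat \<Rightarrow> real \<Rightarrow> (nat \<Rightarrow> nat \<Rightarrow> real) \<Rightarrow> bool" where
  "strongly_gathering l \<rho> f \<longleftrightarrow>
     (\<forall>z. norm z \<le> \<rho> \<longrightarrow> gen_fun l f z 0 \<notin> complex_of_real ` {..<0})"

definition compatible ::
  "nat \<Rightarrow> real \<Rightarrow> (nat \<Rightarrow> nat \<Rightarrow> real) \<Rightarrow> (nat \<Rightarrow> nat \<Rightarrow> real) \<Rightarrow> real set \<Rightarrow> bool" where
  "compatible l \<rho> f g I \<longleftrightarrow>
     (\<forall>z. norm z < \<rho> \<longrightarrow>
        (let \<xi> = csqrt (gen_fun l f z 0)
         in (INF t\<in>I. norm (gen_fun l g z 0 * tanh (of_real t * \<xi>) + \<xi>)) > 0))"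


section \<open>The infinite Riccati system\<close>

definition riccati_solution ::
  "real \<Rightarrow> (nat \<Rightarrow> nat \<Rightarrow> real) \<Rightarrow> (nat \<Rightarrow> nat \<Rightarrow> real) \<Rightarrow> (nat \<Rightarrow> nat \<Rightarrow> real \<Rightarrow> real) \<Rightarrow> bool"
where
  "riccati_solution T f g c \<longleftrightarrow>
     (\<forall>h k. \<forall>t\<in>{0..T}. c h k t = c k h t) \<and>
     (\<forall>h k. c h k T = g h k) \<and>
     (\<forall>h k. \<forall>t\<in>{0..T}. \<exists>c'. (c h k has_real_derivative c') (at t within {0..T}) \<and>
        - c' - c 0 h t * c 0 k t + (\<Sum>j=0..h. c 0 (h - j) t * c j k t)
          + (\<Sum>j=0..k. c 0 (k - j) t * c j h t) = f h k)"

text \<open>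
  The norm of \<open>c\<^sub>0\<close> in \<open>C\<^sup>0([0,T]; \<ell>\<^sup>1)\<close> is taken in \<^typ>\<open>ennreal\<close>, so that no constant is
  admissible if it is infinite.
\<close>

definition admissible :: "real \<Rightarrow> (nat \<Rightarrow> nat \<Rightarrow> real \<Rightarrow> real) \<Rightarrow> real \<Rightarrow> bool" where
  "admissible T c L \<longleftrightarrow> 0 \<le> L \<and> (SUP t\<in>{0..T}. \<Sum>k. ennreal \<bar>c 0 k t\<bar>) \<le> ennreal L"


section \<open>The state space \<open>(\<real>\<^sup>d)\<^sup>N\<close>\<close>

text \<open>
  The bounds must be uniform in \<open>N\<close>, so \<open>N\<close> cannot be a type. A point of \<open>(\<real>\<^sup>d)\<^sup>N\<close> is an
  extensional function on \<open>{..<N}\<close>, that is, an element of the space of the following measurable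
  space.
\<close>

definition states :: "nat \<Rightarrow> (nat \<Rightarrow> real ^ 'd::finite) measure" where
  "states N = Pi\<^sub>M {..<N} (\<lambda>_. borel)"

definition zero_state :: "nat \<Rightarrow> nat \<Rightarrow> real ^ 'd::finite" where
  "zero_state N = (\<lambda>i\<in>{..<N}. 0)"

definition state_norm :: "nat \<Rightarrow> (nat \<Rightarrow> real ^ 'd::finite) \<Rightarrow> real" where
  "state_norm N x = L2_set (\<lambda>i. norm (x i)) {..<N}"

definition state_dist ::
  "nat \<Rightarrow> (nat \<Rightarrow> real ^ 'd::finite) \<Rightarrow> (nat \<Rightarrow> real ^ 'd) \<Rightarrow> real" where
  "state_dist N x y = L2_set (\<lambda>i. norm (x i - y i)) {..<N}"

definition state_inner ::
  "nat \<Rightarrow> (nat \<Rightarrow> real ^ 'd::finite) \<Rightarrow> (nat \<Rightarrow> real ^ 'd) \<Rightarrow> real" where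
  "state_inner N x y = (\<Sum>i<N. x i \<bullet> y i)"

text \<open>The action of the \<open>N \<times> N\<close> block matrix \<open>a \<otimes> I\<^sub>d\<close> on \<open>(\<real>\<^sup>d)\<^sup>N\<close>.\<close>

definition tensor_Id ::
  "nat \<Rightarrow> (nat \<Rightarrow> nat \<Rightarrow> real) \<Rightarrow> (nat \<Rightarrow> real ^ 'd::finite) \<Rightarrow> nat \<Rightarrow> real ^ 'd" where
  "tensor_Id N a x = (\<lambda>h\<in>{..<N}. \<Sum>k<N. a h k *\<^sub>R x k)"

text \<open>The matrix \<open>a\<^sup>i\<close>, with \<open>a\<^sup>0 = a\<close>; the residues are computed in \<^typ>\<open>int\<close> because \<open>h - i\<close> may be
  negative.\<close>

definition shifted :: "nat \<Rightarrow> nat \<Rightarrow> (nat \<Rightarrow> nat \<Rightarrow> real) \<Rightarrow> nat \<Rightarrow> nat \<Rightarrow> real" where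
  "shifted N i a h k =
     a (nat ((int h - int i) mod int N)) (nat ((int k - int i) mod int N))"


section \<open>Brownian motion\<close>

definition paths :: "'t set \<Rightarrow> ('t \<Rightarrow> 'w \<Rightarrow> 'a) \<Rightarrow> 'w \<Rightarrow> 't \<Rightarrow> 'a" where
  "paths A W \<omega> = (\<lambda>t\<in>A. W t \<omega>)"

definition brownian_motion1 :: "'w measure \<Rightarrow> real \<Rightarrow> (real \<Rightarrow> 'w \<Rightarrow> real) \<Rightarrow> bool" where
  "brownian_motion1 P T W \<longleftrightarrow>
     (\<forall>t\<in>{0..T}. W t \<in> borel_measurable P) \<and>
     (AE \<omega> in P. W 0 \<omega> = 0) \<and>
     (AE \<omega> in P. continuous_on {0..T} (\<lambda>t. W t \<omega>)) \<and>
     (\<forall>s t. 0 \<le> s \<longrightarrow> s < t \<longrightarrow> t \<le> T \<longrightarrow>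
        distributed P lborel (\<lambda>\<omega>. W t \<omega> - W s \<omega>) (normal_density 0 (sqrt (t - s)))) \<and>
     (\<forall>(n::nat) \<tau>. mono_on {..n} \<tau> \<longrightarrow> \<tau> ` {..n} \<subseteq> {0..T} \<longrightarrow>
        prob_space.indep_vars P (\<lambda>_. borel) (\<lambda>j \<omega>. W (\<tau> (Suc j)) \<omega> - W (\<tau> j) \<omega>) {..<n})"

definition brownian_motion :: "'w measure \<Rightarrow> real \<Rightarrow> (real \<Rightarrow> 'w \<Rightarrow> real ^ 'd::finite) \<Rightarrow> bool" where
  "brownian_motion P T W \<longleftrightarrow>
     (\<forall>k. brownian_motion1 P T (\<lambda>t \<omega>. W t \<omega> $ k)) \<and>
     prob_space.indep_vars P (\<lambda>_. Pi\<^sub>M {0..T} (\<lambda>_. borel))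
       (\<lambda>k. paths {0..T} (\<lambda>t \<omega>. W t \<omega> $ k)) UNIV"

text \<open>\<open>B i\<close> is the \<open>i\<close>-th Brownian motion; independence is that of the paths as random variables
  in the product \<open>\<sigma>\<close>-algebra.\<close>

definition independent_brownian_motions ::
  "'w measure \<Rightarrow> real \<Rightarrow> nat \<Rightarrow> (nat \<Rightarrow> real \<Rightarrow> 'w \<Rightarrow> real ^ 'd::finite) \<Rightarrow> bool" where
  "independent_brownian_motions P T N B \<longleftrightarrow>
     (\<forall>i<N. brownian_motion P T (B i)) \<and>
     prob_space.indep_vars P (\<lambda>_. Pi\<^sub>M {0..T} (\<lambda>_. borel)) (\<lambda>i. paths {0..T} (B i)) {..<N}"


section \<open>Controls, controlled dynamics and costs\<close>

text \<open>The Lipschitz controls. A feedback control is understood to be Borel measurable in \<open>(t,x)\<close>,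
  without which neither the dynamics nor the costs make sense.\<close>

definition controls ::
  "nat \<Rightarrow> real \<Rightarrow> real \<Rightarrow> real \<Rightarrow> (real \<Rightarrow> (nat \<Rightarrow> real ^ 'd::finite) \<Rightarrow> nat \<Rightarrow> real ^ 'd) set" where
  "controls N T R L = {\<alpha>.
     (\<lambda>(t, x). \<alpha> t x) \<in> restrict_space borel {0..T} \<Otimes>\<^sub>M states N \<rightarrow>\<^sub>M states N \<and>
     (\<forall>t\<in>{0..T}. state_norm N (\<alpha> t (zero_state N)) \<le> R) \<and>
     (\<forall>t\<in>{0..T}. \<forall>x\<in>space (states N). \<forall>y\<in>space (states N).
        state_dist N (\<alpha> t x) (\<alpha> t y) \<le> L * state_dist N x y)}"

text \<open>
  Since the noise is additive, the equation \<open>dX = \<alpha>(t,X) dt + \<surd>2 dB\<close> is an integral equation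
  along paths and involves no stochastic integral. Continuity of \<open>X\<close> is demanded for every
  \<open>\<omega>\<close> since \<open>P\<close> need not be complete: otherwise the time integral in the cost could fail to be
  measurable.
\<close>

definition solves_sde ::
  "'w measure \<Rightarrow> real \<Rightarrow> nat \<Rightarrow> (nat \<Rightarrow> real \<Rightarrow> 'w \<Rightarrow> real ^ 'd::finite) \<Rightarrow> (nat \<Rightarrow> real ^ 'd) \<Rightarrow>
   (real \<Rightarrow> (nat \<Rightarrow> real ^ 'd) \<Rightarrow> nat \<Rightarrow> real ^ 'd) \<Rightarrow> (real \<Rightarrow> 'w \<Rightarrow> nat \<Rightarrow> real ^ 'd) \<Rightarrow> bool" where
  "solves_sde P T N B x0 \<alpha> X \<longleftrightarrow>
     (\<forall>t\<in>{0..T}. X t \<in> P \<rightarrow>\<^sub>M states N) \<and>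
     (\<forall>\<omega>\<in>space P. \<forall>i<N. continuous_on {0..T} (\<lambda>t. X t \<omega> i)) \<and>
     (AE \<omega> in P. \<forall>i<N.
        set_integrable lborel {0..T} (\<lambda>s. \<alpha> s (X s \<omega>) i) \<and>
        (\<forall>t\<in>{0..T}. X t \<omega> i =
           x0 i + (LINT s:{0..t}|lborel. \<alpha> s (X s \<omega>) i) + sqrt 2 *\<^sub>R B i t \<omega>))"

text \<open>\<open>cost P T N f g i \<alpha> X\<close> is \<open>J\<^sup>i(\<alpha>)\<close> when \<open>X\<close> solves the equation driven by \<open>\<alpha>\<close>.\<close>

definition cost ::
  "'w measure \<Rightarrow> real \<Rightarrow> nat \<Rightarrow> (nat \<Rightarrow> nat \<Rightarrow> real) \<Rightarrow> (nat \<Rightarrow> nat \<Rightarrow> real) \<Rightarrow> nat \<Rightarrow>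
   (real \<Rightarrow> (nat \<Rightarrow> real ^ 'd::finite) \<Rightarrow> nat \<Rightarrow> real ^ 'd) \<Rightarrow> (real \<Rightarrow> 'w \<Rightarrow> nat \<Rightarrow> real ^ 'd) \<Rightarrow> real"
where
  "cost P T N f g i \<alpha> X =
     1 / 2 * (LINT \<omega>|P.
       (LINT t:{0..T}|lborel.
          (norm (\<alpha> t (X t \<omega>) i))\<^sup>2
          + state_inner N (tensor_Id N (shifted N i f) (X t \<omega>)) (X t \<omega>))
       + state_inner N (tensor_Id N (shifted N i g) (X T \<omega>)) (X T \<omega>))"

definition alpha_star ::
  "nat \<Rightarrow> (nat \<Rightarrow> nat \<Rightarrow> real \<Rightarrow> real) \<Rightarrow> real \<Rightarrow> (nat \<Rightarrow> real ^ 'd::finite) \<Rightarrow> nat \<Rightarrow> real ^ 'd" where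
  "alpha_star N c t x = (\<lambda>i\<in>{..<N}.
     - ((\<Sum>j\<in>{0..N - i - 1}. c 0 j t *\<^sub>R x (j + i))
        + (\<Sum>j\<in>{N - i..N - 1}. c 0 j t *\<^sub>R x (j + i - N))))"

definition replace_control ::
  "(real \<Rightarrow> (nat \<Rightarrow> real ^ 'd::finite) \<Rightarrow> nat \<Rightarrow> real ^ 'd) \<Rightarrow> nat \<Rightarrow>
   (real \<Rightarrow> (nat \<Rightarrow> real ^ 'd) \<Rightarrow> real ^ 'd) \<Rightarrow> real \<Rightarrow> (nat \<Rightarrow> real ^ 'd) \<Rightarrow> nat \<Rightarrow> real ^ 'd" where
  "replace_control \<alpha> i \<psi> t x = (\<alpha> t x)(i := \<psi> t x)"


section \<open>Local boundedness\<close>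

definition locally_bounded_on ::
  "'a::topological_space set \<Rightarrow> ('a \<Rightarrow> 'b::metric_space) \<Rightarrow> bool" where
  "locally_bounded_on S K \<longleftrightarrow> (\<forall>p\<in>S. \<exists>U. open U \<and> p \<in> U \<and> bounded (K ` (S \<inter> U)))"

end

theory Submission
  imports Defs "HOL-Complex_Analysis.Complex_Analysis"
begin

text \<open>
  The control \<open>\<alpha>\<^sup>*\<close> would be an exact equilibrium if the value function of player \<open>0\<close> were the
  quadratic form with coefficients \<open>c\<^sub>h\<^sub>k\<close>, \<open>h, k < N\<close>, plus a function of time: by the Riccati
  system its gradient in the direction of player \<open>0\<close> is exactly \<open>-\<alpha>\<^sup>*\<^sup>0\<close>. The only obstruction is that the
  feedback wraps around the cycle of \<open>N\<close> players, whereas the Riccati system convolves over all of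
  \<open>\<nat>\<close>. The mismatch (\<open>residual\<close>) consists of products \<open>c\<^sub>h\<^sub>j c\<^sub>0\<^sub>m\<close> in which \<open>h + j + m\<close> is at least \<open>N\<close>,
  so it is of order \<open>N q\<^sup>-\<^sup>N\<close> as soon as \<open>c\<^sub>h\<^sub>k = O(q\<^sup>-\<^sup>h\<^sup>-\<^sup>k)\<close> for some \<open>q > 1/\<delta>\<close>.

  This decay is where the gathering and compatibility conditions enter. The generating function
  \<open>\<theta>(t, z) = \<Sum>\<^sub>k c\<^sub>0\<^sub>k(t) z\<^sup>k\<close> solves the scalar Riccati equation \<open>-\<theta>' + \<theta>\<^sup>2 = \<phi>(z, 0)\<close>, whose explicit
  solution is a quotient of functions holomorphic in \<open>|z| < \<rho>\<close>, with a denominator that compatibility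
  keeps away from zero; Cauchy's inequality gives the first row (\<open>riccati_first_row_decay\<close>). The other
  coefficients solve a linear system driven by the first row, and Gronwall's inequality in a weighted
  supremum norm transfers the decay to them (\<open>riccati_decay\<close>).

  The cost of a deviating player is then computed by completing the square (\<open>cost_identity\<close>): up to
  the residual it is a constant that does not depend on the deviation plus half of
  \<open>E \<integral> |\<psi> - \<alpha>\<^sup>*\<^sup>i|\<^sup>2\<close>, and the last term is nonnegative and vanishes for \<open>\<psi> = \<alpha>\<^sup>*\<^sup>i\<close>. This requires the
  expectation of Ito's formula for the products \<open>Y\<^sup>h \<cdot> Y\<^sup>k\<close> of the components of a solution. As the
  noise is additive, \<open>Y\<close> is a path of bounded variation plus \<open>\<surd>2 B\<close>, and no stochastic integral
  enters: pathwise integration by parts and Fubini's theorem reduce the formula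
  (\<open>ito_product\<close>) to the orthogonality of the drift at time \<open>s\<close> and the increment \<open>B\<^sub>t - B\<^sub>s\<close>
  (\<open>noise_orthogonal\<close>). A solution is not assumed to be adapted, so this orthogonality has
  to be proved; it holds because \<open>Y\<^sub>s\<close> is the limit of an Euler scheme that is a function of
  finitely many increments before \<open>s\<close> (\<open>euler_converges\<close>).

  The second moments of the solutions grow linearly in \<open>N\<close> (\<open>state_size_square_moment\<close>), so the
  error is of order \<open>N\<^sup>3 q\<^sup>-\<^sup>N (1 + |x\<^sub>0|\<^sup>2)\<close>, which is absorbed by \<open>N \<delta>\<^sup>N\<close>. In this way every \<open>M\<close> is admitted
  at once.
\<close>

no_notation fps_nth (infixl \<open>$\<close> 75)

section \<open>Gronwall's inequality and integration by parts\<close>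

text \<open>The inhomogeneity \<open>a\<close> is a function because it will be the size of a noise path. The quantity
  \<open>exp (- L s) \<integral>\<^sub>0\<^sup>s u - \<integral>\<^sub>0\<^sup>s a\<close> is nonincreasing in \<open>s\<close>.\<close>

lemma gronwall_integral:
  fixes u a :: "real \<Rightarrow> real"
  assumes L: "0 \<le> L"
    and u: "continuous_on {0..T} u" and a: "continuous_on {0..T} a"
    and a0: "\<And>t. t \<in> {0..T} \<Longrightarrow> 0 \<le> a t"
    and le: "\<And>t. t \<in> {0..T} \<Longrightarrow> u t \<le> a t + L * integral {0..t} u"
    and t: "t \<in> {0..T}"
  shows "u t \<le> a t + L * exp (L * T) * integral {0..T} a"
proof -
  define V where "V s = exp (- L * s) * integral {0..s} u - integral {0..s} a" for s
  have contint: "continuous_on {0..T} (\<lambda>s. integral {0..s} h)" 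
    if "continuous_on {0..T} h" for h :: "real \<Rightarrow> real"
    by (rule indefinite_integral_continuous_1) (use that integrable_continuous_real in blast)
  have dint: "((\<lambda>s. integral {0..s} h) has_real_derivative h s) (at s)"
    if "continuous_on {0..T} h" "s \<in> {0<..<T}" for h :: "real \<Rightarrow> real" and s
  proof -
    have sT: "s \<in> {0..T}" using that(2) by simp
    have "((\<lambda>s. integral {0..s} h) has_vector_derivative h s) (at s within {0..T})"
      by (rule integral_has_vector_derivative[OF that(1) sT])
    moreover have "at s within {0..T} = at s"
      using that(2) by (intro at_within_Icc_at) auto
    ultimately show ?thesis
      by (simp only: has_real_derivative_iff_has_vector_derivative)
  qed
  have "V t \<le> V 0"
  proof (cases "t = 0")
    case False
    with t have t0: "0 < t" by simp
    show ?thesis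
    proof (rule DERIV_nonpos_imp_decreasing_open[OF less_imp_le[OF t0]])
      fix s assume s: "0 < s" "s < t"
      with t have sT: "s \<in> {0<..<T}" by auto
      let ?d = "exp (- L * s) * (u s - L * integral {0..s} u) - a s"
      have "(V has_real_derivative ?d) (at s)"
        unfolding V_def
        by (auto intro!: derivative_eq_intros dint[OF u sT] dint[OF a sT] simp: algebra_simps)
      moreover have "?d \<le> 0"
      proof -
        have "exp (- L * s) * (u s - L * integral {0..s} u) \<le> exp (- L * s) * a s"
          using le[of s] sT by (intro mult_left_mono) auto
        also have "\<dots> \<le> 1 * a s"
          using a0[of s] sT L by (intro mult_right_mono) auto
        finally show ?thesis by simp
      qed
      ultimately show "\<exists>y. (V has_real_derivative y) (at s) \<and> y \<le> 0" by blast
    next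
      have "continuous_on {0..T} V"
        unfolding V_def by (intro continuous_intros contint[OF u] contint[OF a])
      then show "continuous_on {0..t} V"
        by (rule continuous_on_subset) (use t in auto)
    qed
  qed simp
  then have "exp (- L * t) * integral {0..t} u \<le> integral {0..t} a"
    by (simp add: V_def)
  also have "\<dots> \<le> integral {0..T} a"
  proof (rule integral_subset_le)
    show "a integrable_on {0..t}"
      by (rule integrable_continuous_real, rule continuous_on_subset[OF a]) (use t in auto)
    show "a integrable_on {0..T}"
      by (rule integrable_continuous_real[OF a])
  qed (use t a0 in auto)
  finally have "exp (L * t) * (exp (- L * t) * integral {0..t} u) \<le> exp (L * t) * integral {0..T} a"
    by (intro mult_left_mono) auto
  then have "integral {0..t} u \<le> exp (L * t) * integral {0..T} a"
    by (simp add: mult.assoc[symmetric] exp_minus)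
  also have "\<dots> \<le> exp (L * T) * integral {0..T} a"
    using t L a0 by (intro mult_right_mono Henstock_Kurzweil_Integration.integral_nonneg integrable_continuous_real a) (auto intro!: mult_left_mono)
  finally show ?thesis
    using le[OF t] L mult_left_mono[of "integral {0..t} u" "exp (L * T) * integral {0..T} a" L]
    by (simp add: mult.assoc)
qed

text \<open>Drifts are merely measurable in time, so the product rule for derivatives does not apply.
  Instead, the product of the two increments is the integral of \<open>f r * g s\<close> over a square, which
  Fubini's theorem evaluates separately on the two triangles \<open>s \<le> r\<close> and \<open>r < s\<close>.\<close>

lemma AC_by_parts:
  fixes f g :: "real \<Rightarrow> real"
  assumes f: "set_integrable lborel {0..t} f" and g: "set_integrable lborel {0..t} g"
    and F: "\<And>s. s \<in> {0..t} \<Longrightarrow> F s = F0 + (LINT r:{0..s}|lborel. f r)"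
    and G: "\<And>s. s \<in> {0..t} \<Longrightarrow> G s = G0 + (LINT r:{0..s}|lborel. g r)"
    and t: "0 \<le> t"
  shows "F t * G t = F0 * G0 + (LINT s:{0..t}|lborel. f s * G s + F s * g s)"
    and "set_integrable lborel {0..t} (\<lambda>s. f s * G s + F s * g s)"
proof -
  define f1 g1 where "f1 r = indicator {0..t} r * f r" and "g1 r = indicator {0..t} r * g r" for r
  have fi: "integrable lborel f1" and gi: "integrable lborel g1"
    using f g unfolding f1_def g1_def by (auto simp: set_integrable_def)
  have [measurable]: "f1 \<in> borel_measurable borel" "g1 \<in> borel_measurable borel"
    using borel_measurable_integrable[OF fi] borel_measurable_integrable[OF gi] by auto
  define H where "H = (\<lambda>(r,s). f1 r * g1 s)"
  define H1 where "H1 = (\<lambda>(r,s). of_bool (s \<le> r) * (f1 r * g1 s))"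
  define H2 where "H2 = (\<lambda>(r,s). of_bool (r < s) * (f1 r * g1 s))"
  have Hm [measurable]: "H \<in> borel_measurable (borel \<Otimes>\<^sub>M borel)"
      "H1 \<in> borel_measurable (borel \<Otimes>\<^sub>M borel)" "H2 \<in> borel_measurable (borel \<Otimes>\<^sub>M borel)"
    unfolding H_def H1_def H2_def by measurable
  have HI: "integrable (lborel \<Otimes>\<^sub>M lborel) H"
  proof (rule lborel_pair.Fubini_integrable)
    show "H \<in> borel_measurable (lborel \<Otimes>\<^sub>M lborel)" by measurable
    have "integrable lborel (\<lambda>x. \<bar>f1 x\<bar> * (\<integral>y. \<bar>g1 y\<bar> \<partial>lborel))"
      using fi by (intro integrable_mult_left integrable_abs)
    then show "integrable lborel (\<lambda>x. \<integral>y. norm (H (x, y)) \<partial>lborel)"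
      by (simp add: H_def abs_mult mult.assoc)
    show "AE x in lborel. integrable lborel (\<lambda>y. H (x, y))"
      unfolding H_def split by (intro AE_I2 integrable_mult_right gi)
  qed
  have le: "norm (H1 p) \<le> norm (H p)" "norm (H2 p) \<le> norm (H p)" for p
    by (cases p; simp add: H_def H1_def H2_def)+
  have H1I: "integrable (lborel \<Otimes>\<^sub>M lborel) H1" and H2I: "integrable (lborel \<Otimes>\<^sub>M lborel) H2"
    using Hm by (auto intro!: Bochner_Integration.integrable_bound[OF HI] simp: le[unfolded real_norm_def])
  have Gs: "(\<integral>s. H1 (r, s) \<partial>lborel) = f1 r * (G r - G0)" for r
  proof (cases "r \<in> {0..t}")
    case True
    have "(\<integral>s. H1 (r, s) \<partial>lborel) = (\<integral>s. f1 r * (indicator {0..r} s * g s) \<partial>lborel)"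
      using True by (intro Bochner_Integration.integral_cong) (auto simp: H1_def f1_def g1_def split: split_indicator)
    then show ?thesis
      using G[OF True] True by (simp add: f1_def set_lebesgue_integral_def)
  qed (simp add: H1_def f1_def)
  have Fs: "(\<integral>r. H2 (r, s) \<partial>lborel) = (F s - F0) * g1 s" for s
  proof (cases "s \<in> {0..t}")
    case True
    have "(\<integral>r. H2 (r, s) \<partial>lborel) = (\<integral>r. (indicator {0..s} r * f r) * g1 s \<partial>lborel)"
    proof (rule integral_cong_AE)
      show "AE r in lborel. H2 (r, s) = (indicator {0..s} r * f r) * g1 s"
        using AE_lborel_singleton[of s]
        by eventually_elim (use True in \<open>auto simp: H2_def f1_def g1_def split: split_indicator\<close>)
      have *: "(\<lambda>r. (indicator {0..s} r * f r) * g1 s) = (\<lambda>r. indicator {0..s} r * f1 r * g1 s)"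
        using True by (auto simp: f1_def split: split_indicator)
      show "(\<lambda>r. (indicator {0..s} r * f r) * g1 s) \<in> borel_measurable lborel"
        unfolding * by measurable
    qed (simp add: H2_def)
    then show ?thesis
      using F[OF True] by (simp add: set_lebesgue_integral_def)
  qed (simp add: H2_def g1_def)
  have i1: "integrable lborel (\<lambda>r. f1 r * (G r - G0))"
    using lborel_pair.integrable_fst'[OF H1I] by (simp add: Gs)
  have i2: "integrable lborel (\<lambda>s. (F s - F0) * g1 s)"
    using lborel_pair.integrable_snd[of "\<lambda>r s. H2 (r, s)"] H2I by (simp add: Fs)
  have "(\<integral>r. f1 r \<partial>lborel) * (\<integral>s. g1 s \<partial>lborel) = (\<integral>r. (\<integral>s. H (r, s) \<partial>lborel) \<partial>lborel)"
    by (simp add: H_def)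
  also have "\<dots> = integral\<^sup>L (lborel \<Otimes>\<^sub>M lborel) H"
    by (rule lborel_pair.integral_fst'[OF HI])
  also have "H = (\<lambda>x. H1 x + H2 x)"
    by (auto simp: H_def H1_def H2_def)
  also have "integral\<^sup>L (lborel \<Otimes>\<^sub>M lborel) (\<lambda>x. H1 x + H2 x) = integral\<^sup>L (lborel \<Otimes>\<^sub>M lborel) H1 + integral\<^sup>L (lborel \<Otimes>\<^sub>M lborel) H2"
    by (rule Bochner_Integration.integral_add[OF H1I H2I])
  also have "integral\<^sup>L (lborel \<Otimes>\<^sub>M lborel) H1 = (\<integral>r. f1 r * (G r - G0) \<partial>lborel)"
    by (subst lborel_pair.integral_fst'[OF H1I, symmetric]) (simp add: Gs)
  also have "integral\<^sup>L (lborel \<Otimes>\<^sub>M lborel) H2 = (\<integral>s. (F s - F0) * g1 s \<partial>lborel)"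
    using lborel_pair.integral_snd[of "\<lambda>r s. H2 (r, s)"] H2I by (simp add: Fs)
  finally have eq: "(\<integral>r. f1 r \<partial>lborel) * (\<integral>s. g1 s \<partial>lborel) =
      (\<integral>r. f1 r * (G r - G0) \<partial>lborel) + (\<integral>s. (F s - F0) * g1 s \<partial>lborel)" .
  have tt: "t \<in> {0..t}" using t by simp
  have Ft: "(\<integral>r. f1 r \<partial>lborel) = F t - F0"
    unfolding F[OF tt] set_lebesgue_integral_def f1_def by simp
  have Gt: "(\<integral>r. g1 r \<partial>lborel) = G t - G0"
    unfolding G[OF tt] set_lebesgue_integral_def g1_def by simp
  have e: "(\<lambda>s. indicator {0..t} s * (f s * G s + F s * g s)) =
      (\<lambda>s. (f1 s * (G s - G0) + (F s - F0) * g1 s) + (G0 * f1 s + F0 * g1 s))"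
    by (rule ext) (simp add: f1_def g1_def algebra_simps)
  have i3: "integrable lborel (\<lambda>s. f1 s * (G s - G0) + (F s - F0) * g1 s)"
      "integrable lborel (\<lambda>s. G0 * f1 s + F0 * g1 s)"
    using i1 i2 fi gi by (auto intro!: Bochner_Integration.integrable_add)
  show "set_integrable lborel {0..t} (\<lambda>s. f s * G s + F s * g s)"
    unfolding set_integrable_def real_scaleR_def e
    by (rule Bochner_Integration.integrable_add[OF i3])
  have "(\<integral>s. G0 * f1 s + F0 * g1 s \<partial>lborel) = G0 * (\<integral>r. f1 r \<partial>lborel) + F0 * (\<integral>r. g1 r \<partial>lborel)"
    using fi gi by simp
  then have "(LINT s:{0..t}|lborel. f s * G s + F s * g s) =
      (F t - F0) * (G t - G0) + (G0 * (F t - F0) + F0 * (G t - G0))"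
    unfolding set_lebesgue_integral_def real_scaleR_def e Bochner_Integration.integral_add[OF i3]
      Bochner_Integration.integral_add[OF i1 i2] eq[symmetric] Ft Gt by (rule arg_cong)
  moreover have "F t * G t = F0 * G0 + ((F t - F0) * (G t - G0) + (G0 * (F t - F0) + F0 * (G t - G0)))"
    by algebra
  ultimately show "F t * G t = F0 * G0 + (LINT s:{0..t}|lborel. f s * G s + F s * g s)"
    by (simp only:)
qed

section \<open>Exponential decay of the Riccati coefficients\<close>

lemma gen_fun_sums:
  assumes "sym_matrix l a"
  shows "(\<lambda>k. of_real (a 0 k) * z ^ k) sums gen_fun l a z 0"
proof -
  have "gen_fun l a z 0 = (\<Sum>h<l. of_real (a 0 h) * z ^ h)"
    unfolding gen_fun_def
  proof (rule sum.cong)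
    fix h assume h: "h \<in> {..<l}"
    then obtain l' where "l = Suc l'" by (cases l) auto
    then have "(\<Sum>k<l. of_real (a h k) * z ^ h * 0 ^ k) = of_real (a h 0) * z ^ h"
      by (simp add: sum.lessThan_Suc_shift)
    then show "(\<Sum>k<l. of_real (a h k) * z ^ h * 0 ^ k) = of_real (a 0 h) * z ^ h"
      using assms by (simp add: sym_matrix_def)
  qed simp
  moreover have "(\<lambda>k. of_real (a 0 k) * z ^ k) sums (\<Sum>h<l. of_real (a 0 h) * z ^ h)"
    by (rule sums_finite) (use assms in \<open>auto simp: sym_matrix_def\<close>)
  ultimately show ?thesis by simp
qed

text \<open>For \<open>h = 0\<close> the quadratic term cancels the first convolution, and what is left only involves the
  first row.\<close>

lemma riccati_first_row:
  assumes "riccati_solution T f g c" "t \<in> {0..T}"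
  shows "(c 0 k has_real_derivative (\<Sum>j\<le>k. c 0 j t * c 0 (k - j) t) - f 0 k) (at t within {0..T})"
proof -
  obtain c' where c': "(c 0 k has_real_derivative c') (at t within {0..T})"
    "- c' - c 0 0 t * c 0 k t + (\<Sum>j=0..0. c 0 (0 - j) t * c j k t)
          + (\<Sum>j=0..k. c 0 (k - j) t * c j 0 t) = f 0 k"
    using assms unfolding riccati_solution_def by blast
  have "(\<Sum>j=0..k. c 0 (k - j) t * c j 0 t) = (\<Sum>j\<le>k. c 0 j t * c 0 (k - j) t)"
    using assms unfolding riccati_solution_def by (intro sum.cong) (auto simp: atLeast0AtMost)
  with c' have "c' = (\<Sum>j\<le>k. c 0 j t * c 0 (k - j) t) - f 0 k" by simp
  with c' show ?thesis by simp
qed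

lemma admissible_sum:
  assumes "admissible T c L" "t \<in> {0..T}"
  shows "summable (\<lambda>k. \<bar>c 0 k t\<bar>)" "(\<Sum>k. \<bar>c 0 k t\<bar>) \<le> L"
proof -
  have "(\<Sum>k. ennreal \<bar>c 0 k t\<bar>) \<le> (SUP t\<in>{0..T}. \<Sum>k. ennreal \<bar>c 0 k t\<bar>)"
    by (rule SUP_upper) fact
  also have "\<dots> \<le> ennreal L"
    using assms by (simp add: admissible_def)
  finally have le: "(\<Sum>k. ennreal \<bar>c 0 k t\<bar>) \<le> ennreal L" .
  then have "(\<Sum>k. ennreal \<bar>c 0 k t\<bar>) \<noteq> top"
    by (auto simp: top_unique)
  then show s: "summable (\<lambda>k. \<bar>c 0 k t\<bar>)"
    by (intro summable_suminf_not_top) auto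
  have "ennreal (\<Sum>k. \<bar>c 0 k t\<bar>) = (\<Sum>k. ennreal \<bar>c 0 k t\<bar>)"
    by (rule suminf_ennreal2[symmetric]) (use s in auto)
  with le have "ennreal (\<Sum>k. \<bar>c 0 k t\<bar>) \<le> ennreal L" by simp
  moreover have "0 \<le> L" using assms(1) by (simp add: admissible_def)
  ultimately show "(\<Sum>k. \<bar>c 0 k t\<bar>) \<le> L"
    by (simp only: ennreal_le_iff)
qed

text \<open>The solution of \<open>\<theta>' = \<xi>\<^sup>2 - \<theta>\<^sup>2\<close>, \<open>\<theta>(0) = \<psi>\<close>, in the time to maturity \<open>s\<close> is
  \<open>\<xi> (\<psi> + \<xi> tanh (s \<xi>)) / (\<psi> tanh (s \<xi>) + \<xi>)\<close>. Both parts of the quotient are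
  multiplied by \<open>cosh (s \<xi>)\<close>, which makes them holomorphic in \<open>\<xi>\<close> and makes the numerator the time
  derivative of the denominator.\<close>

definition riccati_den :: "(complex \<Rightarrow> complex) \<Rightarrow> (complex \<Rightarrow> complex) \<Rightarrow> real \<Rightarrow> complex \<Rightarrow> complex" where
  "riccati_den \<psi> \<xi> s z = \<psi> z * sinh (of_real s * \<xi> z) + \<xi> z * cosh (of_real s * \<xi> z)"

definition riccati_num :: "(complex \<Rightarrow> complex) \<Rightarrow> (complex \<Rightarrow> complex) \<Rightarrow> real \<Rightarrow> complex \<Rightarrow> complex" where
  "riccati_num \<psi> \<xi> s z = \<xi> z * (\<psi> z * cosh (of_real s * \<xi> z) + \<xi> z * sinh (of_real s * \<xi> z))"

lemma riccati_den_deriv: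
  "((\<lambda>t. riccati_den \<psi> \<xi> (T - t) z) has_vector_derivative - riccati_num \<psi> \<xi> (T - t) z) (at t within S)"
  unfolding riccati_den_def riccati_num_def of_real_diff
  by (rule has_vector_derivative_real_field) (auto intro!: derivative_eq_intros simp: algebra_simps)

lemma riccati_num_deriv:
  "((\<lambda>t. riccati_num \<psi> \<xi> (T - t) z) has_vector_derivative
      - ((\<xi> z)\<^sup>2 * riccati_den \<psi> \<xi> (T - t) z)) (at t within S)"
  unfolding riccati_den_def riccati_num_def of_real_diff
  by (rule has_vector_derivative_real_field)
     (auto intro!: derivative_eq_intros simp: algebra_simps power2_eq_square)

text \<open>The function \<open>exp (2 L t) |W t|\<^sup>2\<close> is nondecreasing and vanishes at \<open>T\<close>.\<close>

lemma linear_ode_zero: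
  fixes W :: "real \<Rightarrow> complex"
  assumes d: "\<And>t. t \<in> {0..T} \<Longrightarrow> (W has_vector_derivative \<theta> t * W t) (at t within {0..T})"
    and b: "\<And>t. t \<in> {0..T} \<Longrightarrow> norm (\<theta> t) \<le> L"
    and T: "W T = 0" and t: "t \<in> {0..T}"
  shows "W t = 0"
proof -
  define q where "q s = exp (2 * L * s) * (W s \<bullet> W s)" for s
  have cont: "continuous_on {0..T} W"
    using d has_vector_derivative_continuous continuous_on_eq_continuous_within by blast
  have "q t \<le> q T"
  proof (cases "t = T")
    case False
    with t have tT: "t < T" by simp
    show ?thesis
    proof (rule DERIV_nonneg_imp_increasing_open[OF less_imp_le[OF tT]])
      fix s assume s: "t < s" "s < T"
      with t have sT: "s \<in> {0..T}" by simp
      have "at s within {0..T} = at s"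
        using s t by (intro at_within_Icc_at) auto
      with d[OF sT] have W: "(W has_vector_derivative \<theta> s * W s) (at s)" by simp
      then have "(q has_real_derivative exp (2 * L * s) * (2 * (L * (W s \<bullet> W s) + W s \<bullet> (\<theta> s * W s)))) (at s)"
        unfolding q_def has_vector_derivative_def has_field_derivative_def
        by (auto intro!: derivative_eq_intros simp: algebra_simps inner_commute)
      moreover have "0 \<le> exp (2 * L * s) * (2 * (L * (W s \<bullet> W s) + W s \<bullet> (\<theta> s * W s)))"
      proof -
        have "0 \<le> L * (W s \<bullet> W s) + W s \<bullet> (\<theta> s * W s)"
        proof -
          have "\<bar>W s \<bullet> (\<theta> s * W s)\<bar> \<le> norm (W s) * norm (\<theta> s * W s)"
            by (rule Cauchy_Schwarz_ineq2)
          also have "\<dots> = norm (\<theta> s) * (W s \<bullet> W s)"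
            by (simp add: norm_mult dot_square_norm power2_eq_square)
          also have "\<dots> \<le> L * (W s \<bullet> W s)"
            by (intro mult_right_mono b sT) simp
          finally show ?thesis by linarith
        qed
        then show ?thesis by simp
      qed
      ultimately show "\<exists>y. (q has_real_derivative y) (at s) \<and> 0 \<le> y"
        by blast
    next
      have "continuous_on {0..T} q"
        unfolding q_def by (intro continuous_intros cont)
      then show "continuous_on {t..T} q"
        by (rule continuous_on_subset) (use t in auto)
    qed
  qed simp
  then have "exp (2 * L * t) * (W t \<bullet> W t) \<le> 0"
    by (simp add: q_def T)
  then have "W t \<bullet> W t \<le> 0"
    by (simp add: mult_le_0_iff)
  then show ?thesis
    using inner_ge_zero[of "W t"] inner_eq_zero_iff[of "W t"] by linarith
qed

text \<open>Admissibility bounds the first row in \<open>\<ell>\<^sup>1\<close> uniformly in time, so its generating function \<open>\<theta>\<close> converges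
  in the unit disc and may be differentiated term by term; the convolution becomes \<open>\<theta>\<^sup>2\<close>. With
  denominator \<open>D\<close> and numerator \<open>D'\<close> of the explicit solution, \<open>W = \<theta> D - D'\<close> satisfies \<open>W' = \<theta> W\<close> and
  \<open>W T = 0\<close>.\<close>

lemma riccati_first_row_series:
  assumes ric: "riccati_solution T f g c" and adm: "admissible T c L"
    and f: "sym_matrix l f" and g: "sym_matrix l g"
    and z: "norm z < 1" and t: "t \<in> {0..T}" and \<xi>: "(\<xi> z)\<^sup>2 = gen_fun l f z 0"
  shows "(\<Sum>k. of_real (c 0 k t) * z ^ k) * riccati_den (\<lambda>z. gen_fun l g z 0) \<xi> (T - t) z
           = riccati_num (\<lambda>z. gen_fun l g z 0) \<xi> (T - t) z"
    and "summable (\<lambda>k. of_real (c 0 k t) * z ^ k)"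
proof -
  let ?\<psi> = "\<lambda>z. gen_fun l g z 0"
  define \<phi> where "\<phi> = gen_fun l f z 0"
  define F where "F k s = complex_of_real (c 0 k s) * z ^ k" for k s
  define F' where "F' k s = complex_of_real ((\<Sum>j\<le>k. c 0 j s * c 0 (k - j) s) - f 0 k) * z ^ k" for k s
  define \<theta> where "\<theta> s = (\<Sum>k. F k s)" for s
  note asum = admissible_sum[OF adm]
  have z1: "norm z ^ k \<le> 1" for k
    using z by (intro power_le_one) auto
  have Fn: "norm (F k s) \<le> \<bar>c 0 k s\<bar>" for k s
    using z1 by (simp add: F_def norm_mult norm_power mult_left_le)
  have Fs: "summable (\<lambda>k. norm (F k s))" if "s \<in> {0..T}" for s
    by (rule summable_comparison_test'[OF asum(1)[OF that]]) (use Fn in auto)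
  have \<theta>b: "norm (\<theta> s) \<le> L" if "s \<in> {0..T}" for s
  proof -
    have "norm (\<theta> s) \<le> (\<Sum>k. norm (F k s))"
      unfolding \<theta>_def by (rule summable_norm[OF Fs[OF that]])
    also have "\<dots> \<le> (\<Sum>k. \<bar>c 0 k s\<bar>)"
      by (rule suminf_le[OF Fn Fs[OF that] asum(1)[OF that]])
    also have "\<dots> \<le> L" by (rule asum(2)[OF that])
    finally show ?thesis .
  qed
  have F'sums: "(\<lambda>k. F' k s) sums ((\<theta> s)\<^sup>2 - \<phi>)" if "s \<in> {0..T}" for s
  proof -
    have "(\<lambda>k. \<Sum>j\<le>k. F j s * F (k - j) s) sums (\<theta> s * \<theta> s)"
      unfolding \<theta>_def by (rule Cauchy_product_sums) (use Fs[OF that] in auto)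
    moreover have "(\<Sum>j\<le>k. F j s * F (k - j) s) = of_real (\<Sum>j\<le>k. c 0 j s * c 0 (k - j) s) * z ^ k" for k
    proof -
      have "(\<Sum>j\<le>k. F j s * F (k - j) s) = (\<Sum>j\<le>k. of_real (c 0 j s * c 0 (k - j) s) * z ^ k)"
      proof (rule sum.cong)
        fix j assume "j \<in> {..k}"
        then have "z ^ k = z ^ j * z ^ (k - j)"
          by (simp flip: power_add)
        then show "F j s * F (k - j) s = of_real (c 0 j s * c 0 (k - j) s) * z ^ k"
          by (simp add: F_def)
      qed simp
      then show ?thesis
        by (simp add: sum_distrib_right)
    qed
    ultimately have "(\<lambda>k. of_real (\<Sum>j\<le>k. c 0 j s * c 0 (k - j) s) * z ^ k) sums (\<theta> s)\<^sup>2"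
      by (simp add: power2_eq_square)
    from sums_diff[OF this gen_fun_sums[OF f, of z]] show ?thesis
      by (simp add: F'_def \<phi>_def ring_distribs)
  qed
  define B where "B = (\<Sum>k<l. \<bar>f 0 k\<bar>)"
  have fB: "\<bar>f 0 k\<bar> \<le> B" for k
  proof (cases "k < l")
    case True
    then show ?thesis
      unfolding B_def by (intro member_le_sum) auto
  next
    case False
    then show ?thesis
      using f by (auto simp: sym_matrix_def B_def intro!: sum_nonneg)
  qed
  have L0: "0 \<le> L" using adm by (simp add: admissible_def)
  have cL: "(\<Sum>j\<in>J. \<bar>c 0 j s\<bar>) \<le> L" if "s \<in> {0..T}" "finite J" for s J
    using sum_le_suminf[OF asum(1)[OF that(1)] that(2)] asum(2)[OF that(1)] by simp
  have F'b: "norm (F' k s) \<le> (L * L + B) * norm z ^ k" if s: "s \<in> {0..T}" for k s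
  proof -
    have "\<bar>\<Sum>j\<le>k. c 0 j s * c 0 (k - j) s\<bar> \<le> (\<Sum>j\<le>k. \<bar>c 0 j s\<bar> * L)"
    proof (rule order_trans[OF sum_abs], rule sum_mono)
      fix j
      have "\<bar>c 0 (k - j) s\<bar> \<le> L"
        using cL[OF s, of "{k - j}"] by simp
      then show "\<bar>c 0 j s * c 0 (k - j) s\<bar> \<le> \<bar>c 0 j s\<bar> * L"
        by (simp add: abs_mult mult_left_mono)
    qed
    also have "\<dots> \<le> L * L"
      using cL[OF s, of "{..k}"] L0 by (simp add: sum_distrib_right[symmetric] mult_right_mono)
    finally have "\<bar>(\<Sum>j\<le>k. c 0 j s * c 0 (k - j) s) - f 0 k\<bar> \<le> L * L + B"
      using fB[of k] by linarith
    then show ?thesis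
      unfolding F'_def norm_mult norm_power norm_of_real by (rule mult_right_mono) simp
  qed
  have unif: "uniform_limit {0..T} (\<lambda>n s. \<Sum>i<n. F' i s) (\<lambda>s. \<Sum>i. F' i s) sequentially"
    by (rule Weierstrass_m_test[OF F'b]) (use z in \<open>auto intro!: summable_mult summable_geometric\<close>)
  have "\<exists>G. \<forall>s\<in>{0..T}. (\<lambda>n. F n s) sums (G s) \<and> (G has_derivative (\<lambda>h. h *\<^sub>R ((\<theta> s)\<^sup>2 - \<phi>))) (at s within {0..T})"
  proof (rule has_derivative_series)
    show "convex {0..T}" by simp
    show "(F n has_derivative (\<lambda>h. h *\<^sub>R F' n s)) (at s within {0..T})" if "s \<in> {0..T}" for n s
    proof -
      have "((\<lambda>s. complex_of_real (c 0 n s)) has_vector_derivative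
          complex_of_real ((\<Sum>j\<le>n. c 0 j s * c 0 (n - j) s) - f 0 n)) (at s within {0..T})"
        using riccati_first_row[OF ric that, of n]
        by (intro has_vector_derivative_of_real) (simp add: has_real_derivative_iff_has_vector_derivative)
      then have "(F n has_vector_derivative F' n s) (at s within {0..T})"
        unfolding F_def F'_def by (rule has_vector_derivative_mult_left)
      then show ?thesis by (simp add: has_vector_derivative_def)
    qed
    show "\<forall>\<^sub>F n in sequentially. \<forall>x\<in>{0..T}. \<forall>h. norm ((\<Sum>i<n. h *\<^sub>R F' i x) - h *\<^sub>R ((\<theta> x)\<^sup>2 - \<phi>)) \<le> e * norm h"
      if "e > 0" for e
      using uniform_limitD[OF unif that]
    proof eventually_elim
      case (elim n)
      show ?case
      proof (intro ballI allI)
        fix x h assume x: "x \<in> {0..T}"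
        have "norm ((\<Sum>i<n. F' i x) - ((\<theta> x)\<^sup>2 - \<phi>)) \<le> e"
          using elim x sums_unique[OF F'sums[OF x]] by (auto simp: dist_norm intro: less_imp_le)
        then have "\<bar>h\<bar> * norm ((\<Sum>i<n. F' i x) - ((\<theta> x)\<^sup>2 - \<phi>)) \<le> \<bar>h\<bar> * e"
          by (rule mult_left_mono) simp
        then show "norm ((\<Sum>i<n. h *\<^sub>R F' i x) - h *\<^sub>R ((\<theta> x)\<^sup>2 - \<phi>)) \<le> e * norm h"
          unfolding scaleR_sum_right[symmetric] scaleR_diff_right[symmetric] norm_scaleR by (simp add: mult.commute)
      qed
    qed
    show "t \<in> {0..T}" by fact
    show "(\<lambda>n. F n t) sums \<theta> t"
      unfolding \<theta>_def using summable_norm_cancel[OF Fs[OF t]] by (rule summable_sums)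
  qed
  then obtain G where G: "\<And>s. s \<in> {0..T} \<Longrightarrow> (\<lambda>n. F n s) sums (G s)"
     "\<And>s. s \<in> {0..T} \<Longrightarrow> (G has_vector_derivative ((\<theta> s)\<^sup>2 - \<phi>)) (at s within {0..T})"
    unfolding has_vector_derivative_def by blast
  have GE: "G s = \<theta> s" if "s \<in> {0..T}" for s
    unfolding \<theta>_def using G(1)[OF that] by (rule sums_unique)
  define W where "W s = G s * riccati_den ?\<psi> \<xi> (T - s) z - riccati_num ?\<psi> \<xi> (T - s) z" for s
  have W: "W t = 0"
  proof (rule linear_ode_zero[OF _ \<theta>b _ t])
    fix s assume s: "s \<in> {0..T}"
    have "(W has_vector_derivative (G s * (- riccati_num ?\<psi> \<xi> (T - s) z) + ((\<theta> s)\<^sup>2 - \<phi>) * riccati_den ?\<psi> \<xi> (T - s) z)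
       - (- ((\<xi> z)\<^sup>2 * riccati_den ?\<psi> \<xi> (T - s) z))) (at s within {0..T})"
      unfolding W_def
      by (intro has_vector_derivative_diff has_vector_derivative_mult G(2) s riccati_den_deriv riccati_num_deriv)
    then show "(W has_vector_derivative \<theta> s * W s) (at s within {0..T})"
      by (rule has_vector_derivative_eq_rhs)
         (simp add: W_def GE[OF s] \<phi>_def \<xi>[symmetric] algebra_simps power2_eq_square)
  next
    have TT: "T \<in> {0..T}" using t by simp
    have "G T = ?\<psi> z"
      using sums_unique2[OF G(1)[OF TT]] gen_fun_sums[OF g, of z] ric
      by (simp add: F_def riccati_solution_def)
    then show "W T = 0"
      by (simp add: W_def riccati_den_def riccati_num_def)
  qed
  show "(\<Sum>k. of_real (c 0 k t) * z ^ k) * riccati_den ?\<psi> \<xi> (T - t) z = riccati_num ?\<psi> \<xi> (T - t) z"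
    using W unfolding W_def GE[OF t] \<theta>_def F_def by simp
  show "summable (\<lambda>k. of_real (c 0 k t) * z ^ k)"
    using summable_norm_cancel[OF Fs[OF t]] unfolding F_def .
qed


text \<open>Compatibility at \<open>t = 0\<close> says \<open>\<xi> \<noteq> 0\<close>, which together with the gathering condition excludes the whole
  branch cut of the square root. Hence \<open>Re \<xi> > 0\<close>, \<open>cosh (t \<xi>)\<close> has no zero, and compatibility
  yields that the denominator, which is \<open>cosh (t \<xi>)\<close> times the expression in that condition, does not vanish.\<close>

lemma compatible_csqrt:
  assumes sg: "strongly_gathering l \<rho> f" and co: "compatible l \<rho> f g I"
    and I: "{0..T} \<subseteq> I" and T: "0 \<le> T" and z: "norm z < \<rho>"
  shows "gen_fun l f z 0 \<notin> \<real>\<^sub>\<le>\<^sub>0"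
    and "0 < Re (csqrt (gen_fun l f z 0))"
    and "t \<in> {0..T} \<Longrightarrow> riccati_den (\<lambda>z. gen_fun l g z 0) (\<lambda>z. csqrt (gen_fun l f z 0)) t z \<noteq> 0"
proof -
  define \<xi> where "\<xi> = csqrt (gen_fun l f z 0)"
  have pos: "0 < norm (gen_fun l g z 0 * tanh (of_real t * \<xi>) + \<xi>)" if "t \<in> {0..T}" for t
  proof -
    have "0 < (INF t\<in>I. norm (gen_fun l g z 0 * tanh (of_real t * \<xi>) + \<xi>))"
      using co z unfolding compatible_def Let_def \<xi>_def by blast
    also have "\<dots> \<le> norm (gen_fun l g z 0 * tanh (of_real t * \<xi>) + \<xi>)"
      by (rule cINF_lower) (use that I in \<open>auto intro!: bdd_belowI2[of _ 0]\<close>)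
    finally show ?thesis .
  qed
  have \<xi>0: "\<xi> \<noteq> 0"
    using pos[of 0] T by simp
  show n: "gen_fun l f z 0 \<notin> \<real>\<^sub>\<le>\<^sub>0"
  proof
    assume "gen_fun l f z 0 \<in> \<real>\<^sub>\<le>\<^sub>0"
    then obtain r where r: "gen_fun l f z 0 = of_real r" "r \<le> 0"
      by (auto elim!: nonpos_Reals_cases)
    have "r \<noteq> 0"
      using \<xi>0 r by (auto simp: \<xi>_def)
    then have "gen_fun l f z 0 \<in> complex_of_real ` {..<0}"
      using r by auto
    then show False
      using sg z by (auto simp: strongly_gathering_def)
  qed
  show re: "0 < Re (csqrt (gen_fun l f z 0))"
  proof (rule ccontr)
    assume "\<not> ?thesis"
    then have "Re \<xi> = 0"
      using csqrt_principal[of "gen_fun l f z 0"] by (auto simp: \<xi>_def)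
    then have "\<xi>\<^sup>2 = of_real (- (Im \<xi>)\<^sup>2)"
      by (auto simp: complex_eq_iff power2_eq_square)
    then have "gen_fun l f z 0 = of_real (- (Im \<xi>)\<^sup>2)"
      by (simp add: \<xi>_def)
    then have "gen_fun l f z 0 \<in> \<real>\<^sub>\<le>\<^sub>0"
      by (simp only: nonpos_Reals_of_real_iff) simp
    with n show False ..
  qed
  show "riccati_den (\<lambda>z. gen_fun l g z 0) (\<lambda>z. csqrt (gen_fun l f z 0)) t z \<noteq> 0" if t: "t \<in> {0..T}"
  proof -
    define w where "w = of_real t * \<xi>"
    have "cosh w \<noteq> 0"
    proof
      assume c: "cosh w = 0"
      then have "exp w = - exp (- w)"
        by (simp add: cosh_def eq_neg_iff_add_eq_0)
      then have "norm (exp w) = norm (exp (- w))"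
        by simp
      then have "Re w = 0"
        by simp
      then have "t = 0"
        using re by (simp add: w_def \<xi>_def)
      then show False
        using c by (simp add: w_def)
    qed
    then have "riccati_den (\<lambda>z. gen_fun l g z 0) (\<lambda>z. csqrt (gen_fun l f z 0)) t z =
        (gen_fun l g z 0 * tanh w + \<xi>) * cosh w"
      by (simp add: riccati_den_def tanh_def w_def \<xi>_def algebra_simps)
    with pos[OF t] \<open>cosh w \<noteq> 0\<close> show ?thesis
      by (auto simp: w_def)
  qed
qed

lemma gen_fun_holomorphic: "(\<lambda>z. gen_fun l a z 0) holomorphic_on S"
  unfolding gen_fun_def by (intro holomorphic_intros)

text \<open>The explicit solution is holomorphic in the disc of radius \<open>\<rho>\<close> and bounded on the compact set
  \<open>{0..T0} \<times> cball 0 r\<close>. By the previous lemmas it coincides near \<open>0\<close> with the generating function of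
  the first row, whose coefficients are therefore subject to Cauchy's inequality. The constant
  serves every horizon up to \<open>T0\<close> because the solution depends on \<open>t\<close> through \<open>T - t\<close> only.\<close>

lemma riccati_first_row_decay:
  assumes f: "sym_matrix l f" and g: "sym_matrix l g"
    and sg: "strongly_gathering l \<rho> f" and co: "compatible l \<rho> f g I"
    and I: "{0..T0} \<subseteq> I" and T0: "0 \<le> T0" and r: "0 < r" "r < \<rho>" and \<rho>: "1 < \<rho>"
  obtains C where "0 \<le> C"
    "\<And>T c L k t. T \<le> T0 \<Longrightarrow> riccati_solution T f g c \<Longrightarrow> admissible T c L \<Longrightarrow> t \<in> {0..T} \<Longrightarrow>
       \<bar>c 0 k t\<bar> \<le> C / r ^ k"
proof -
  let ?\<psi> = "\<lambda>z. gen_fun l g z 0"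
  define \<xi> where "\<xi> z = csqrt (gen_fun l f z 0)" for z
  define \<Theta> where "\<Theta> s z = riccati_num ?\<psi> \<xi> s z / riccati_den ?\<psi> \<xi> s z" for s z
  note cc = compatible_csqrt[OF sg co I T0]
  have \<xi>hol: "\<xi> holomorphic_on ball 0 \<rho>"
    unfolding \<xi>_def by (intro holomorphic_on_csqrt' gen_fun_holomorphic) (use cc in auto)
  have den: "riccati_den ?\<psi> \<xi> s z \<noteq> 0" if "s \<in> {0..T0}" "norm z < \<rho>" for s z
    using cc(3)[OF that(2,1)] by (simp add: \<xi>_def[abs_def])
  have \<Theta>hol: "\<Theta> s holomorphic_on ball 0 \<rho>" if s: "s \<in> {0..T0}" for s
    unfolding \<Theta>_def[abs_def] 
    by (intro holomorphic_intros; (use den[OF s] in \<open>simp; fail\<close>)?)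
       (auto simp: riccati_num_def riccati_den_def sinh_def cosh_def
          intro!: holomorphic_intros \<xi>hol gen_fun_holomorphic)
  have \<xi>c: "continuous_on (cball 0 r) \<xi>"
    using holomorphic_on_imp_continuous_on[OF \<xi>hol] by (rule continuous_on_subset) (use r in auto)
  have \<psi>c: "continuous_on (cball 0 r) ?\<psi>"
    using gen_fun_holomorphic by (rule holomorphic_on_imp_continuous_on)
  have "continuous_on ({0..T0} \<times> cball 0 r) (\<lambda>p. \<Theta> (fst p) (snd p))"
  proof -
    have 1: "continuous_on ({0..T0} \<times> cball 0 r) (\<lambda>p. \<xi> (snd p))"
      by (rule continuous_on_compose2[OF \<xi>c continuous_on_snd[OF continuous_on_id]]) auto
    have 2: "continuous_on ({0..T0} \<times> cball 0 r) (\<lambda>p. ?\<psi> (snd p))"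
      by (rule continuous_on_compose2[OF \<psi>c continuous_on_snd[OF continuous_on_id]]) auto
    have nz: "\<forall>p\<in>{0..T0} \<times> cball 0 r. riccati_den ?\<psi> \<xi> (fst p) (snd p) \<noteq> 0"
      using den r by auto
    have 3: "continuous_on ({0..T0} \<times> cball 0 r) (\<lambda>p. complex_of_real (fst p))"
      by (intro continuous_intros)
    have "continuous_on ({0..T0} \<times> cball 0 r) (\<lambda>p. riccati_num ?\<psi> \<xi> (fst p) (snd p))"
      "continuous_on ({0..T0} \<times> cball 0 r) (\<lambda>p. riccati_den ?\<psi> \<xi> (fst p) (snd p))"
      unfolding riccati_num_def riccati_den_def sinh_def cosh_def
      by (intro continuous_intros 1 2 3)+
    then show ?thesis
      unfolding \<Theta>_def by (rule continuous_on_divide) (use nz in auto)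
  qed
  then have "compact ((\<lambda>p. \<Theta> (fst p) (snd p)) ` ({0..T0} \<times> cball 0 r))"
    by (intro compact_continuous_image compact_Times) auto
  from compact_imp_bounded[OF this] obtain C where C: "0 < C"
    "\<forall>x\<in>(\<lambda>p. \<Theta> (fst p) (snd p)) ` ({0..T0} \<times> cball 0 r). norm x \<le> C"
    using bounded_pos by metis
  have Cb: "norm (\<Theta> s z) \<le> C" if "s \<in> {0..T0}" "norm z \<le> r" for s z
    using C(2) that by force
  show ?thesis
  proof (rule that)
    show "0 \<le> C" using C by simp
    fix T c L k t
    assume T: "T \<le> T0" and ric: "riccati_solution T f g c" and adm: "admissible T c L"
      and t: "t \<in> {0..T}"
    have s: "T - t \<in> {0..T0}" using t T by auto
    define A where "A = Abs_fps (\<lambda>k. complex_of_real (c 0 k t))"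
    have exp: "\<Theta> (T - t) has_fps_expansion A"
    proof (rule has_fps_expansionI)
      have "eventually (\<lambda>u. u \<in> ball 0 1) (nhds (0::complex))"
        by (rule eventually_nhds_in_open) auto
      then show "eventually (\<lambda>u. (\<lambda>n. fps_nth A n * u ^ n) sums \<Theta> (T - t) u) (nhds 0)"
      proof eventually_elim
        case (elim u)
        then have u: "norm u < 1" by simp
        note ser = riccati_first_row_series[OF ric adm f g u t, of \<xi>]
        have "(\<Sum>k. of_real (c 0 k t) * u ^ k) = \<Theta> (T - t) u"
          using ser(1) den[OF s, of u] u \<rho> by (simp add: \<Theta>_def \<xi>_def field_simps)
        moreover have "summable (\<lambda>k. of_real (c 0 k t) * u ^ k)"
          by (rule ser(2)) (simp add: \<xi>_def)
        ultimately show ?case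
          by (simp add: A_def sums_iff)
      qed
    qed
    have "norm ((deriv ^^ k) (\<Theta> (T - t)) 0) \<le> fact k * C / r ^ k"
    proof (rule Cauchy_inequality[OF _ _ r(1)])
      show "\<Theta> (T - t) holomorphic_on ball 0 r"
        using \<Theta>hol[OF s] by (rule holomorphic_on_subset) (use r in auto)
      show "continuous_on (cball 0 r) (\<Theta> (T - t))"
        using holomorphic_on_imp_continuous_on[OF \<Theta>hol[OF s]] by (rule continuous_on_subset) (use r in auto)
      show "norm (\<Theta> (T - t) x) \<le> C" if "norm (0 - x) = r" for x
        by (rule Cb[OF s]) (use that in simp)
    qed
    moreover have "complex_of_real (c 0 k t) = (deriv ^^ k) (\<Theta> (T - t)) 0 / fact k"
      using fps_nth_fps_expansion[OF exp, of k] by (simp add: A_def)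
    then have "\<bar>c 0 k t\<bar> = norm ((deriv ^^ k) (\<Theta> (T - t)) 0) / fact k"
      by (metis norm_divide norm_fact norm_of_real)
    ultimately have "fact k * \<bar>c 0 k t\<bar> \<le> fact k * (C / r ^ k)"
      by simp
    then show "\<bar>c 0 k t\<bar> \<le> C / r ^ k"
      by (simp only: mult_le_cancel_left_pos[OF fact_gt_zero])
  qed
qed


lemma continuous_on_Max:
  fixes f :: "'i \<Rightarrow> real \<Rightarrow> real"
  assumes "finite J" "J \<noteq> {}" "\<And>i. i \<in> J \<Longrightarrow> continuous_on S (f i)"
  shows "continuous_on S (\<lambda>x. Max ((\<lambda>i. f i x) ` J))"
  using assms
proof (induction J rule: finite_ne_induct)
  case (insert i J)
  then have "continuous_on S (\<lambda>x. max (f i x) (Max ((\<lambda>i. f i x) ` J)))"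
    by (intro continuous_on_max) auto
  then show ?case
    using insert by simp
qed simp

text \<open>Once the first row is known, the remaining equations are linear. In the norm
  \<open>max q\<^sup>h\<^sup>+\<^sup>k |c\<^sub>h\<^sub>k|\<close> over \<open>h, k \<le> n\<close>, convolution with the first row has norm at most
  \<open>C \<Sum>\<^sub>j (q/r)\<^sup>j = C r / (r - q)\<close>. The convolutions do not leave the square \<open>h, k \<le> n\<close>, so Gronwall's
  inequality applies to this finite maximum with constants that do not depend on \<open>n\<close>.\<close>

lemma riccati_decay:
  assumes f: "sym_matrix l f" and g: "sym_matrix l g"
    and C: "0 \<le> C" and q: "0 < q" "q < r"
    and ric: "riccati_solution T f g c"
    and row: "\<And>k t. t \<in> {0..T} \<Longrightarrow> \<bar>c 0 k t\<bar> \<le> C / r ^ k"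
    and T: "0 \<le> T" "T \<le> T0" and t: "t \<in> {0..T}"
  defines "m \<equiv> (\<Sum>h<l. \<Sum>k<l. q ^ (h + k) * (\<bar>g h k\<bar> + T0 * \<bar>f h k\<bar>)) + T0 * C\<^sup>2"
    and "\<kappa> \<equiv> 2 * (C * (r / (r - q)))"
  shows "\<bar>c h k t\<bar> * q ^ (h + k) \<le> m + \<kappa> * exp (\<kappa> * T0) * (T0 * m)"
proof -
  \<comment> \<open>The smallest square of indices that contains the given one.\<close>
  define n where "n = max h k"
  define J where "J = {..n} \<times> {..n}"
  define v where "v p s = \<bar>c (fst p) (snd p) (T - s)\<bar> * q ^ (fst p + snd p)" for p :: "nat \<times> nat" and s
  define u where "u s = Max ((\<lambda>p. v p s) ` J)" for s
  have J: "finite J" "J \<noteq> {}" by (auto simp: J_def)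
  have T0: "0 \<le> T0" using T by simp
  have \<kappa>: "0 \<le> \<kappa>" using C q by (auto simp: \<kappa>_def)
  have rq: "0 < r" using q by simp
  have a_w: "\<bar>c 0 k t\<bar> * q ^ k \<le> C * (q / r) ^ k" if "t \<in> {0..T}" for k t
  proof -
    have "\<bar>c 0 k t\<bar> * q ^ k \<le> C / r ^ k * q ^ k"
      using row[OF that] q by (intro mult_right_mono) auto
    then show ?thesis by (simp add: power_divide)
  qed
  have geo: "(\<Sum>j\<in>K. (q / r) ^ j) \<le> r / (r - q)" if "finite K" for K
  proof -
    have "(\<Sum>j\<in>K. (q / r) ^ j) \<le> (\<Sum>j. (q / r) ^ j)"
      by (rule sum_le_suminf) (use q that in \<open>auto intro!: summable_geometric\<close>)
    also have "\<dots> = 1 / (1 - q / r)"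
      by (rule suminf_geometric) (use q in auto)
    also have "\<dots> = r / (r - q)"
      using q by (simp add: field_simps)
    finally show ?thesis .
  qed
  have a1: "\<bar>c 0 k t\<bar> * q ^ k \<le> C" if "t \<in> {0..T}" for k t
  proof -
    have "(q / r) ^ k \<le> 1"
      using q by (intro power_le_one) auto
    then show ?thesis
      using a_w[OF that, of k] C by (simp add: mult_left_le order_trans)
  qed
  define der where "der h k t = f h k + c 0 h t * c 0 k t - (\<Sum>j=0..h. c 0 (h - j) t * c j k t)
          - (\<Sum>j=0..k. c 0 (k - j) t * c j h t)" for h k t
  have cder: "(c h k has_real_derivative - der h k t) (at t within {0..T})" if t: "t \<in> {0..T}" for h k t
  proof -
    obtain c' where c': "(c h k has_real_derivative c') (at t within {0..T})"
      "- c' - c 0 h t * c 0 k t + (\<Sum>j=0..h. c 0 (h - j) t * c j k t)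
          + (\<Sum>j=0..k. c 0 (k - j) t * c j h t) = f h k"
      using ric t unfolding riccati_solution_def by blast
    then have "c' = - der h k t"
      by (simp add: der_def)
    with c' show ?thesis by simp
  qed
  have ccont: "continuous_on {0..T} (\<lambda>s. c h k s)" for h k
    using cder by (intro DERIV_continuous_on) blast
  have vcont: "continuous_on {0..T} (v p)" for p
  proof -
    have "continuous_on {0..T} (\<lambda>s. c (fst p) (snd p) (T - s))"
      by (rule continuous_on_compose2[OF ccont]) (auto intro!: continuous_intros)
    then show ?thesis
      unfolding v_def[abs_def] by (intro continuous_intros)
  qed
  have ucont: "continuous_on {0..T} u"
    unfolding u_def[abs_def] using J vcont by (rule continuous_on_Max)
  have vu: "v p s \<le> u s" if "p \<in> J" for p s
    unfolding u_def using J that by (intro Max_ge) auto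
  have row_sum: "(\<Sum>j=0..h. \<bar>c 0 (h - j) (T - s)\<bar> * \<bar>c j k (T - s)\<bar>) * q ^ (h + k) \<le> C * (r / (r - q)) * u s"
    if s: "s \<in> {0..T}" and hk: "h \<le> n" "k \<le> n" for h k s
  proof -
    have s': "T - s \<in> {0..T}" using s by auto
    have u0: "0 \<le> u s"
    proof -
      have "0 \<le> v (0,0) s" by (simp add: v_def)
      also have "\<dots> \<le> u s" by (rule vu) (simp add: J_def)
      finally show ?thesis .
    qed
    have "(\<Sum>j=0..h. \<bar>c 0 (h - j) (T - s)\<bar> * \<bar>c j k (T - s)\<bar>) * q ^ (h + k)
       = (\<Sum>j=0..h. (\<bar>c 0 (h - j) (T - s)\<bar> * q ^ (h - j)) * v (j, k) s)"
      unfolding sum_distrib_right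
    proof (rule sum.cong)
      fix j assume "j \<in> {0..h}"
      then have "q ^ (h + k) = q ^ (h - j) * q ^ (j + k)"
        by (simp flip: power_add)
      then show "\<bar>c 0 (h - j) (T - s)\<bar> * \<bar>c j k (T - s)\<bar> * q ^ (h + k)
        = (\<bar>c 0 (h - j) (T - s)\<bar> * q ^ (h - j)) * v (j, k) s"
        by (simp add: v_def)
    qed simp
    also have "\<dots> \<le> (\<Sum>j=0..h. (C * (q / r) ^ (h - j)) * u s)"
    proof (rule sum_mono, rule mult_mono)
      fix j assume j: "j \<in> {0..h}"
      show "\<bar>c 0 (h - j) (T - s)\<bar> * q ^ (h - j) \<le> C * (q / r) ^ (h - j)"
        by (rule a_w[OF s'])
      show "v (j, k) s \<le> u s"
        by (rule vu) (use j hk in \<open>auto simp: J_def\<close>)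
      show "0 \<le> v (j, k) s" using q by (simp add: v_def)
      show "0 \<le> C * (q / r) ^ (h - j)" using C q by simp
    qed
    also have "\<dots> = (C * u s) * (\<Sum>j=0..h. (q / r) ^ (h - j))"
      by (simp add: sum_distrib_left mult_ac)
    also have "(\<Sum>j=0..h. (q / r) ^ (h - j)) = (\<Sum>j\<in>{0..h}. (q / r) ^ j)"
      by (rule sum.reindex_bij_witness[of _ "\<lambda>j. h - j" "\<lambda>j. h - j"]) auto
    also have "(C * u s) * (\<Sum>j\<in>{0..h}. (q / r) ^ j) \<le> (C * u s) * (r / (r - q))"
      by (intro mult_left_mono geo) (use C u0 in auto)
    finally show ?thesis by (simp add: mult_ac)
  qed
  have fg: "q ^ (h + k) * (\<bar>g h k\<bar> + T0 * \<bar>f h k\<bar>) \<le> (\<Sum>h<l. \<Sum>k<l. q ^ (h + k) * (\<bar>g h k\<bar> + T0 * \<bar>f h k\<bar>))" for h k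
  proof (cases "h < l \<and> k < l")
    case True
    have "q ^ (h + k) * (\<bar>g h k\<bar> + T0 * \<bar>f h k\<bar>) \<le> (\<Sum>k<l. q ^ (h + k) * (\<bar>g h k\<bar> + T0 * \<bar>f h k\<bar>))"
      by (rule member_le_sum[of k "{..<l}" "\<lambda>k. q ^ (h + k) * (\<bar>g h k\<bar> + T0 * \<bar>f h k\<bar>)"]) (use True q T0 in auto)
    also have "\<dots> \<le> (\<Sum>h<l. \<Sum>k<l. q ^ (h + k) * (\<bar>g h k\<bar> + T0 * \<bar>f h k\<bar>))"
      by (rule member_le_sum[of h "{..<l}" "\<lambda>h. \<Sum>k<l. q ^ (h + k) * (\<bar>g h k\<bar> + T0 * \<bar>f h k\<bar>)"])
         (use True q T0 in \<open>auto intro!: sum_nonneg\<close>)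
    finally show ?thesis .
  next
    case False
    then have "g h k = 0" "f h k = 0"
      using f g by (auto simp: sym_matrix_def)
    then show ?thesis
      using q T0 by (auto intro!: sum_nonneg)
  qed
  have m0: "0 \<le> m"
    unfolding m_def using q T0 by (intro add_nonneg_nonneg sum_nonneg) auto
  have main: "u s \<le> m + \<kappa> * integral {0..s} u" if s: "s \<in> {0..T}" for s
  proof -
    have uint: "u integrable_on {0..s}"
      by (rule integrable_continuous_real, rule continuous_on_subset[OF ucont]) (use s in auto)
    have vle: "v p s \<le> m + \<kappa> * integral {0..s} u" if pJ: "p \<in> J" for p
    proof -
      obtain h k where p: "p = (h, k)" by (cases p)
      then have hk: "h \<le> n" "k \<le> n" using pJ by (auto simp: J_def)
      let ?Q = "q ^ (h + k)"
      have ftc: "((\<lambda>\<tau>. der h k (T - \<tau>)) has_integral (c h k (T - s) - c h k (T - 0))) {0..s}"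
      proof (rule fundamental_theorem_of_calculus)
        show "0 \<le> s" using s by simp
        fix \<tau> assume \<tau>: "\<tau> \<in> {0..s}"
        then have \<tau>': "T - \<tau> \<in> {0..T}" using s by auto
        have 1: "(c h k has_real_derivative - der h k (T - \<tau>)) (at (T - \<tau>) within (\<lambda>\<tau>. T - \<tau>) ` {0..s})"
          using cder[OF \<tau>'] by (rule has_field_derivative_subset) (use s in auto)
        have 2: "((\<lambda>\<tau>. T - \<tau>) has_real_derivative - 1) (at \<tau> within {0..s})"
          by (auto intro!: derivative_eq_intros)
        from DERIV_image_chain[OF 1 2]
        have "((\<lambda>\<tau>. c h k (T - \<tau>)) has_real_derivative - der h k (T - \<tau>) * (- 1)) (at \<tau> within {0..s})"
          by (simp add: o_def)
        then show "((\<lambda>\<tau>. c h k (T - \<tau>)) has_vector_derivative der h k (T - \<tau>)) (at \<tau> within {0..s})"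
          by (simp add: has_real_derivative_iff_has_vector_derivative)
      qed
      have bd: "\<bar>der h k (T - \<tau>)\<bar> * ?Q \<le> (\<bar>f h k\<bar> * ?Q + C\<^sup>2) + \<kappa> * u \<tau>" if \<tau>: "\<tau> \<in> {0..s}" for \<tau>
      proof -
        have \<tau>T: "\<tau> \<in> {0..T}" and \<tau>': "T - \<tau> \<in> {0..T}" using \<tau> s by auto
        let ?x = "T - \<tau>"
        have "\<bar>der h k ?x\<bar> \<le> \<bar>f h k\<bar> + \<bar>c 0 h ?x * c 0 k ?x\<bar> + \<bar>\<Sum>j=0..h. c 0 (h - j) ?x * c j k ?x\<bar>
            + \<bar>\<Sum>j=0..k. c 0 (k - j) ?x * c j h ?x\<bar>"
          unfolding der_def by linarith
        also have "\<dots> \<le> \<bar>f h k\<bar> + \<bar>c 0 h ?x\<bar> * \<bar>c 0 k ?x\<bar> + (\<Sum>j=0..h. \<bar>c 0 (h - j) ?x\<bar> * \<bar>c j k ?x\<bar>)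
            + (\<Sum>j=0..k. \<bar>c 0 (k - j) ?x\<bar> * \<bar>c j h ?x\<bar>)"
          by (intro add_mono order_trans[OF sum_abs]) (auto simp: abs_mult)
        finally have "\<bar>der h k ?x\<bar> * ?Q \<le> (\<bar>f h k\<bar> + \<bar>c 0 h ?x\<bar> * \<bar>c 0 k ?x\<bar> + (\<Sum>j=0..h. \<bar>c 0 (h - j) ?x\<bar> * \<bar>c j k ?x\<bar>)
            + (\<Sum>j=0..k. \<bar>c 0 (k - j) ?x\<bar> * \<bar>c j h ?x\<bar>)) * ?Q"
          by (rule mult_right_mono) (use q in simp)
        also have "\<dots> = \<bar>f h k\<bar> * ?Q + (\<bar>c 0 h ?x\<bar> * q ^ h) * (\<bar>c 0 k ?x\<bar> * q ^ k)
            + (\<Sum>j=0..h. \<bar>c 0 (h - j) ?x\<bar> * \<bar>c j k ?x\<bar>) * q ^ (h + k)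
            + (\<Sum>j=0..k. \<bar>c 0 (k - j) ?x\<bar> * \<bar>c j h ?x\<bar>) * q ^ (k + h)"
          by (simp add: ring_distribs power_add mult_ac)
        also have "\<dots> \<le> \<bar>f h k\<bar> * ?Q + C * C + C * (r / (r - q)) * u \<tau> + C * (r / (r - q)) * u \<tau>"
          using C q by (intro add_mono mult_mono a1 \<tau>' row_sum hk \<tau>T) auto
        finally show ?thesis
          by (simp add: \<kappa>_def power2_eq_square algebra_simps)
      qed
      have "\<bar>(c h k (T - s) - g h k) * ?Q\<bar> \<le> integral {0..s} (\<lambda>\<tau>. (\<bar>f h k\<bar> * ?Q + C\<^sup>2) + \<kappa> * u \<tau>)"
      proof -
        have i: "((\<lambda>\<tau>. der h k (T - \<tau>) * ?Q) has_integral (c h k (T - s) - g h k) * ?Q) {0..s}"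
          using has_integral_mult_left[OF ftc, of ?Q] ric by (simp add: riccati_solution_def)
        have "norm (integral {0..s} (\<lambda>\<tau>. der h k (T - \<tau>) * ?Q)) \<le> integral {0..s} (\<lambda>\<tau>. (\<bar>f h k\<bar> * ?Q + C\<^sup>2) + \<kappa> * u \<tau>)"
        proof (rule integral_norm_bound_integral)
          show "(\<lambda>\<tau>. der h k (T - \<tau>) * ?Q) integrable_on {0..s}"
            using i by blast
          show "(\<lambda>\<tau>. (\<bar>f h k\<bar> * ?Q + C\<^sup>2) + \<kappa> * u \<tau>) integrable_on {0..s}"
            using integrable_on_mult_right[OF uint, of \<kappa>] by (intro integrable_add integrable_const_ivl)
          show "norm (der h k (T - \<tau>) * ?Q) \<le> (\<bar>f h k\<bar> * ?Q + C\<^sup>2) + \<kappa> * u \<tau>" if "\<tau> \<in> {0..s}" for \<tau>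
            using bd[OF that] q by (simp add: abs_mult)
        qed
        then show ?thesis
          unfolding integral_unique[OF i] real_norm_def .
      qed
      also have "\<dots> = s * (\<bar>f h k\<bar> * ?Q + C\<^sup>2) + \<kappa> * integral {0..s} u"
        using s integrable_on_mult_right[OF uint, of \<kappa>]
        by (subst Henstock_Kurzweil_Integration.integral_add) (auto intro: integrable_const_ivl)
      also have "\<dots> \<le> T0 * (\<bar>f h k\<bar> * ?Q + C\<^sup>2) + \<kappa> * integral {0..s} u"
        using s T q by (intro add_right_mono mult_right_mono) auto
      finally have "\<bar>c h k (T - s) - g h k\<bar> * ?Q \<le> T0 * (\<bar>f h k\<bar> * ?Q + C\<^sup>2) + \<kappa> * integral {0..s} u"
        using q by (simp add: abs_mult)
      moreover have "v p s \<le> \<bar>g h k\<bar> * ?Q + \<bar>c h k (T - s) - g h k\<bar> * ?Q"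
        unfolding v_def p fst_conv snd_conv distrib_right[symmetric] using q by (intro mult_right_mono) auto
      ultimately have "v p s \<le> (?Q * (\<bar>g h k\<bar> + T0 * \<bar>f h k\<bar>) + T0 * C\<^sup>2) + \<kappa> * integral {0..s} u"
        by (simp add: algebra_simps)
      then show ?thesis
        using fg[of h k] unfolding m_def by linarith
    qed
    show ?thesis
      using J vle by (subst u_def) (auto simp: Max_le_iff)
  qed
  have s: "T - t \<in> {0..T}" using t by auto
  have hkJ: "(h, k) \<in> J" by (auto simp: J_def n_def)
  have "\<bar>c h k t\<bar> * q ^ (h + k) = v (h, k) (T - t)"
    by (simp add: v_def)
  also have "\<dots> \<le> u (T - t)"
    by (rule vu[OF hkJ])
  also have "\<dots> \<le> m + \<kappa> * exp (\<kappa> * T) * integral {0..T} (\<lambda>_. m)"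
    by (rule gronwall_integral[OF \<kappa> ucont continuous_on_const m0 main s])
  also have "\<dots> = m + \<kappa> * (exp (\<kappa> * T) * (T * m))"
    using T by simp
  also have "\<dots> \<le> m + \<kappa> * (exp (\<kappa> * T0) * (T0 * m))"
    using T m0 \<kappa> by (intro add_left_mono mult_left_mono mult_mono) (auto intro: mult_left_mono)
  finally show ?thesis by (simp add: mult.assoc)
qed

section \<open>Independence of Brownian increments and measurability of processes\<close>

lemma vec_nth_borel [measurable]: "(\<lambda>v :: real ^ 'd::finite. v $ k) \<in> borel_measurable borel"
  by (intro borel_measurable_continuous_onI continuous_intros)

text \<open>Brownian motions are independent across players, their coordinates are independent as paths, and the
  increments of a coordinate are independent. This lemma merges such a hierarchy into one
  independent family.\<close>

lemma (in prob_space) indep_vars_nested: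
  assumes outer: "indep_vars M' X I"
    and Y: "\<And>i b. i \<in> I \<Longrightarrow> b \<in> J i \<Longrightarrow> Y i b \<in> measurable (M' i) (N i b)"
    and inner: "\<And>i. i \<in> I \<Longrightarrow> indep_vars (N i) (\<lambda>b \<omega>. Y i b (X i \<omega>)) (J i)"
  shows "indep_vars (\<lambda>(i, b). N i b) (\<lambda>(i, b) \<omega>. Y i b (X i \<omega>)) (SIGMA i:I. J i)"
  unfolding indep_vars_def2
proof (intro conjI ballI indep_setsI)
  have X: "X i \<in> measurable M (M' i)" if "i \<in> I" for i
    using outer that by (auto simp: indep_vars_def2)
  {
    fix p assume "p \<in> (SIGMA i:I. J i)"
    then obtain i b where p: "p = (i, b)" "i \<in> I" "b \<in> J i" by auto
    have "(\<lambda>\<omega>. Y i b (X i \<omega>)) \<in> measurable M (N i b)"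
      by (rule measurable_compose[OF X Y]) (use p in auto)
    then show rv: "random_variable (case p of (i, b) \<Rightarrow> N i b) (case p of (i, b) \<Rightarrow> \<lambda>\<omega>. Y i b (X i \<omega>))"
      using p by simp
    then show "{(case p of (i, b) \<Rightarrow> \<lambda>\<omega>. Y i b (X i \<omega>)) -` A \<inter> space M |A. A \<in> sets (case p of (i, b) \<Rightarrow> N i b)} \<subseteq> events"
      by (auto intro: measurable_sets)
  }
  fix A K
  assume K: "K \<noteq> {}" "K \<subseteq> (SIGMA i:I. J i)" "finite K"
    and A: "\<forall>p\<in>K. A p \<in> {(case p of (i, b) \<Rightarrow> \<lambda>\<omega>. Y i b (X i \<omega>)) -` A \<inter> space M |A. A \<in> sets (case p of (i, b) \<Rightarrow> N i b)}"
  have "\<forall>p\<in>K. \<exists>S. A p = (case p of (i, b) \<Rightarrow> \<lambda>\<omega>. Y i b (X i \<omega>)) -` S \<inter> space M \<and> S \<in> sets (case p of (i, b) \<Rightarrow> N i b)"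
    using A by blast
  from bchoice[OF this] obtain S where S': "\<forall>p\<in>K. A p = (case p of (i, b) \<Rightarrow> \<lambda>\<omega>. Y i b (X i \<omega>)) -` S p \<inter> space M
      \<and> S p \<in> sets (case p of (i, b) \<Rightarrow> N i b)" ..
  then have S: "\<And>p. p \<in> K \<Longrightarrow> A p = (case p of (i, b) \<Rightarrow> \<lambda>\<omega>. Y i b (X i \<omega>)) -` S p \<inter> space M"
      "\<And>p. p \<in> K \<Longrightarrow> S p \<in> sets (case p of (i, b) \<Rightarrow> N i b)"
    by auto
  define K1 where "K1 = fst ` K"
  define K2 where "K2 i = {b. (i, b) \<in> K}" for i
  have K1: "finite K1" "K1 \<noteq> {}" "K1 \<subseteq> I" using K by (auto simp: K1_def)
  have K2: "finite (K2 i)" "K2 i \<subseteq> J i" for i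
  proof -
    have "K2 i \<subseteq> snd ` K" by (force simp: K2_def)
    then show "finite (K2 i)" using K(3) finite_surj by blast
    show "K2 i \<subseteq> J i" using K by (auto simp: K2_def)
  qed
  have K2n: "K2 i \<noteq> {}" if "i \<in> K1" for i
    using that by (auto simp: K1_def K2_def)
  have KS: "K = (SIGMA i:K1. K2 i)"
    by (force simp: K1_def K2_def)
  have Ain: "A (i, b) = (\<lambda>\<omega>. Y i b (X i \<omega>)) -` S (i, b) \<inter> space M" "S (i, b) \<in> sets (N i b)"
    if "i \<in> K1" "b \<in> K2 i" for i b
    using S[of "(i, b)"] that by (auto simp: KS)
  have inn: "prob (\<Inter>b\<in>K2 i. A (i, b)) = (\<Prod>b\<in>K2 i. prob (A (i, b)))" if i: "i \<in> K1" for i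
  proof (rule indep_setsD)
    show "indep_sets (\<lambda>b. {(\<lambda>\<omega>. Y i b (X i \<omega>)) -` A \<inter> space M | A. A \<in> sets (N i b)}) (J i)"
      using inner[OF subsetD[OF K1(3) i]] unfolding indep_vars_def2 by (rule conjunct2)
    show "\<forall>b\<in>K2 i. A (i, b) \<in> {(\<lambda>\<omega>. Y i b (X i \<omega>)) -` A \<inter> space M | A. A \<in> sets (N i b)}"
    proof
      fix b assume "b \<in> K2 i"
      from Ain[OF i this] show "A (i, b) \<in> {(\<lambda>\<omega>. Y i b (X i \<omega>)) -` A \<inter> space M | A. A \<in> sets (N i b)}"
        by (intro CollectI exI[of _ "S (i, b)"] conjI)
    qed
  qed (rule K2(2) K2n[OF i] K2(1))+
  have out: "prob (\<Inter>i\<in>K1. \<Inter>b\<in>K2 i. A (i, b)) = (\<Prod>i\<in>K1. prob (\<Inter>b\<in>K2 i. A (i, b)))"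
  proof (rule indep_setsD)
    show "indep_sets (\<lambda>i. {X i -` A \<inter> space M | A. A \<in> sets (M' i)}) I"
      using outer unfolding indep_vars_def2 by (rule conjunct2)
    show "\<forall>i\<in>K1. (\<Inter>b\<in>K2 i. A (i, b)) \<in> {X i -` A \<inter> space M | A. A \<in> sets (M' i)}"
    proof
      fix i assume i: "i \<in> K1"
      let ?S = "\<Inter>b\<in>K2 i. Y i b -` S (i, b) \<inter> space (M' i)"
      have "?S \<in> sets (M' i)"
        using K2 K2n[OF i] Ain(2)[OF i] i K1 by (intro sets.finite_INT measurable_sets[OF Y]) auto
      moreover have "(\<Inter>b\<in>K2 i. A (i, b)) = X i -` ?S \<inter> space M"
        using Ain(1)[OF i] K2n[OF i] measurable_space[OF X] i K1 by auto
      ultimately show "(\<Inter>b\<in>K2 i. A (i, b)) \<in> {X i -` A \<inter> space M | A. A \<in> sets (M' i)}"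
        by (intro CollectI exI[of _ "?S"] conjI)
    qed
  qed (rule K1)+
  have "(\<Inter>p\<in>K. A p) = (\<Inter>i\<in>K1. \<Inter>b\<in>K2 i. A (i, b))"
    unfolding KS by auto
  then have "prob (\<Inter>p\<in>K. A p) = (\<Prod>i\<in>K1. \<Prod>b\<in>K2 i. prob (A (i, b)))"
    using out inn by simp
  also have "\<dots> = (\<Prod>p\<in>K. prob (A p))"
    unfolding KS by (subst prod.Sigma) (use K1 K2 in auto)
  finally show "prob (\<Inter>p\<in>K. A p) = (\<Prod>p\<in>K. prob (A p))" .
qed

lemma brownian_increments_indep:
  fixes B :: "nat \<Rightarrow> real \<Rightarrow> 'w \<Rightarrow> real ^ 'd::finite"
  assumes P: "prob_space P" and B: "independent_brownian_motions P T N B"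
    and \<tau>: "mono_on {..n} \<tau>" "\<tau> ` {..n} \<subseteq> {0..T}"
  shows "prob_space.indep_vars P (\<lambda>_. borel)
    (\<lambda>(i, k, j) \<omega>. B i (\<tau> (Suc j)) \<omega> $ k - B i (\<tau> j) \<omega> $ k) ({..<N} \<times> UNIV \<times> {..<n})"
proof -
  interpret prob_space P by fact
  have \<tau>in: "\<tau> (Suc j) \<in> {0..T}" "\<tau> j \<in> {0..T}" if "j < n" for j
    using \<tau>(2) that by (auto simp: image_subset_iff)
  have inc: "(\<lambda>p::real \<Rightarrow> real. p (\<tau> (Suc j)) - p (\<tau> j)) \<in> borel_measurable (Pi\<^sub>M {0..T} (\<lambda>_. borel))"
    if "j < n" for j
    using \<tau>in[OF that] by (intro borel_measurable_diff measurable_component_singleton) auto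
  have inner: "indep_vars (\<lambda>_. borel) (\<lambda>(k, j) \<omega>. B i (\<tau> (Suc j)) \<omega> $ k - B i (\<tau> j) \<omega> $ k) (UNIV \<times> {..<n})"
    if i: "i < N" for i
  proof -
    have bm: "brownian_motion P T (B i)"
      using B i by (simp add: independent_brownian_motions_def)
    let ?X = "\<lambda>k. paths {0..T} (\<lambda>t \<omega>. B i t \<omega> $ k)"
    have "indep_vars (\<lambda>(k, j). borel) (\<lambda>(k, j) \<omega>. (\<lambda>p. p (\<tau> (Suc j)) - p (\<tau> j)) (?X k \<omega>)) (SIGMA k:UNIV. {..<n})"
    proof (rule indep_vars_nested[where M' = "\<lambda>_. Pi\<^sub>M {0..T} (\<lambda>_. borel)" and N = "\<lambda>_ _. borel"])
      show "indep_vars (\<lambda>_. Pi\<^sub>M {0..T} (\<lambda>_. borel)) ?X UNIV"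
        using bm by (simp add: brownian_motion_def)
      show "(\<lambda>p::real \<Rightarrow> real. p (\<tau> (Suc j)) - p (\<tau> j)) \<in> borel_measurable (Pi\<^sub>M {0..T} (\<lambda>_. borel))" if "j \<in> {..<n}" for j
        using inc that by auto
      fix k
      have "indep_vars (\<lambda>_. borel) (\<lambda>j \<omega>. B i (\<tau> (Suc j)) \<omega> $ k - B i (\<tau> j) \<omega> $ k) {..<n}"
        using bm \<tau> unfolding brownian_motion_def brownian_motion1_def by blast
      then show "indep_vars (\<lambda>_. borel) (\<lambda>j \<omega>. ?X k \<omega> (\<tau> (Suc j)) - ?X k \<omega> (\<tau> j)) {..<n}"
        by (rule indep_vars_cong[THEN iffD1, rotated -1]) (use \<tau>in in \<open>auto simp: paths_def\<close>)
    qed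
    then show ?thesis
      by (rule indep_vars_cong[THEN iffD1, rotated -1]) (use \<tau>in in \<open>auto simp: paths_def\<close>)
  qed
  have "indep_vars (\<lambda>(i, p). borel) (\<lambda>(i, p) \<omega>. (\<lambda>q. q (\<tau> (Suc (snd p))) $ fst p - q (\<tau> (snd p)) $ fst p) (paths {0..T} (B i) \<omega>))
     (SIGMA i:{..<N}. UNIV \<times> {..<n})"
  proof (rule indep_vars_nested[where M' = "\<lambda>_. Pi\<^sub>M {0..T} (\<lambda>_. borel)" and N = "\<lambda>_ _. borel"])
    show "indep_vars (\<lambda>_. Pi\<^sub>M {0..T} (\<lambda>_. borel)) (\<lambda>i. paths {0..T} (B i)) {..<N}"
      using B by (simp add: independent_brownian_motions_def)
    show "(\<lambda>q::real \<Rightarrow> real^'d. q (\<tau> (Suc (snd p))) $ fst p - q (\<tau> (snd p)) $ fst p) \<in> borel_measurable (Pi\<^sub>M {0..T} (\<lambda>_. borel))"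
      if "p \<in> UNIV \<times> {..<n}" for p
    proof -
      have 1: "(\<lambda>q::real \<Rightarrow> real^'d. q (\<tau> (Suc (snd p)))) \<in> borel_measurable (Pi\<^sub>M {0..T} (\<lambda>_. borel))"
        "(\<lambda>q::real \<Rightarrow> real^'d. q (\<tau> (snd p))) \<in> borel_measurable (Pi\<^sub>M {0..T} (\<lambda>_. borel))"
        using \<tau>in[of "snd p"] that by (auto intro!: measurable_component_singleton)
      show ?thesis
        by (intro borel_measurable_diff 1[THEN measurable_compose, OF vec_nth_borel])
    qed
    fix i assume "i \<in> {..<N}"
    then have "i < N" by simp
    from inner[OF this]
    show "indep_vars (\<lambda>_. borel) (\<lambda>p \<omega>. paths {0..T} (B i) \<omega> (\<tau> (Suc (snd p))) $ fst p - paths {0..T} (B i) \<omega> (\<tau> (snd p)) $ fst p) (UNIV \<times> {..<n})"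
      by (rule indep_vars_cong[THEN iffD1, rotated -1]) (use \<tau>in in \<open>auto simp: paths_def\<close>)
  qed
  then show ?thesis
    by (rule indep_vars_cong[THEN iffD1, rotated -1]) (use \<tau>in in \<open>auto simp: paths_def\<close>)
qed

text \<open>The process is the limit of the step processes \<open>X (\<lfloor>n t\<rfloor> / n)\<close>, which take only countably many
  time values.\<close>

lemma continuous_process_measurable:
  fixes X :: "real \<Rightarrow> 'w \<Rightarrow> 'b::{metric_space}"
  assumes m: "\<And>t. X t \<in> borel_measurable M"
    and c: "\<And>\<omega>. \<omega> \<in> space M \<Longrightarrow> continuous_on UNIV (\<lambda>t. X t \<omega>)"
  shows "(\<lambda>(t, \<omega>). X t \<omega>) \<in> borel_measurable (borel \<Otimes>\<^sub>M M)"
proof (rule borel_measurable_LIMSEQ_metric)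
  define g :: "nat \<Rightarrow> real \<times> 'w \<Rightarrow> int" where "g n p = \<lfloor>real (Suc n) * fst p\<rfloor>" for n p
  show "(\<lambda>p. X (of_int (g n p) / real (Suc n)) (snd p)) \<in> borel_measurable (borel \<Otimes>\<^sub>M M)" for n
  proof (rule measurable_compose_countable[where f = "\<lambda>i p. X (of_int i / real (Suc n)) (snd p)"])
    show "(\<lambda>p. X (of_int i / real (Suc n)) (snd p)) \<in> borel_measurable (borel \<Otimes>\<^sub>M M)" for i
      using m by (rule measurable_compose[OF measurable_snd])
    show "g n \<in> measurable (borel \<Otimes>\<^sub>M M) (count_space UNIV)"
      unfolding g_def by measurable
  qed
  fix p assume p: "p \<in> space (borel \<Otimes>\<^sub>M M :: (real \<times> 'w) measure)"
  have "(\<lambda>n. of_int (g n p) / real (Suc n)) \<longlonglongrightarrow> fst p"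
  proof (rule real_tendsto_sandwich)
    show "\<forall>\<^sub>F n in sequentially. fst p - 1 / real (Suc n) \<le> of_int (g n p) / real (Suc n)"
    proof (rule always_eventually, rule allI)
      fix n
      have "real (Suc n) * fst p - 1 \<le> of_int (g n p)"
        unfolding g_def by linarith
      then have "(real (Suc n) * fst p - 1) / real (Suc n) \<le> of_int (g n p) / real (Suc n)"
        by (rule divide_right_mono) simp
      then show "fst p - 1 / real (Suc n) \<le> of_int (g n p) / real (Suc n)"
        by (simp add: diff_divide_distrib)
    qed
    show "\<forall>\<^sub>F n in sequentially. of_int (g n p) / real (Suc n) \<le> fst p"
    proof (rule always_eventually, rule allI)
      fix n
      have "of_int (g n p) \<le> real (Suc n) * fst p"
        unfolding g_def by linarith
      then have "of_int (g n p) / real (Suc n) \<le> (real (Suc n) * fst p) / real (Suc n)"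
        by (rule divide_right_mono) simp
      then show "of_int (g n p) / real (Suc n) \<le> fst p"
        by simp
    qed
    have "(\<lambda>n. fst p - 1 / real (Suc n)) \<longlonglongrightarrow> fst p - 0"
      by (intro tendsto_diff tendsto_const LIMSEQ_Suc lim_inverse_n[unfolded inverse_eq_divide])
    then show "(\<lambda>n. fst p - 1 / real (Suc n)) \<longlonglongrightarrow> fst p" by simp
  qed simp
  moreover have "isCont (\<lambda>t. X t (snd p)) (fst p)"
    using c[of "snd p"] p by (simp add: space_pair_measure continuous_on_eq_continuous_at mem_Times_iff)
  ultimately have "(\<lambda>n. X (of_int (g n p) / real (Suc n)) (snd p)) \<longlonglongrightarrow> X (fst p) (snd p)"
    by (rule isCont_tendsto_compose[rotated])
  then show "(\<lambda>n. X (of_int (g n p) / real (Suc n)) (snd p)) \<longlonglongrightarrow> (case p of (t, \<omega>) \<Rightarrow> X t \<omega>)"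
    by (simp add: case_prod_beta)
qed

lemma brownian_motion1_increment:
  assumes P: "prob_space P" and W: "brownian_motion1 P T W" and st: "0 \<le> s" "s < t" "t \<le> T"
  shows "integrable P (\<lambda>\<omega>. (W t \<omega> - W s \<omega>)\<^sup>2)" "(LINT \<omega>|P. W t \<omega> - W s \<omega>) = 0"
    "(LINT \<omega>|P. (W t \<omega> - W s \<omega>)\<^sup>2) = t - s" "integrable P (\<lambda>\<omega>. W t \<omega> - W s \<omega>)"
proof -
  interpret prob_space P by fact
  have D: "distributed P lborel (\<lambda>\<omega>. W t \<omega> - W s \<omega>) (normal_density 0 (sqrt (t - s)))"
    using W st by (simp add: brownian_motion1_def)
  have s: "0 < sqrt (t - s)" using st by simp
  show E: "(LINT \<omega>|P. W t \<omega> - W s \<omega>) = 0"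
    by (rule normal_distributed_expectation[OF s D])
  have "variance (\<lambda>\<omega>. W t \<omega> - W s \<omega>) = (sqrt (t - s))\<^sup>2"
    by (rule normal_distributed_variance[OF s D])
  then show "(LINT \<omega>|P. (W t \<omega> - W s \<omega>)\<^sup>2) = t - s"
    using st by (simp add: E)
  have "integrable lborel (\<lambda>x. normal_density 0 (sqrt (t - s)) x * x ^ 2)"
    using integrable_normal_moment[OF s, of 0 2] by simp
  then show "integrable P (\<lambda>\<omega>. (W t \<omega> - W s \<omega>)\<^sup>2)"
    using distributed_integrable[OF D, of "\<lambda>x. x\<^sup>2"] by simp
  have "integrable lborel (\<lambda>x. normal_density 0 (sqrt (t - s)) x * x ^ 1)"
    using integrable_normal_moment[OF s, of 0 1] by simp
  then show "integrable P (\<lambda>\<omega>. W t \<omega> - W s \<omega>)"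
    using distributed_integrable[OF D, of "\<lambda>x. x"] by simp
qed

lemma brownian_motion1_moments:
  assumes P: "prob_space P" and W: "brownian_motion1 P T W" and t: "0 \<le> t" "t \<le> T"
  shows "integrable P (\<lambda>\<omega>. (W t \<omega>)\<^sup>2)" "(LINT \<omega>|P. W t \<omega>) = 0"
    "(LINT \<omega>|P. (W t \<omega>)\<^sup>2) = t" "integrable P (W t)"
proof -
  interpret prob_space P by fact
  have m [measurable]: "W t \<in> borel_measurable P" "W 0 \<in> borel_measurable P"
    using W t by (auto simp: brownian_motion1_def)
  have W0: "AE \<omega> in P. W 0 \<omega> = 0"
    using W by (simp add: brownian_motion1_def)
  have "integrable P (\<lambda>\<omega>. (W t \<omega>)\<^sup>2) \<and> (LINT \<omega>|P. W t \<omega>) = 0 \<and> (LINT \<omega>|P. (W t \<omega>)\<^sup>2) = t \<and> integrable P (W t)"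
  proof (cases "t = 0")
    case True
    have "integrable P (\<lambda>\<omega>. (W t \<omega>)\<^sup>2) \<longleftrightarrow> integrable P (\<lambda>\<omega>. 0::real)"
      by (rule integrable_cong_AE) (use W0 True in auto)
    moreover have "integrable P (W t) \<longleftrightarrow> integrable P (\<lambda>\<omega>. 0::real)"
      by (rule integrable_cong_AE) (use W0 True in auto)
    moreover have "(LINT \<omega>|P. W t \<omega>) = (LINT \<omega>|P. 0)"
      by (rule integral_cong_AE) (use W0 True in auto)
    moreover have "(LINT \<omega>|P. (W t \<omega>)\<^sup>2) = (LINT \<omega>|P. 0)"
      by (rule integral_cong_AE) (use W0 True in auto)
    ultimately show ?thesis using True by simp
  next
    case False
    with t have "0 < t" by simp
    note inc = brownian_motion1_increment[OF P W order_refl this t(2)]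
    have ae: "AE \<omega> in P. W t \<omega> = W t \<omega> - W 0 \<omega>" "AE \<omega> in P. (W t \<omega>)\<^sup>2 = (W t \<omega> - W 0 \<omega>)\<^sup>2"
      using W0 by auto
    have "integrable P (\<lambda>\<omega>. (W t \<omega>)\<^sup>2) \<longleftrightarrow> integrable P (\<lambda>\<omega>. (W t \<omega> - W 0 \<omega>)\<^sup>2)"
      by (rule integrable_cong_AE[OF _ _ ae(2)]) auto
    moreover have "integrable P (W t) \<longleftrightarrow> integrable P (\<lambda>\<omega>. W t \<omega> - W 0 \<omega>)"
      by (rule integrable_cong_AE[OF _ _ ae(1)]) auto
    moreover have "(LINT \<omega>|P. W t \<omega>) = (LINT \<omega>|P. W t \<omega> - W 0 \<omega>)"
      by (rule integral_cong_AE[OF _ _ ae(1)]) auto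
    moreover have "(LINT \<omega>|P. (W t \<omega>)\<^sup>2) = (LINT \<omega>|P. (W t \<omega> - W 0 \<omega>)\<^sup>2)"
      by (rule integral_cong_AE[OF _ _ ae(2)]) auto
    ultimately show ?thesis using inc by simp
  qed
  then show "integrable P (\<lambda>\<omega>. (W t \<omega>)\<^sup>2)" "(LINT \<omega>|P. W t \<omega>) = 0"
    "(LINT \<omega>|P. (W t \<omega>)\<^sup>2) = t" "integrable P (W t)" by auto
qed

section \<open>Controlled solutions as a drift path plus noise\<close>

lemma norm_le_state_norm: "h < N \<Longrightarrow> norm (v h) \<le> state_norm N v"
  unfolding state_norm_def by (rule member_le_L2_set) auto

lemma comp_le_state_norm: "h < N \<Longrightarrow> \<bar>v h $ k\<bar> \<le> state_norm N v"
  using component_le_norm_cart[of "v h" k] norm_le_state_norm[of h N v] by linarith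

lemma state_norm_nonneg [simp]: "0 \<le> state_norm N v"
  by (simp add: state_norm_def)

lemma state_norm_triangle: "state_norm N (\<lambda>h. u h + v h) \<le> state_norm N u + state_norm N v"
proof -
  have "state_norm N (\<lambda>h. u h + v h) \<le> L2_set (\<lambda>h. norm (u h) + norm (v h)) {..<N}"
    unfolding state_norm_def by (intro L2_set_mono norm_triangle_ineq) auto
  also have "\<dots> \<le> state_norm N u + state_norm N v"
    unfolding state_norm_def by (rule L2_set_triangle_ineq)
  finally show ?thesis .
qed

lemma state_norm_cong: "(\<And>h. h < N \<Longrightarrow> u h = v h) \<Longrightarrow> state_norm N u = state_norm N v"
  unfolding state_norm_def by (rule L2_set_cong) auto

lemma state_dist_norm: "state_dist N u v = state_norm N (\<lambda>h. u h - v h)"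
  by (simp add: state_dist_def state_norm_def)

lemma state_norm_scaleR: "state_norm N (\<lambda>h. a *\<^sub>R v h) = \<bar>a\<bar> * state_norm N v"
  unfolding state_norm_def by (simp add: L2_set_right_distrib)

lemma state_norm_square: "(state_norm N v)\<^sup>2 = (\<Sum>h<N. v h \<bullet> v h)"
  by (simp add: state_norm_def L2_set_def sum_nonneg power2_norm_eq_inner)

lemma state_norm_square_comp: "(state_norm N v)\<^sup>2 = (\<Sum>h<N. \<Sum>k\<in>UNIV. (v h $ k)\<^sup>2)"
  unfolding state_norm_square by (simp add: inner_vec_def power2_eq_square)

lemma state_inner_le: "(\<Sum>h<N. u h \<bullet> v h) \<le> state_norm N u * state_norm N v"
proof -
  have "(\<Sum>h<N. u h \<bullet> v h) \<le> (\<Sum>h<N. \<bar>norm (u h)\<bar> * \<bar>norm (v h)\<bar>)"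
    by (intro sum_mono) (simp add: norm_cauchy_schwarz)
  also have "\<dots> \<le> state_norm N u * state_norm N v"
    unfolding state_norm_def by (rule L2_set_mult_ineq)
  finally show ?thesis .
qed

text \<open>Minkowski's integral inequality. It is obtained by pairing the integral with itself, since the
  states do not form a normed space type.\<close>

lemma state_norm_integral_le:
  fixes v :: "'s \<Rightarrow> nat \<Rightarrow> real ^ 'd::finite"
  assumes v: "\<And>h. h < N \<Longrightarrow> integrable M (\<lambda>s. v s h)"
    and nv: "integrable M (\<lambda>s. state_norm N (v s))"
  shows "state_norm N (\<lambda>h. \<integral>s. v s h \<partial>M) \<le> (\<integral>s. state_norm N (v s) \<partial>M)"
proof -
  define V where "V h = (\<integral>s. v s h \<partial>M)" for h
  have "(state_norm N V)\<^sup>2 = (\<Sum>h<N. \<integral>s. v s h \<bullet> V h \<partial>M)"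
    unfolding state_norm_square by (intro sum.cong) (auto simp: V_def v)
  also have "\<dots> = (\<integral>s. (\<Sum>h<N. v s h \<bullet> V h) \<partial>M)"
    by (rule Bochner_Integration.integral_sum[symmetric]) (use v in auto)
  also have "\<dots> \<le> (\<integral>s. state_norm N (v s) * state_norm N V \<partial>M)"
    using v nv by (intro integral_mono state_inner_le Bochner_Integration.integrable_sum) auto
  also have "\<dots> = (\<integral>s. state_norm N (v s) \<partial>M) * state_norm N V"
    by simp
  finally have "state_norm N V * state_norm N V \<le> (\<integral>s. state_norm N (v s) \<partial>M) * state_norm N V"
    by (simp add: power2_eq_square)
  moreover have "0 \<le> (\<integral>s. state_norm N (v s) \<partial>M)"
    by (rule Bochner_Integration.integral_nonneg) simp
  ultimately have "state_norm N V \<le> (\<integral>s. state_norm N (v s) \<partial>M)"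
    using state_norm_nonneg[of N V] by (cases "state_norm N V = 0") (auto simp: mult_le_cancel_right)
  then show ?thesis by (simp add: V_def[abs_def])
qed

lemma state_norm_set_integral_le:
  fixes v :: "real \<Rightarrow> nat \<Rightarrow> real ^ 'd::finite"
  assumes v: "\<And>h. h < N \<Longrightarrow> set_integrable lborel S (\<lambda>s. v s h)"
    and nv: "set_integrable lborel S (\<lambda>s. state_norm N (v s))"
  shows "state_norm N (\<lambda>h. LINT s:S|lborel. v s h) \<le> (LINT s:S|lborel. state_norm N (v s))"
proof -
  have e: "state_norm N (\<lambda>h. indicator S s *\<^sub>R v s h) = indicator S s *\<^sub>R state_norm N (v s)" for s
    by (simp add: state_norm_scaleR)
  have "state_norm N (\<lambda>h. \<integral>s. indicator S s *\<^sub>R v s h \<partial>lborel)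
      \<le> (\<integral>s. state_norm N (\<lambda>h. indicator S s *\<^sub>R v s h) \<partial>lborel)"
    by (rule state_norm_integral_le) (use v nv in \<open>simp_all only: e set_integrable_def\<close>)
  then show ?thesis
    by (simp only: e set_lebesgue_integral_def)
qed

lemma measurable_states_comp: "h < N \<Longrightarrow> (\<lambda>x. x h) \<in> borel_measurable (states N)"
  unfolding states_def by (rule measurable_component_singleton) simp

lemma state_norm_measurable [measurable]: "state_norm N \<in> borel_measurable (states N)"
proof -
  have "(\<lambda>x :: nat \<Rightarrow> real ^ 'd. sqrt (\<Sum>h<N. (norm (x h))\<^sup>2)) \<in> borel_measurable (states N)"
    by (rule measurable_compose[OF _ borel_measurable_sqrt])
       (auto intro!: borel_measurable_sum borel_measurable_power
          measurable_compose[OF measurable_states_comp borel_measurable_norm])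
  then show ?thesis
    by (simp add: state_norm_def[abs_def] L2_set_def)
qed

lemma measurable_into_states:
  assumes "\<And>h. h < N \<Longrightarrow> (\<lambda>p. f p h) \<in> borel_measurable M"
    and "\<And>p. p \<in> space M \<Longrightarrow> f p \<in> space (states N)"
  shows "f \<in> M \<rightarrow>\<^sub>M states N"
  unfolding states_def
proof (rule measurable_PiM_single'[where f = "\<lambda>h p. f p h"])
  show "(\<lambda>p. f p h) \<in> borel_measurable M" if "h \<in> {..<N}" for h
    using assms(1)[of h] that by simp
  show "f \<in> space M \<rightarrow> ({..<N} \<rightarrow>\<^sub>E space borel)"
    using assms(2) unfolding states_def space_PiM by blast
qed

lemma space_states: "x \<in> space (states N) \<longleftrightarrow> x \<in> extensional {..<N}"
  by (auto simp: states_def space_PiM PiE_def)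

lemma zero_state_space: "zero_state N \<in> space (states N)"
  by (simp add: space_states zero_state_def)

lemma set_integral_split:
  fixes f :: "real \<Rightarrow> 'e::{banach,second_countable_topology}"
  assumes "0 \<le> a" "a \<le> b" "set_integrable lborel {0..b} f"
  shows "(LINT s:{0..b}|lborel. f s) = (LINT s:{0..a}|lborel. f s) + (LINT s:{a<..b}|lborel. f s)"
    and "set_integrable lborel {a<..b} f"
proof -
  have e: "{0..b} = {0..a} \<union> {a<..b}" using assms by auto
  have i: "set_integrable lborel {0..a} f"
    by (rule set_integrable_subset[OF assms(3)]) (use assms in auto)
  show j: "set_integrable lborel {a<..b} f"
    by (rule set_integrable_subset[OF assms(3)]) (use assms in auto)
  show "(LINT s:{0..b}|lborel. f s) = (LINT s:{0..a}|lborel. f s) + (LINT s:{a<..b}|lborel. f s)"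
    unfolding e by (rule set_integral_Un[OF _ i j]) auto
qed

text \<open>A solution of the equation driven by a fixed Lipschitz control. Both the candidate equilibrium and
  a deviation from it are instances.\<close>

locale controlled_sde = prob_space P for P :: "'w measure" +
  fixes T :: real and N :: nat and B :: "nat \<Rightarrow> real \<Rightarrow> 'w \<Rightarrow> real ^ 'd::finite"
    and x0 :: "nat \<Rightarrow> real ^ 'd" and \<alpha> :: "real \<Rightarrow> (nat \<Rightarrow> real ^ 'd) \<Rightarrow> nat \<Rightarrow> real ^ 'd"
    and Y :: "real \<Rightarrow> 'w \<Rightarrow> nat \<Rightarrow> real ^ 'd" and R L :: real
  assumes T: "0 < T" and BM: "independent_brownian_motions P T N B"
    and x0: "x0 \<in> space (states N)"
    and \<alpha>: "\<alpha> \<in> controls N T R L" and R: "0 \<le> R" and L: "0 \<le> L"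
    and sde: "solves_sde P T N B x0 \<alpha> Y"
begin

text \<open>Freezing time outside of \<open>{0..T}\<close> turns processes on \<open>{0..T}\<close> into processes on the real line,
  for which joint measurability is a statement about ordinary product spaces.\<close>

definition clamp_time :: "real \<Rightarrow> real" where "clamp_time t = max 0 (min T t)"

lemma clamp_time_in [simp]: "clamp_time t \<in> {0..T}" using T by (auto simp: clamp_time_def)
lemma clamp_time_id [simp]: "t \<in> {0..T} \<Longrightarrow> clamp_time t = t" by (auto simp: clamp_time_def)
lemma clamp_time_cont: "continuous_on S clamp_time" unfolding clamp_time_def[abs_def] by (intro continuous_intros)
lemma clamp_time_meas: "clamp_time \<in> borel \<rightarrow>\<^sub>M restrict_space borel {0..T}"
  by (rule measurable_restrict_space2) (use clamp_time_cont in \<open>auto intro!: borel_measurable_continuous_onI simp del: atLeastAtMost_iff\<close>)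

lemma clamp_time_meas' [measurable]: "clamp_time \<in> borel_measurable borel"
  by (rule borel_measurable_continuous_onI[OF clamp_time_cont])

lemma Y_meas: "Y (clamp_time t) \<in> P \<rightarrow>\<^sub>M states N"
  using sde clamp_time_in[of t] unfolding solves_sde_def by blast

lemma Y_space: "\<omega> \<in> space P \<Longrightarrow> Y (clamp_time t) \<omega> \<in> space (states N)"
  using measurable_space[OF Y_meas] .

lemma Y_cont: "\<omega> \<in> space P \<Longrightarrow> h < N \<Longrightarrow> continuous_on S (\<lambda>t. Y (clamp_time t) \<omega> h)"
  by (rule continuous_on_compose2[where f = clamp_time and t = "{0..T}"])
     (use sde clamp_time_cont in \<open>auto simp: solves_sde_def simp del: atLeastAtMost_iff\<close>)

lemma Y_joint: "(\<lambda>p. Y (clamp_time (fst p)) (snd p)) \<in> borel \<Otimes>\<^sub>M P \<rightarrow>\<^sub>M states N"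
proof (rule measurable_into_states)
  fix h assume h: "h < N"
  have "(\<lambda>(t, \<omega>). Y (clamp_time t) \<omega> h) \<in> borel_measurable (borel \<Otimes>\<^sub>M P)"
    by (rule continuous_process_measurable[OF measurable_compose[OF Y_meas measurable_states_comp[OF h]] Y_cont])
       (use h in auto)
  then show "(\<lambda>p. Y (clamp_time (fst p)) (snd p) h) \<in> borel_measurable (borel \<Otimes>\<^sub>M P)"
    by (simp add: case_prod_beta)
qed (auto simp: space_pair_measure Y_space)

lemma \<alpha>_meas: "(\<lambda>p. \<alpha> (clamp_time (fst p)) (snd p)) \<in> borel \<Otimes>\<^sub>M states N \<rightarrow>\<^sub>M states N"
proof -
  have "(\<lambda>p. (clamp_time (fst p), snd p)) \<in> borel \<Otimes>\<^sub>M states N \<rightarrow>\<^sub>M restrict_space borel {0..T} \<Otimes>\<^sub>M states N"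
    by (intro measurable_Pair measurable_compose[OF measurable_fst clamp_time_meas] measurable_snd)
  from measurable_compose[OF this, of "\<lambda>(t, x). \<alpha> t x" "states N"] show ?thesis
    using \<alpha> by (simp add: controls_def)
qed

lemma \<alpha>_meas1: "t \<in> {0..T} \<Longrightarrow> \<alpha> t \<in> states N \<rightarrow>\<^sub>M states N"
  using measurable_compose[OF measurable_Pair1'[of t borel "states N"] \<alpha>_meas] by simp

lemma \<alpha>_lip: "t \<in> {0..T} \<Longrightarrow> x \<in> space (states N) \<Longrightarrow> y \<in> space (states N) \<Longrightarrow>
    state_dist N (\<alpha> t x) (\<alpha> t y) \<le> L * state_dist N x y"
  using \<alpha> unfolding controls_def by blast

lemma \<alpha>_growth:
  assumes t: "t \<in> {0..T}" and x: "x \<in> space (states N)"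
  shows "state_norm N (\<alpha> t x) \<le> R + L * state_norm N x"
proof -
  have "state_norm N (\<alpha> t x) = state_norm N (\<lambda>h. (\<alpha> t x h - \<alpha> t (zero_state N) h) + \<alpha> t (zero_state N) h)"
    by simp
  also have "\<dots> \<le> state_dist N (\<alpha> t x) (\<alpha> t (zero_state N)) + state_norm N (\<alpha> t (zero_state N))"
    unfolding state_dist_norm by (rule state_norm_triangle)
  also have "\<dots> \<le> L * state_dist N x (zero_state N) + R"
    using \<alpha>_lip[OF t x zero_state_space] \<alpha> t by (auto simp: controls_def intro!: add_mono)
  also have "state_dist N x (zero_state N) = state_norm N x"
    unfolding state_dist_norm by (rule state_norm_cong) (simp add: zero_state_def)
  finally show ?thesis by simp
qed

definition drift :: "real \<Rightarrow> 'w \<Rightarrow> nat \<Rightarrow> real ^ 'd" where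
  "drift t \<omega> = \<alpha> (clamp_time t) (Y (clamp_time t) \<omega>)"

lemma drift_joint: "(\<lambda>p. drift (fst p) (snd p)) \<in> borel \<Otimes>\<^sub>M P \<rightarrow>\<^sub>M states N"
proof -
  have "(\<lambda>p. (fst p, Y (clamp_time (fst p)) (snd p))) \<in> borel \<Otimes>\<^sub>M P \<rightarrow>\<^sub>M borel \<Otimes>\<^sub>M states N"
    by (intro measurable_Pair Y_joint measurable_fst)
  from measurable_compose[OF this \<alpha>_meas] show ?thesis
    by (simp add: drift_def)
qed

definition state_size :: "real \<Rightarrow> 'w \<Rightarrow> real" where "state_size t \<omega> = state_norm N (Y (clamp_time t) \<omega>)"

lemma state_size_nonneg [simp]: "0 \<le> state_size t \<omega>" by (simp add: state_size_def)

lemma state_size_cont: "\<omega> \<in> space P \<Longrightarrow> continuous_on S (\<lambda>t. state_size t \<omega>)"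
  unfolding state_size_def state_norm_def L2_set_def by (intro continuous_intros Y_cont) auto

lemma drift_le: "\<omega> \<in> space P \<Longrightarrow> state_norm N (drift t \<omega>) \<le> R + L * state_size t \<omega>"
  unfolding drift_def state_size_def by (intro \<alpha>_growth clamp_time_in Y_space)

lemma drift_path_meas:
  assumes "\<omega> \<in> space P" "h < N"
  shows "(\<lambda>s. drift s \<omega> h) \<in> borel_measurable borel"
  using measurable_compose[OF measurable_Pair2'[OF assms(1)] measurable_compose[OF drift_joint measurable_states_comp[OF assms(2)]]]
  by simp

lemma growth_set_integrable: "\<omega> \<in> space P \<Longrightarrow> set_integrable lborel {a..b} (\<lambda>s. R + L * state_size s \<omega>)"
  by (intro borel_integrable_atLeastAtMost' continuous_intros state_size_cont)

lemma drift_set_integrable: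
  assumes "\<omega> \<in> space P" "h < N"
  shows "set_integrable lborel {a..b} (\<lambda>s. drift s \<omega> h)"
proof (rule set_integrable_bound[OF growth_set_integrable[OF assms(1), of a b]])
  show "set_borel_measurable lborel {a..b} (\<lambda>s. drift s \<omega> h)"
    using drift_path_meas[OF assms] unfolding set_borel_measurable_def by measurable
  have "norm (drift s \<omega> h) \<le> norm (R + L * state_size s \<omega>)" for s
    using norm_le_state_norm[OF assms(2), of "drift s \<omega>"] drift_le[OF assms(1), of s] by simp
  then show "AE s in lborel. s \<in> {a..b} \<longrightarrow> norm (drift s \<omega> h) \<le> norm (R + L * state_size s \<omega>)"
    by simp
qed

lemma drift_norm_set_integrable:
  assumes "\<omega> \<in> space P"
  shows "set_integrable lborel {a..b} (\<lambda>s. state_norm N (drift s \<omega>))"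
proof (rule set_integrable_bound[OF growth_set_integrable[OF assms(1), of a b]])
  have "(\<lambda>s. state_norm N (drift s \<omega>)) \<in> borel_measurable borel"
    using measurable_compose[OF measurable_Pair2'[OF assms(1)] measurable_compose[OF drift_joint state_norm_measurable]] by simp
  then show "set_borel_measurable lborel {a..b} (\<lambda>s. state_norm N (drift s \<omega>))"
    unfolding set_borel_measurable_def by measurable
  have "norm (state_norm N (drift s \<omega>)) \<le> norm (R + L * state_size s \<omega>)" for s
    using drift_le[OF assms(1), of s] by simp
  then show "AE s in lborel. s \<in> {a..b} \<longrightarrow> norm (state_norm N (drift s \<omega>)) \<le> norm (R + L * state_size s \<omega>)"
    by simp
qed

text \<open>Every path of the solution splits into an absolutely continuous part and a remainder. The
  remainder is defined as the difference, and not as \<open>\<surd>2 B\<close>, since the paths of \<open>B\<close> are continuous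
  almost surely only and \<open>B\<close> need not be jointly measurable.\<close>

definition drift_path :: "real \<Rightarrow> 'w \<Rightarrow> nat \<Rightarrow> real ^ 'd" where
  "drift_path t \<omega> h = x0 h + (LINT s:{0..clamp_time t}|lborel. drift s \<omega> h)"

lemma drift_path_joint [measurable]:
  assumes h: "h < N"
  shows "(\<lambda>p. drift_path (fst p) (snd p) h) \<in> borel_measurable (borel \<Otimes>\<^sub>M P)"
proof -
  have "(\<lambda>(p, s). indicator {0..clamp_time (fst p)} s *\<^sub>R drift s (snd p) h) \<in> borel_measurable ((borel \<Otimes>\<^sub>M P) \<Otimes>\<^sub>M lborel)"
  proof -
    have 1: "(\<lambda>q. drift (snd q) (snd (fst q)) h) \<in> borel_measurable ((borel \<Otimes>\<^sub>M P) \<Otimes>\<^sub>M lborel)"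
    proof -
      have "(\<lambda>q. (snd q, snd (fst q))) \<in> (borel \<Otimes>\<^sub>M P) \<Otimes>\<^sub>M lborel \<rightarrow>\<^sub>M borel \<Otimes>\<^sub>M P"
        by measurable
      from measurable_compose[OF this measurable_compose[OF drift_joint measurable_states_comp[OF h]]]
      show ?thesis by simp
    qed
    have 2: "(\<lambda>q. indicator {0..clamp_time (fst (fst q))} (snd q) :: real) = (\<lambda>q. if 0 \<le> snd q \<and> snd q \<le> clamp_time (fst (fst q)) then 1 else 0)"
      by (auto simp: fun_eq_iff)
    have "(\<lambda>q. indicator {0..clamp_time (fst (fst q))} (snd q) :: real) \<in> borel_measurable ((borel \<Otimes>\<^sub>M P) \<Otimes>\<^sub>M lborel)"
      unfolding 2 by measurable
    then show ?thesis
      unfolding case_prod_beta using 1 by (rule borel_measurable_scaleR)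
  qed
  then have "(\<lambda>p. LINT s|lborel. indicator {0..clamp_time (fst p)} s *\<^sub>R drift s (snd p) h) \<in> borel_measurable (borel \<Otimes>\<^sub>M P)"
    by (rule sigma_finite_measure.borel_measurable_lebesgue_integral[OF sigma_finite_lborel])
  then show ?thesis
    unfolding drift_path_def set_lebesgue_integral_def by simp
qed

definition noise :: "real \<Rightarrow> 'w \<Rightarrow> nat \<Rightarrow> real ^ 'd" where
  "noise t \<omega> h = Y (clamp_time t) \<omega> h - drift_path t \<omega> h"

lemma noise_joint:
  assumes h: "h < N"
  shows "(\<lambda>p. noise (fst p) (snd p) h) \<in> borel_measurable (borel \<Otimes>\<^sub>M P)"
  unfolding noise_def
  by (intro borel_measurable_diff drift_path_joint[OF h] measurable_compose[OF Y_joint measurable_states_comp[OF h]])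

lemma noise_AE: "AE \<omega> in P. \<forall>h<N. \<forall>t\<in>{0..T}. noise t \<omega> h = sqrt 2 *\<^sub>R B h t \<omega>"
proof -
  have "AE \<omega> in P. \<forall>i<N.
        set_integrable lborel {0..T} (\<lambda>s. \<alpha> s (Y s \<omega>) i) \<and>
        (\<forall>t\<in>{0..T}. Y t \<omega> i =
           x0 i + (LINT s:{0..t}|lborel. \<alpha> s (Y s \<omega>) i) + sqrt 2 *\<^sub>R B i t \<omega>)"
    using sde unfolding solves_sde_def by blast
  then show ?thesis
  proof eventually_elim
    case (elim \<omega>)
    show ?case
    proof (intro allI impI ballI)
      fix h t assume h: "h < N" and t: "t \<in> {0..T}"
      have "(LINT s:{0..t}|lborel. drift s \<omega> h) = (LINT s:{0..t}|lborel. \<alpha> s (Y s \<omega>) h)"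
        using t by (intro set_lebesgue_integral_cong) (auto simp: drift_def)
      moreover have "Y t \<omega> h = x0 h + (LINT s:{0..t}|lborel. \<alpha> s (Y s \<omega>) h) + sqrt 2 *\<^sub>R B h t \<omega>"
        using elim h t by blast
      ultimately show "noise t \<omega> h = sqrt 2 *\<^sub>R B h t \<omega>"
        using t by (simp add: noise_def drift_path_def)
    qed
  qed
qed

lemma BM1: "h < N \<Longrightarrow> brownian_motion1 P T (\<lambda>t \<omega>. B h t \<omega> $ k)"
  using BM by (simp add: independent_brownian_motions_def brownian_motion_def)

lemma B_cont_AE: "AE \<omega> in P. \<forall>h<N. \<forall>k. continuous_on {0..T} (\<lambda>t. B h t \<omega> $ k)"
proof -
  have "AE \<omega> in P. \<forall>h\<in>{..<N}. \<forall>k\<in>UNIV. continuous_on {0..T} (\<lambda>t. B h t \<omega> $ k)"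
  proof (intro AE_finite_allI)
    fix h k assume "h \<in> {..<N}"
    then show "AE \<omega> in P. continuous_on {0..T} (\<lambda>t. B h t \<omega> $ k)"
      using BM1[of h k] by (simp add: brownian_motion1_def)
  qed auto
  then show ?thesis by eventually_elim auto
qed

lemma B0_AE: "AE \<omega> in P. \<forall>h<N. B h 0 \<omega> = 0"
proof -
  have "AE \<omega> in P. \<forall>h\<in>{..<N}. \<forall>k\<in>UNIV. B h 0 \<omega> $ k = 0"
  proof (intro AE_finite_allI)
    fix h k assume "h \<in> {..<N}"
    then show "AE \<omega> in P. B h 0 \<omega> $ k = 0"
      using BM1[of h k] by (simp add: brownian_motion1_def)
  qed auto
  then show ?thesis by eventually_elim (auto simp: vec_eq_iff)
qed

lemma noise_meas:
  assumes h: "h < N"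
  shows "(\<lambda>\<omega>. noise t \<omega> h $ k) \<in> borel_measurable P"
proof -
  have "(\<lambda>\<omega>. (t, \<omega>)) \<in> P \<rightarrow>\<^sub>M borel \<Otimes>\<^sub>M P" by measurable
  from measurable_compose[OF this measurable_compose[OF noise_joint[OF h] vec_nth_borel]]
  show ?thesis by simp
qed

lemma noise_moments:
  assumes h: "h < N" and t: "t \<in> {0..T}"
  shows "integrable P (\<lambda>\<omega>. (noise t \<omega> h $ k)\<^sup>2)" "(LINT \<omega>|P. (noise t \<omega> h $ k)\<^sup>2) = 2 * t"
    "integrable P (\<lambda>\<omega>. noise t \<omega> h $ k)" "(LINT \<omega>|P. noise t \<omega> h $ k) = 0"
proof -
  have t': "0 \<le> t" "t \<le> T" using t by auto
  note bm = brownian_motion1_moments[OF prob_space_axioms BM1[OF h, of k] t']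
  have [measurable]: "(\<lambda>\<omega>. B h t \<omega> $ k) \<in> borel_measurable P"
    using BM1[OF h, of k] t by (simp add: brownian_motion1_def)
  note [measurable] = noise_meas[OF h]
  have ae: "AE \<omega> in P. noise t \<omega> h $ k = sqrt 2 * B h t \<omega> $ k"
    using noise_AE by eventually_elim (use h t in simp)
  then have ae2: "AE \<omega> in P. (noise t \<omega> h $ k)\<^sup>2 = 2 * (B h t \<omega> $ k)\<^sup>2"
    by eventually_elim (simp add: power_mult_distrib)
  have "integrable P (\<lambda>\<omega>. (noise t \<omega> h $ k)\<^sup>2) \<longleftrightarrow> integrable P (\<lambda>\<omega>. 2 * (B h t \<omega> $ k)\<^sup>2)"
    by (rule integrable_cong_AE[OF _ _ ae2]) auto
  then show "integrable P (\<lambda>\<omega>. (noise t \<omega> h $ k)\<^sup>2)" using bm(1) by simp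
  have "(LINT \<omega>|P. (noise t \<omega> h $ k)\<^sup>2) = (LINT \<omega>|P. 2 * (B h t \<omega> $ k)\<^sup>2)"
    by (rule integral_cong_AE[OF _ _ ae2]) auto
  then show "(LINT \<omega>|P. (noise t \<omega> h $ k)\<^sup>2) = 2 * t" using bm(3) by simp
  have "integrable P (\<lambda>\<omega>. noise t \<omega> h $ k) \<longleftrightarrow> integrable P (\<lambda>\<omega>. sqrt 2 * B h t \<omega> $ k)"
    by (rule integrable_cong_AE[OF _ _ ae]) auto
  then show "integrable P (\<lambda>\<omega>. noise t \<omega> h $ k)" using bm(4) by simp
  have "(LINT \<omega>|P. noise t \<omega> h $ k) = (LINT \<omega>|P. sqrt 2 * B h t \<omega> $ k)"
    by (rule integral_cong_AE[OF _ _ ae]) auto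
  then show "(LINT \<omega>|P. noise t \<omega> h $ k) = 0" using bm(2) by simp
qed

end

section \<open>Second moments\<close>

lemma integral_square_le:
  fixes v :: "real \<Rightarrow> real"
  assumes v: "continuous_on {0..T} v" and T: "0 < T"
  shows "(integral {0..T} v)\<^sup>2 \<le> T * integral {0..T} (\<lambda>s. (v s)\<^sup>2)"
proof -
  define m where "m = integral {0..T} v / T"
  have i: "v integrable_on {0..T}" "(\<lambda>s. (v s)\<^sup>2) integrable_on {0..T}"
    by (intro integrable_continuous_real continuous_intros v)+
  have "0 \<le> integral {0..T} (\<lambda>s. (v s - m)\<^sup>2)"
    by (intro Henstock_Kurzweil_Integration.integral_nonneg integrable_continuous_real continuous_intros v) auto
  also have "(\<lambda>s. (v s - m)\<^sup>2) = (\<lambda>s. (v s)\<^sup>2 - (2 * m) * v s + m\<^sup>2)"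
    by (simp add: power2_eq_square algebra_simps)
  also have "integral {0..T} \<dots> = integral {0..T} (\<lambda>s. (v s)\<^sup>2) - (2 * m) * integral {0..T} v + T * m\<^sup>2"
  proof -
    have "((\<lambda>s. (v s)\<^sup>2 - (2 * m) * v s + m\<^sup>2) has_integral
        (integral {0..T} (\<lambda>s. (v s)\<^sup>2) - (2 * m) * integral {0..T} v + (T - 0) *\<^sub>R m\<^sup>2)) {0..T}"
      by (intro has_integral_add has_integral_diff has_integral_mult_right integrable_integral i
            has_integral_const_real[THEN has_integral_eq_rhs]) (use T in auto)
    then show ?thesis by (simp add: integral_unique)
  qed
  finally have "0 \<le> T * (integral {0..T} (\<lambda>s. (v s)\<^sup>2) - (2 * m) * integral {0..T} v + T * m\<^sup>2)"
    using T by simp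
  also have "\<dots> = T * integral {0..T} (\<lambda>s. (v s)\<^sup>2) - (integral {0..T} v)\<^sup>2"
    using T by (simp add: m_def power2_eq_square field_simps)
  finally show ?thesis by simp
qed

context controlled_sde
begin

definition noise_size :: "real \<Rightarrow> 'w \<Rightarrow> real" where "noise_size t \<omega> = state_norm N (noise t \<omega>)"

lemma noise_size_square: "(noise_size t \<omega>)\<^sup>2 = (\<Sum>h<N. \<Sum>k\<in>UNIV. (noise t \<omega> h $ k)\<^sup>2)"
  by (simp add: noise_size_def state_norm_square_comp)

lemma noise_size_square_joint [measurable]: "(\<lambda>p. (noise_size (fst p) (snd p))\<^sup>2) \<in> borel_measurable (borel \<Otimes>\<^sub>M P)"
  unfolding noise_size_square
  by (intro borel_measurable_sum borel_measurable_power measurable_compose[OF noise_joint vec_nth_borel]) auto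

text \<open>There are \<open>N * CARD('d)\<close> scalar noise components, each of variance \<open>2 t\<close>.\<close>

lemma noise_size_square_moment:
  assumes t: "t \<in> {0..T}"
  shows "integrable P (\<lambda>\<omega>. (noise_size t \<omega>)\<^sup>2)" "(LINT \<omega>|P. (noise_size t \<omega>)\<^sup>2) = 2 * real N * real CARD('d) * t"
  unfolding noise_size_square using noise_moments[OF _ t]
  by (auto intro!: Bochner_Integration.integrable_sum simp: Bochner_Integration.integral_sum)

lemma noise_size_cont_AE: "AE \<omega> in P. continuous_on {0..T} (\<lambda>t. noise_size t \<omega>)"
  using noise_AE B_cont_AE
proof eventually_elim
  case (elim \<omega>)
  have Veq: "noise_size t \<omega> = sqrt (\<Sum>h<N. \<Sum>k\<in>UNIV. (noise t \<omega> h $ k)\<^sup>2)" for t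
    unfolding noise_size_square[symmetric] by (simp add: noise_size_def)
  have "continuous_on {0..T} (\<lambda>t. sqrt (\<Sum>h<N. \<Sum>k\<in>UNIV. (sqrt 2 * B h t \<omega> $ k)\<^sup>2))"
    by (intro continuous_on_real_sqrt continuous_on_sum continuous_on_power continuous_on_mult_left)
       (use elim(2) in auto)
  then show ?case
    by (rule continuous_on_eq) (use elim(1) in \<open>simp add: Veq\<close>)
qed

text \<open>Minkowski's inequality in the state space keeps the factor in front of the integral equal to
  the Lipschitz constant, so that the exponential in Gronwall's inequality does not depend on \<open>N\<close>.\<close>

lemma state_size_path_le:
  assumes \<omega>: "\<omega> \<in> space P" and t: "t \<in> {0..T}"
  shows "state_size t \<omega> \<le> (state_norm N x0 + R * T + noise_size t \<omega>) + L * integral {0..t} (\<lambda>s. state_size s \<omega>)"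
proof -
  let ?I = "\<lambda>h. LINT s:{0..t}|lborel. drift s \<omega> h"
  have "state_size t \<omega> = state_norm N (\<lambda>h. (x0 h + ?I h) + noise t \<omega> h)"
    using t by (simp add: state_size_def noise_def drift_path_def)
  also have "\<dots> \<le> state_norm N (\<lambda>h. x0 h + ?I h) + noise_size t \<omega>"
    unfolding noise_size_def by (rule state_norm_triangle)
  also have "state_norm N (\<lambda>h. x0 h + ?I h) \<le> state_norm N x0 + state_norm N ?I"
    by (rule state_norm_triangle)
  also have "state_norm N ?I \<le> (LINT s:{0..t}|lborel. state_norm N (drift s \<omega>))"
    by (intro state_norm_set_integral_le drift_set_integrable drift_norm_set_integrable \<omega>)
  also have "\<dots> \<le> (LINT s:{0..t}|lborel. R + L * state_size s \<omega>)"
    by (rule set_integral_mono[OF drift_norm_set_integrable[OF \<omega>] growth_set_integrable[OF \<omega>] drift_le[OF \<omega>]])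
  also have "\<dots> = integral {0..t} (\<lambda>s. R + L * state_size s \<omega>)"
    by (rule set_borel_integral_eq_integral(2)[OF growth_set_integrable[OF \<omega>]])
  also have "\<dots> = R * t + L * integral {0..t} (\<lambda>s. state_size s \<omega>)"
  proof -
    have i: "(\<lambda>s. state_size s \<omega>) integrable_on {0..t}"
      by (intro integrable_continuous_real state_size_cont \<omega>)
    have "((\<lambda>s. R + L * state_size s \<omega>) has_integral (t - 0) *\<^sub>R R + L * integral {0..t} (\<lambda>s. state_size s \<omega>)) {0..t}"
      by (intro has_integral_add has_integral_mult_right integrable_integral i
          has_integral_const_real[THEN has_integral_eq_rhs]) (use t in auto)
    then show ?thesis by (simp add: integral_unique mult.commute)
  qed
  also have "R * t \<le> R * T"
    using t R by (intro mult_left_mono) auto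
  finally show ?thesis by simp
qed

text \<open>The factor of the integral of the inhomogeneity in Gronwall's inequality.\<close>

definition \<kappa> :: real where "\<kappa> = L * exp (L * T)"

lemma state_size_square_path_le:
  assumes \<omega>: "\<omega> \<in> space P" and noise_size: "continuous_on {0..T} (\<lambda>t. noise_size t \<omega>)" and t: "t \<in> {0..T}"
  shows "(state_size t \<omega>)\<^sup>2 \<le> 3 * (((state_norm N x0 + R * T) * (1 + \<kappa> * T))\<^sup>2 + (noise_size t \<omega>)\<^sup>2
    + \<kappa>\<^sup>2 * T * integral {0..T} (\<lambda>s. (noise_size s \<omega>)\<^sup>2))"
proof -
  let ?k = "state_norm N x0 + R * T"
  have V0: "0 \<le> noise_size s \<omega>" for s by (simp add: noise_size_def)
  have k0: "0 \<le> ?k" using R T by simp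
  have "state_size t \<omega> \<le> (?k + noise_size t \<omega>) + L * exp (L * T) * integral {0..T} (\<lambda>s. ?k + noise_size s \<omega>)"
  proof (rule gronwall_integral[OF L state_size_cont[OF \<omega>]])
    show "continuous_on {0..T} (\<lambda>s. ?k + noise_size s \<omega>)"
      by (intro continuous_intros noise_size)
    show "0 \<le> ?k + noise_size s \<omega>" for s using V0 k0 by (rule add_nonneg_nonneg[rotated])
  qed (use state_size_path_le[OF \<omega>] t in auto)
  also have "integral {0..T} (\<lambda>s. ?k + noise_size s \<omega>) = ?k * T + integral {0..T} (\<lambda>s. noise_size s \<omega>)"
  proof -
    have "((\<lambda>s. ?k + noise_size s \<omega>) has_integral (T - 0) *\<^sub>R ?k + integral {0..T} (\<lambda>s. noise_size s \<omega>)) {0..T}"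
      by (intro has_integral_add integrable_integral integrable_continuous_real noise_size
          has_integral_const_real[THEN has_integral_eq_rhs]) (use T in auto)
    then show ?thesis by (simp add: integral_unique mult.commute)
  qed
  finally have "state_size t \<omega> \<le> ?k * (1 + \<kappa> * T) + noise_size t \<omega> + \<kappa> * integral {0..T} (\<lambda>s. noise_size s \<omega>)"
    by (simp add: \<kappa>_def algebra_simps)
  then have "(state_size t \<omega>)\<^sup>2 \<le> (?k * (1 + \<kappa> * T) + noise_size t \<omega> + \<kappa> * integral {0..T} (\<lambda>s. noise_size s \<omega>))\<^sup>2"
    by (intro power_mono) auto
  also have "\<dots> \<le> 3 * ((?k * (1 + \<kappa> * T))\<^sup>2 + (noise_size t \<omega>)\<^sup>2 + (\<kappa> * integral {0..T} (\<lambda>s. noise_size s \<omega>))\<^sup>2)"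
  proof -
    have "(a + b + c)\<^sup>2 \<le> 3 * (a\<^sup>2 + b\<^sup>2 + c\<^sup>2)" for a b c :: real
      using sum_squares_ge_zero[of "a - b" "b - c"] zero_le_power2[of "a - c"]
      by (simp add: power2_eq_square algebra_simps)
    then show ?thesis .
  qed
  also have "(\<kappa> * integral {0..T} (\<lambda>s. noise_size s \<omega>))\<^sup>2 \<le> \<kappa>\<^sup>2 * (T * integral {0..T} (\<lambda>s. (noise_size s \<omega>)\<^sup>2))"
    unfolding power_mult_distrib by (intro mult_left_mono integral_square_le noise_size T) auto
  finally show ?thesis by (simp add: mult.assoc)
qed

definition moment_bound :: real where
  "moment_bound = 3 * (((state_norm N x0 + R * T) * (1 + \<kappa> * T))\<^sup>2 + 2 * real N * real CARD('d) * T * (1 + (\<kappa> * T)\<^sup>2))"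

lemma moment_bound_nonneg: "0 \<le> moment_bound" unfolding moment_bound_def using T by simp

lemma noise_size_path_nn:
  assumes noise_size: "continuous_on {0..T} (\<lambda>t. noise_size t \<omega>)"
  shows "ennreal (integral {0..T} (\<lambda>s. (noise_size s \<omega>)\<^sup>2)) = (\<integral>\<^sup>+s. ennreal (indicator {0..T} s * (noise_size s \<omega>)\<^sup>2) \<partial>lborel)"
proof -
  have c: "continuous_on {0..T} (\<lambda>s. (noise_size s \<omega>)\<^sup>2)"
    by (intro continuous_intros noise_size)
  have si: "set_integrable lborel {0..T} (\<lambda>s. (noise_size s \<omega>)\<^sup>2)"
    by (rule borel_integrable_atLeastAtMost'[OF c])
  have "(LINT s:{0..T}|lborel. (noise_size s \<omega>)\<^sup>2) = integral {0..T} (\<lambda>s. (noise_size s \<omega>)\<^sup>2)"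
    by (rule set_borel_integral_eq_integral(2)[OF si])
  then show ?thesis
    using si by (subst nn_integral_eq_integral) (auto simp: set_integrable_def set_lebesgue_integral_def)
qed

lemma noise_size_double_nn: "(\<integral>\<^sup>+\<omega>. (\<integral>\<^sup>+s. ennreal (indicator {0..T} s * (noise_size s \<omega>)\<^sup>2) \<partial>lborel) \<partial>P)
   \<le> ennreal (2 * real N * real CARD('d) * T * T)"
proof -
  interpret pair_sigma_finite lborel P
    by (intro pair_sigma_finite.intro sigma_finite_lborel sigma_finite_measure_axioms)
  have m: "(\<lambda>(s, \<omega>). ennreal (indicator {0..T} s * (noise_size s \<omega>)\<^sup>2)) \<in> borel_measurable (lborel \<Otimes>\<^sub>M P)"
    using noise_size_square_joint by (simp add: case_prod_beta)
  have "(\<integral>\<^sup>+\<omega>. (\<integral>\<^sup>+s. ennreal (indicator {0..T} s * (noise_size s \<omega>)\<^sup>2) \<partial>lborel) \<partial>P)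
     = (\<integral>\<^sup>+s. (\<integral>\<^sup>+\<omega>. ennreal (indicator {0..T} s * (noise_size s \<omega>)\<^sup>2) \<partial>P) \<partial>lborel)"
    by (rule Fubini'[OF m])
  also have "\<dots> \<le> (\<integral>\<^sup>+s. ennreal (2 * real N * real CARD('d) * T) * indicator {0..T} s \<partial>lborel)"
  proof (rule nn_integral_mono)
    fix s :: real
    show "(\<integral>\<^sup>+\<omega>. ennreal (indicator {0..T} s * (noise_size s \<omega>)\<^sup>2) \<partial>P) \<le> ennreal (2 * real N * real CARD('d) * T) * indicator {0..T} s"
    proof (cases "s \<in> {0..T}")
      case True
      have "(\<integral>\<^sup>+\<omega>. ennreal ((noise_size s \<omega>)\<^sup>2) \<partial>P) = ennreal (2 * real N * real CARD('d) * s)"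
        using noise_size_square_moment[OF True] by (subst nn_integral_eq_integral) auto
      also have "\<dots> \<le> ennreal (2 * real N * real CARD('d) * T)"
        using True by (intro ennreal_leI mult_left_mono) auto
      finally show ?thesis using True by simp
    qed simp
  qed
  also have "\<dots> = ennreal (2 * real N * real CARD('d) * T) * ennreal T"
    using T by (subst nn_integral_cmult_indicator) auto
  also have "\<dots> = ennreal (2 * real N * real CARD('d) * T * T)"
    using T by (simp add: ennreal_mult)
  finally show ?thesis .
qed

lemma state_size_meas [measurable]: "state_size t \<in> borel_measurable P"
  unfolding state_size_def[abs_def] by (rule measurable_compose[OF Y_meas state_norm_measurable])

text \<open>The squared pathwise Gronwall bound is integrated over the probability space. A pathwise bound has to come
  first: it shows that the second moment is finite.\<close>

lemma state_size_square_moment: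
  assumes t: "t \<in> {0..T}"
  shows "integrable P (\<lambda>\<omega>. (state_size t \<omega>)\<^sup>2)" "(LINT \<omega>|P. (state_size t \<omega>)\<^sup>2) \<le> moment_bound"
proof -
  let ?c = "((state_norm N x0 + R * T) * (1 + \<kappa> * T))\<^sup>2"
  let ?D = "2 * real N * real CARD('d) * T"
  let ?I = "\<lambda>\<omega>. \<integral>\<^sup>+s. ennreal (indicator {0..T} s * (noise_size s \<omega>)\<^sup>2) \<partial>lborel"
  have \<kappa>T: "0 \<le> \<kappa>\<^sup>2 * T" using T by simp
  have [measurable]: "(\<lambda>\<omega>. (noise_size t \<omega>)\<^sup>2) \<in> borel_measurable P"
    using noise_size_square_moment(1)[OF t] by (rule borel_measurable_integrable)
  have Vm: "(\<lambda>(\<omega>, s). ennreal (indicator {0..T} s * (noise_size s \<omega>)\<^sup>2)) \<in> borel_measurable (P \<Otimes>\<^sub>M lborel)"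
  proof -
    have "(\<lambda>q. (snd q, fst q)) \<in> P \<Otimes>\<^sub>M lborel \<rightarrow>\<^sub>M borel \<Otimes>\<^sub>M P" by measurable
    from measurable_compose[OF this noise_size_square_joint]
    have [measurable]: "(\<lambda>q. (noise_size (snd q) (fst q))\<^sup>2) \<in> borel_measurable (P \<Otimes>\<^sub>M lborel)" by simp
    show ?thesis unfolding case_prod_beta by measurable
  qed
  have Im [measurable]: "?I \<in> borel_measurable P"
    by (rule sigma_finite_measure.borel_measurable_nn_integral[OF sigma_finite_lborel Vm])
  have "(\<integral>\<^sup>+\<omega>. ennreal ((state_size t \<omega>)\<^sup>2) \<partial>P) \<le> (\<integral>\<^sup>+\<omega>. 3 * (ennreal ?c + ennreal ((noise_size t \<omega>)\<^sup>2) + ennreal (\<kappa>\<^sup>2 * T) * ?I \<omega>) \<partial>P)"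
  proof (rule nn_integral_mono_AE)
    show "AE \<omega> in P. ennreal ((state_size t \<omega>)\<^sup>2) \<le> 3 * (ennreal ?c + ennreal ((noise_size t \<omega>)\<^sup>2) + ennreal (\<kappa>\<^sup>2 * T) * ?I \<omega>)"
      using noise_size_cont_AE AE_space
    proof eventually_elim
      case (elim \<omega>)
      have i0: "0 \<le> integral {0..T} (\<lambda>s. (noise_size s \<omega>)\<^sup>2)"
        by (intro Henstock_Kurzweil_Integration.integral_nonneg integrable_continuous_real continuous_intros elim) auto
      have "ennreal ((state_size t \<omega>)\<^sup>2) \<le> ennreal (3 * (?c + (noise_size t \<omega>)\<^sup>2 + \<kappa>\<^sup>2 * T * integral {0..T} (\<lambda>s. (noise_size s \<omega>)\<^sup>2)))"
        by (rule ennreal_leI[OF state_size_square_path_le[OF elim(2,1) t]])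
      also have "\<dots> = 3 * (ennreal ?c + ennreal ((noise_size t \<omega>)\<^sup>2) + ennreal (\<kappa>\<^sup>2 * T) * ennreal (integral {0..T} (\<lambda>s. (noise_size s \<omega>)\<^sup>2)))"
        using i0 \<kappa>T by (simp add: ennreal_mult ennreal_plus)
      finally show ?case
        by (simp only: noise_size_path_nn[OF elim(1)])
    qed
  qed
  also have "\<dots> = 3 * (ennreal ?c + (\<integral>\<^sup>+\<omega>. ennreal ((noise_size t \<omega>)\<^sup>2) \<partial>P) + ennreal (\<kappa>\<^sup>2 * T) * (\<integral>\<^sup>+\<omega>. ?I \<omega> \<partial>P))"
    by (simp add: nn_integral_cmult nn_integral_add emeasure_space_1)
  also have "\<dots> \<le> 3 * (ennreal ?c + ennreal ?D + ennreal (\<kappa>\<^sup>2 * T) * ennreal (?D * T))"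
  proof (intro mult_left_mono add_mono order_refl noise_size_double_nn)
    have "(\<integral>\<^sup>+\<omega>. ennreal ((noise_size t \<omega>)\<^sup>2) \<partial>P) = ennreal (2 * real N * real CARD('d) * t)"
      using noise_size_square_moment[OF t] by (subst nn_integral_eq_integral) auto
    also have "\<dots> \<le> ennreal ?D"
      using t by (intro ennreal_leI mult_left_mono) auto
    finally show "(\<integral>\<^sup>+\<omega>. ennreal ((noise_size t \<omega>)\<^sup>2) \<partial>P) \<le> ennreal ?D" .
  qed auto
  also have "\<dots> = ennreal (3 * (?c + ?D + \<kappa>\<^sup>2 * T * (?D * T)))"
  proof -
    have "3 * (ennreal a + ennreal b + ennreal c * ennreal d) = ennreal (3 * (a + b + c * d))"
      if "0 \<le> a" "0 \<le> b" "0 \<le> c" "0 \<le> d" for a b c d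
      using that by (simp add: ennreal_mult ennreal_plus)
    then show ?thesis using T \<kappa>T by simp
  qed
  also have "3 * (?c + ?D + \<kappa>\<^sup>2 * T * (?D * T)) = moment_bound"
    by (simp add: moment_bound_def power2_eq_square algebra_simps)
  finally have le: "(\<integral>\<^sup>+\<omega>. ennreal ((state_size t \<omega>)\<^sup>2) \<partial>P) \<le> ennreal moment_bound" .
  show int: "integrable P (\<lambda>\<omega>. (state_size t \<omega>)\<^sup>2)"
    by (rule integrableI_bounded) (use le in \<open>auto simp: order_le_less_trans[OF _ ennreal_less_top]\<close>)
  show "(LINT \<omega>|P. (state_size t \<omega>)\<^sup>2) \<le> moment_bound"
    using le moment_bound_nonneg by (subst (asm) nn_integral_eq_integral[OF int]) (auto simp: ennreal_le_iff)
qed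

end

section \<open>Orthogonality of drift and later noise\<close>

text \<open>An Euler scheme along the grid \<open>\<tau>\<close> that freezes the state, but not the time, in the control: the
  control need not be continuous in time. The Brownian increments enter as an explicit argument \<open>\<xi>\<close>,
  indexed by player, coordinate and step.\<close>

primrec euler :: "nat \<Rightarrow> (nat \<Rightarrow> real ^ 'd::finite) \<Rightarrow> (real \<Rightarrow> (nat \<Rightarrow> real ^ 'd) \<Rightarrow> nat \<Rightarrow> real ^ 'd)
    \<Rightarrow> (nat \<Rightarrow> real) \<Rightarrow> (nat \<times> 'd \<times> nat \<Rightarrow> real) \<Rightarrow> nat \<Rightarrow> nat \<Rightarrow> real ^ 'd" where
  "euler N x0 a \<tau> \<xi> 0 = x0"
| "euler N x0 a \<tau> \<xi> (Suc j) = (\<lambda>i\<in>{..<N}. euler N x0 a \<tau> \<xi> j i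
     + (LINT r:{\<tau> j<..\<tau> (Suc j)}|lborel. a r (euler N x0 a \<tau> \<xi> j) i) + sqrt 2 *\<^sub>R (\<chi> k. \<xi> (i, k, j)))"

declare euler.simps(2) [simp del]

context controlled_sde
begin

abbreviation eul :: "(nat \<Rightarrow> real) \<Rightarrow> (nat \<times> 'd \<times> nat \<Rightarrow> real) \<Rightarrow> nat \<Rightarrow> nat \<Rightarrow> real ^ 'd" where
  "eul \<equiv> euler N x0 (\<lambda>r. \<alpha> (clamp_time r))"

lemma eul_space: "eul \<tau> \<xi> j \<in> space (states N)"
  using x0 by (cases j) (auto simp: space_states euler.simps(2))

lemma eul_measurable:
  "j \<le> n \<Longrightarrow> (\<lambda>\<xi>. eul \<tau> \<xi> j) \<in> Pi\<^sub>M ({..<N} \<times> UNIV \<times> {..<n}) (\<lambda>_. borel) \<rightarrow>\<^sub>M states N"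
proof (induction j)
  case 0
  then show ?case using x0 by simp
next
  case (Suc j)
  let ?M = "Pi\<^sub>M ({..<N} \<times> UNIV \<times> {..<n}) (\<lambda>_. borel :: real measure) :: (nat \<times> 'd \<times> nat \<Rightarrow> real) measure"
  have IH: "(\<lambda>\<xi>. eul \<tau> \<xi> j) \<in> ?M \<rightarrow>\<^sub>M states N"
    using Suc by simp
  show ?case
  proof (rule measurable_into_states)
    fix h assume h: "h < N"
    have 1: "(\<lambda>\<xi>. eul \<tau> \<xi> j h) \<in> borel_measurable ?M"
      by (rule measurable_compose[OF IH measurable_states_comp[OF h]])
    have "(\<lambda>(\<xi>, r). indicator {\<tau> j<..\<tau> (Suc j)} r *\<^sub>R \<alpha> (clamp_time r) (eul \<tau> \<xi> j) h) \<in> borel_measurable (?M \<Otimes>\<^sub>M lborel)"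
    proof -
      have "(\<lambda>q. (snd q, eul \<tau> (fst q) j)) \<in> ?M \<Otimes>\<^sub>M lborel \<rightarrow>\<^sub>M borel \<Otimes>\<^sub>M states N"
        by (intro measurable_Pair measurable_compose[OF measurable_fst IH]) simp
      from measurable_compose[OF this measurable_compose[OF \<alpha>_meas measurable_states_comp[OF h]]]
      have "(\<lambda>q. \<alpha> (clamp_time (snd q)) (eul \<tau> (fst q) j) h) \<in> borel_measurable (?M \<Otimes>\<^sub>M lborel)"
        by simp
      moreover have "(\<lambda>q. indicator {\<tau> j<..\<tau> (Suc j)} (snd q) :: real) \<in> borel_measurable (?M \<Otimes>\<^sub>M lborel)"
        by measurable
      ultimately show ?thesis
        unfolding case_prod_beta by (intro borel_measurable_scaleR)
    qed
    then have 2: "(\<lambda>\<xi>. LINT r:{\<tau> j<..\<tau> (Suc j)}|lborel. \<alpha> (clamp_time r) (eul \<tau> \<xi> j) h) \<in> borel_measurable ?M"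
      unfolding set_lebesgue_integral_def
      by (rule sigma_finite_measure.borel_measurable_lebesgue_integral[OF sigma_finite_lborel])
    have 3: "(\<lambda>\<xi>. \<chi> k. \<xi> (h, k, j)) \<in> borel_measurable ?M"
    proof -
      have "(\<lambda>\<xi>. (\<chi> k. \<xi> (h, k, j)) \<bullet> b) \<in> borel_measurable ?M" if b: "b \<in> Basis" for b :: "real ^ 'd"
      proof -
        obtain k where "b = axis k 1" using b by (auto simp: Basis_vec_def)
        then have "(\<lambda>\<xi>::nat \<times> 'd \<times> nat \<Rightarrow> real. (\<chi> k. \<xi> (h, k, j)) \<bullet> b) = (\<lambda>\<xi>. \<xi> (h, k, j))"
          by (auto simp: inner_axis)
        then show ?thesis
          using h Suc.prems by (auto intro!: measurable_component_singleton)
      qed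
      then show ?thesis by (subst borel_measurable_euclidean_space) blast
    qed
    show "(\<lambda>\<xi>. eul \<tau> \<xi> (Suc j) h) \<in> borel_measurable ?M"
      using h 1 2 3 by (simp add: euler.simps(2))
  qed (rule eul_space)
qed

lemma \<alpha>_path_set_integrable:
  assumes x: "x \<in> space (states N)" and h: "h < N"
  shows "set_integrable lborel {a<..b} (\<lambda>s. \<alpha> (clamp_time s) x h)"
proof -
  have "set_integrable lborel {a..b} (\<lambda>s::real. R + L * state_norm N x)"
    by (intro borel_integrable_atLeastAtMost' continuous_intros)
  then have "set_integrable lborel {a<..b} (\<lambda>s::real. R + L * state_norm N x)"
    by (rule set_integrable_subset) auto
  then show ?thesis
  proof (rule set_integrable_bound)
    have "(\<lambda>s. \<alpha> (clamp_time s) x h) \<in> borel_measurable borel"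
      using measurable_compose[OF measurable_Pair2'[OF x] measurable_compose[OF \<alpha>_meas measurable_states_comp[OF h]]] by simp
    then show "set_borel_measurable lborel {a<..b} (\<lambda>s. \<alpha> (clamp_time s) x h)"
      unfolding set_borel_measurable_def by measurable
    have "norm (\<alpha> (clamp_time s) x h) \<le> norm (R + L * state_norm N x)" for s
      using norm_le_state_norm[OF h, of "\<alpha> (clamp_time s) x"] \<alpha>_growth[OF clamp_time_in x, of s] by simp
    then show "AE s in lborel. s \<in> {a<..b} \<longrightarrow> norm (\<alpha> (clamp_time s) x h) \<le> norm (R + L * state_norm N x)"
      by simp
  qed
qed

lemma drift_diff_set_integrable:
  assumes \<omega>: "\<omega> \<in> space P" and x: "x \<in> space (states N)"
  shows "set_integrable lborel {a<..b} (\<lambda>s. state_norm N (\<lambda>h. drift s \<omega> h - \<alpha> (clamp_time s) x h))"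
proof -
  have "set_integrable lborel {a..b} (\<lambda>s. L * state_norm N (\<lambda>h. Y (clamp_time s) \<omega> h - x h))"
    unfolding state_norm_def L2_set_def
    by (intro borel_integrable_atLeastAtMost' continuous_on_mult_left continuous_on_real_sqrt continuous_on_sum
        continuous_on_power continuous_on_norm continuous_on_diff Y_cont \<omega> continuous_on_const) auto
  then have "set_integrable lborel {a<..b} (\<lambda>s. L * state_norm N (\<lambda>h. Y (clamp_time s) \<omega> h - x h))"
    by (rule set_integrable_subset) auto
  then show ?thesis
  proof (rule set_integrable_bound)
    have "(\<lambda>s. sqrt (\<Sum>h<N. (norm (drift s \<omega> h - \<alpha> (clamp_time s) x h))\<^sup>2)) \<in> borel_measurable borel"
    proof (rule measurable_compose[OF _ borel_measurable_sqrt], rule borel_measurable_sum)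
      fix h assume "h \<in> {..<N}"
      then have h: "h < N" by simp
      have [measurable]: "(\<lambda>s. \<alpha> (clamp_time s) x h) \<in> borel_measurable borel"
        using measurable_compose[OF measurable_Pair2'[OF x] measurable_compose[OF \<alpha>_meas measurable_states_comp[OF h]]] by simp
      note [measurable] = drift_path_meas[OF \<omega> h]
      show "(\<lambda>s. (norm (drift s \<omega> h - \<alpha> (clamp_time s) x h))\<^sup>2) \<in> borel_measurable borel"
        by measurable
    qed
    then show "set_borel_measurable lborel {a<..b} (\<lambda>s. state_norm N (\<lambda>h. drift s \<omega> h - \<alpha> (clamp_time s) x h))"
      unfolding set_borel_measurable_def state_norm_def L2_set_def by measurable
    have "norm (state_norm N (\<lambda>h. drift s \<omega> h - \<alpha> (clamp_time s) x h)) \<le> norm (L * state_norm N (\<lambda>h. Y (clamp_time s) \<omega> h - x h))" for s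
      using \<alpha>_lip[OF clamp_time_in Y_space[OF \<omega>] x, of s s] L by (simp add: drift_def state_dist_norm)
    then show "AE s in lborel. s \<in> {a<..b} \<longrightarrow> norm (state_norm N (\<lambda>h. drift s \<omega> h - \<alpha> (clamp_time s) x h)) \<le> norm (L * state_norm N (\<lambda>h. Y (clamp_time s) \<omega> h - x h))"
      by simp
  qed
qed

lemma euler_step:
  assumes \<omega>: "\<omega> \<in> space P"
    and eq: "\<forall>h<N. \<forall>t\<in>{0..T}. noise t \<omega> h = sqrt 2 *\<^sub>R B h t \<omega>"
    and ab: "0 \<le> a" "a \<le> b" "b \<le> T" and x: "x \<in> space (states N)"
    and osc: "\<And>r. r \<in> {a<..b} \<Longrightarrow> state_dist N (Y r \<omega>) (Y a \<omega>) \<le> \<epsilon>"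
    and y: "\<And>h. h < N \<Longrightarrow> y h = x h + (LINT r:{a<..b}|lborel. \<alpha> (clamp_time r) x h) + sqrt 2 *\<^sub>R (B h b \<omega> - B h a \<omega>)"
  shows "state_dist N (Y b \<omega>) y \<le> state_dist N (Y a \<omega>) x + (b - a) * (L * (\<epsilon> + state_dist N (Y a \<omega>) x))"
proof -
  have Yb: "Y b \<omega> h = Y a \<omega> h + (LINT r:{a<..b}|lborel. drift r \<omega> h) + sqrt 2 *\<^sub>R (B h b \<omega> - B h a \<omega>)" if h: "h < N" for h
  proof -
    have sp: "(LINT s:{0..b}|lborel. drift s \<omega> h) = (LINT s:{0..a}|lborel. drift s \<omega> h) + (LINT s:{a<..b}|lborel. drift s \<omega> h)"
      by (rule set_integral_split) (use ab drift_set_integrable[OF \<omega> h] in auto)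
    have "noise b \<omega> h = sqrt 2 *\<^sub>R B h b \<omega>" "noise a \<omega> h = sqrt 2 *\<^sub>R B h a \<omega>"
      using eq h ab by auto
    then show ?thesis
      using sp ab by (simp add: noise_def drift_path_def scaleR_diff_right algebra_simps)
  qed
  have di: "set_integrable lborel {a<..b} (\<lambda>r. drift r \<omega> h)" if "h < N" for h
    by (rule set_integrable_subset[OF drift_set_integrable[OF \<omega> that, of a b]]) auto
  let ?D = "\<lambda>h. LINT r:{a<..b}|lborel. (drift r \<omega> h - \<alpha> (clamp_time r) x h)"
  have "state_dist N (Y b \<omega>) y = state_norm N (\<lambda>h. (Y a \<omega> h - x h) + ?D h)"
    unfolding state_dist_norm
  proof (rule state_norm_cong)
    fix h assume h: "h < N"
    have "?D h = (LINT r:{a<..b}|lborel. drift r \<omega> h) - (LINT r:{a<..b}|lborel. \<alpha> (clamp_time r) x h)"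
      by (rule set_integral_diff(2)[OF di[OF h] \<alpha>_path_set_integrable[OF x h]])
    then show "Y b \<omega> h - y h = (Y a \<omega> h - x h) + ?D h"
      using Yb[OF h] y[OF h] by simp
  qed
  also have "\<dots> \<le> state_dist N (Y a \<omega>) x + state_norm N ?D"
    unfolding state_dist_norm by (rule state_norm_triangle)
  also have "state_norm N ?D \<le> (LINT r:{a<..b}|lborel. state_norm N (\<lambda>h. drift r \<omega> h - \<alpha> (clamp_time r) x h))"
    by (intro state_norm_set_integral_le set_integral_diff(1) di \<alpha>_path_set_integrable x drift_diff_set_integrable \<omega>)
  also have "\<dots> \<le> (LINT r:{a<..b}|lborel. L * (\<epsilon> + state_dist N (Y a \<omega>) x))"
  proof (rule set_integral_mono[OF drift_diff_set_integrable[OF \<omega> x]])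
    have "set_integrable lborel {a..b} (\<lambda>_::real. L * (\<epsilon> + state_dist N (Y a \<omega>) x))"
      by (intro borel_integrable_atLeastAtMost' continuous_intros)
    then show "set_integrable lborel {a<..b} (\<lambda>_::real. L * (\<epsilon> + state_dist N (Y a \<omega>) x))"
      by (rule set_integrable_subset) auto
    fix r assume r: "r \<in> {a<..b}"
    then have rT: "r \<in> {0..T}" using ab by auto
    have "state_norm N (\<lambda>h. drift r \<omega> h - \<alpha> (clamp_time r) x h) \<le> L * state_dist N (Y r \<omega>) x"
      using \<alpha>_lip[OF clamp_time_in Y_space[OF \<omega>] x, of r r] rT by (simp add: drift_def state_dist_norm)
    also have "state_dist N (Y r \<omega>) x \<le> state_dist N (Y r \<omega>) (Y a \<omega>) + state_dist N (Y a \<omega>) x"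
      using state_norm_triangle[of N "\<lambda>h. Y r \<omega> h - Y a \<omega> h" "\<lambda>h. Y a \<omega> h - x h"]
      by (simp add: state_dist_norm)
    finally show "state_norm N (\<lambda>h. drift r \<omega> h - \<alpha> (clamp_time r) x h) \<le> L * (\<epsilon> + state_dist N (Y a \<omega>) x)"
      using osc[OF r] L by (meson add_right_mono mult_left_mono order_trans)
  qed
  also have "\<dots> = (b - a) * (L * (\<epsilon> + state_dist N (Y a \<omega>) x))"
    using ab by (simp add: set_lebesgue_integral_def)
  finally show ?thesis by simp
qed

text \<open>The extra grid point \<open>t\<close> after the uniform grid of \<open>{0..s}\<close> makes the increment from \<open>s\<close> to \<open>t\<close>
  a member of the same independent family as the increments before \<open>s\<close>.\<close>

definition grid :: "real \<Rightarrow> real \<Rightarrow> nat \<Rightarrow> nat \<Rightarrow> real" where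
  "grid s t n j = (if j \<le> n then s * real j / real n else t)"

definition incr :: "(nat \<Rightarrow> real) \<Rightarrow> 'w \<Rightarrow> nat \<times> 'd \<times> nat \<Rightarrow> real" where
  "incr \<tau> \<omega> = (\<lambda>(i, k, j). B i (\<tau> (Suc j)) \<omega> $ k - B i (\<tau> j) \<omega> $ k)"

lemma euler_cong:
  assumes "\<And>i k j'. i < N \<Longrightarrow> j' < j \<Longrightarrow> \<xi> (i, k, j') = \<xi>' (i, k, j')"
  shows "eul \<tau> \<xi> j = eul \<tau> \<xi>' j"
  using assms
proof (induction j)
  case (Suc j)
  then have e: "eul \<tau> \<xi> j = eul \<tau> \<xi>' j" by simp
  have x: "(\<chi> k. \<xi> (i, k, j)) = (\<chi> k. \<xi>' (i, k, j))" if "i < N" for i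
    using Suc.prems that by simp
  show ?case
    unfolding euler.simps(2) e by (rule restrict_ext) (simp add: x)
qed simp

text \<open>If \<open>\<epsilon>\<close> bounds the oscillation of the path over one step of length \<open>q\<close>, the errors satisfy
  \<open>e\<^sub>j\<^sub>+\<^sub>1 + \<epsilon> \<le> (1 + L q) (e\<^sub>j + \<epsilon>)\<close>, hence \<open>e\<^sub>n \<le> exp (L s) \<epsilon>\<close>.\<close>

lemma euler_converges:
  assumes \<omega>: "\<omega> \<in> space P"
    and eq: "\<forall>h<N. \<forall>t\<in>{0..T}. noise t \<omega> h = sqrt 2 *\<^sub>R B h t \<omega>"
    and B0: "\<forall>h<N. B h 0 \<omega> = 0"
    and s: "0 \<le> s" "s \<le> T"
  shows "(\<lambda>n. state_dist N (Y s \<omega>) (eul (grid s t (Suc n)) (incr (grid s t (Suc n)) \<omega>) (Suc n))) \<longlonglongrightarrow> 0"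
proof (rule LIMSEQ_I)
  fix e :: real assume e: "0 < e"
  define \<epsilon> where "\<epsilon> = e / (2 * exp (L * T))"
  have \<epsilon>: "0 < \<epsilon>" using e by (simp add: \<epsilon>_def)
  have "uniformly_continuous_on {0..T} (\<lambda>t. Y t \<omega> h)" if "h < N" for h
    by (rule compact_uniformly_continuous) (use sde \<omega> that in \<open>auto simp: solves_sde_def\<close>)
  \<comment> \<open>The denominator exceeds \<open>N\<close>, so that the sum over the players is at most \<open>\<epsilon>\<close>.\<close>
  then have "\<forall>h<N. \<exists>d>0. \<forall>x\<in>{0..T}. \<forall>y\<in>{0..T}. dist y x < d \<longrightarrow> dist (Y y \<omega> h) (Y x \<omega> h) < \<epsilon> / (real N + 1)"
    unfolding uniformly_continuous_on_def using \<epsilon> by auto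
  then obtain d where d: "\<And>h. h < N \<Longrightarrow> 0 < d h"
    "\<And>h x y. h < N \<Longrightarrow> x \<in> {0..T} \<Longrightarrow> y \<in> {0..T} \<Longrightarrow> dist y x < d h \<Longrightarrow> dist (Y y \<omega> h) (Y x \<omega> h) < \<epsilon> / (real N + 1)"
    by metis
  define \<delta> where "\<delta> = Min (insert 1 (d ` {..<N}))"
  have \<delta>: "0 < \<delta>" "\<And>h. h < N \<Longrightarrow> \<delta> \<le> d h"
    unfolding \<delta>_def using d(1) by (auto simp: Min_gr_iff)
  have osc: "state_dist N (Y y \<omega>) (Y x \<omega>) \<le> \<epsilon>" if "x \<in> {0..T}" "y \<in> {0..T}" "dist y x < \<delta>" for x y
  proof -
    have "state_dist N (Y y \<omega>) (Y x \<omega>) \<le> (\<Sum>h<N. norm (Y y \<omega> h - Y x \<omega> h))"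
      unfolding state_dist_def by (rule L2_set_le_sum) auto
    also have "\<dots> \<le> (\<Sum>h<N. \<epsilon> / (real N + 1))"
      using d(2)[OF _ that(1,2)] \<delta>(2) that(3) by (intro sum_mono) (force simp: dist_norm intro: less_imp_le)
    also have "\<dots> \<le> \<epsilon>"
      using \<epsilon> by (simp add: field_simps)
    finally show ?thesis .
  qed
  obtain n0 where n0: "s / \<delta> < real n0" using reals_Archimedean2 by blast
  show "\<exists>no. \<forall>n\<ge>no. norm (state_dist N (Y s \<omega>) (eul (grid s t (Suc n)) (incr (grid s t (Suc n)) \<omega>) (Suc n)) - 0) < e"
  proof (intro exI allI impI)
    fix n assume n: "n0 \<le> n"
    let ?n = "Suc n"
    let ?\<tau> = "grid s t ?n"
    let ?x = "\<lambda>j. eul ?\<tau> (incr ?\<tau> \<omega>) j"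
    let ?e = "\<lambda>j. state_dist N (Y (?\<tau> j) \<omega>) (?x j)"
    define q where "q = s / real ?n"
    have q0: "0 \<le> q" using s by (simp add: q_def)
    have q\<delta>: "q < \<delta>"
    proof -
      have "s / \<delta> < real ?n" using n0 n by linarith
      then show ?thesis using \<delta>(1) by (simp add: q_def field_simps)
    qed
    have \<tau>: "?\<tau> j = q * real j" if "j \<le> ?n" for j
      using that by (simp add: grid_def q_def)
    have \<tau>T: "0 \<le> ?\<tau> j" "?\<tau> j \<le> T" if "j \<le> ?n" for j
    proof -
      have "q * real j \<le> q * real ?n"
        using that q0 by (intro mult_left_mono) auto
      also have "\<dots> = s" by (simp add: q_def)
      finally show "0 \<le> ?\<tau> j" "?\<tau> j \<le> T" using \<tau>[OF that] s q0 by auto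
    qed
    have "j \<le> ?n \<Longrightarrow> ?e j + \<epsilon> \<le> (1 + L * q) ^ j * \<epsilon>" for j
    proof (induction j)
      case 0
      have "Y 0 \<omega> h = x0 h" if h: "h < N" for h
      proof -
        have "noise 0 \<omega> h = 0" using eq B0 h T by auto
        moreover have "drift_path 0 \<omega> h = x0 h"
        proof -
          have "(LINT s|lborel. indicator {0..0::real} s *\<^sub>R drift s \<omega> h) = (LINT s|(lborel :: real measure). 0)"
          proof (rule integral_cong_AE)
            show "AE s in lborel. indicator {0..0::real} s *\<^sub>R drift s \<omega> h = 0"
              using AE_lborel_singleton[of "0::real"] by eventually_elim simp
            note [measurable] = drift_path_meas[OF \<omega> h]
            show "(\<lambda>s. indicator {0..0::real} s *\<^sub>R drift s \<omega> h) \<in> borel_measurable lborel"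
              by measurable
          qed simp
          then show ?thesis using T by (simp add: drift_path_def set_lebesgue_integral_def)
        qed
        ultimately show ?thesis using T by (simp add: noise_def)
      qed
      then have "state_dist N (Y 0 \<omega>) x0 = state_norm N (\<lambda>_. 0 :: real ^ 'd)"
        unfolding state_dist_norm by (intro state_norm_cong) simp
      then show ?case by (simp add: grid_def state_norm_def L2_set_def)
    next
      case (Suc j)
      have j: "j \<le> ?n" "Suc j \<le> ?n" using Suc.prems by auto
      have step: "?\<tau> (Suc j) - ?\<tau> j = q"
        unfolding \<tau>[OF j(1)] \<tau>[OF j(2)] by (simp add: algebra_simps)
      have "?e (Suc j) \<le> ?e j + (?\<tau> (Suc j) - ?\<tau> j) * (L * (\<epsilon> + ?e j))"
      proof (rule euler_step[OF \<omega> eq \<tau>T(1)[OF j(1)] _ \<tau>T(2)[OF j(2)] eul_space])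
        show "?\<tau> j \<le> ?\<tau> (Suc j)" using step q0 by linarith
        show "state_dist N (Y r \<omega>) (Y (?\<tau> j) \<omega>) \<le> \<epsilon>" if "r \<in> {?\<tau> j<..?\<tau> (Suc j)}" for r
        proof (rule osc)
          show "?\<tau> j \<in> {0..T}" using \<tau>T[OF j(1)] by simp
          show "r \<in> {0..T}" using that \<tau>T[OF j(1)] \<tau>T[OF j(2)] by auto
          show "dist r (?\<tau> j) < \<delta>" using that step q\<delta> by (auto simp: dist_real_def)
        qed
        show "?x (Suc j) h = ?x j h + (LINT r:{?\<tau> j<..?\<tau> (Suc j)}|lborel. \<alpha> (clamp_time r) (?x j) h) + sqrt 2 *\<^sub>R (B h (?\<tau> (Suc j)) \<omega> - B h (?\<tau> j) \<omega>)"
          if "h < N" for h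
          using that by (simp add: euler.simps(2) incr_def vec_eq_iff)
      qed
      then have "?e (Suc j) + \<epsilon> \<le> (1 + L * q) * (?e j + \<epsilon>)"
        unfolding step by (simp add: algebra_simps)
      also have "\<dots> \<le> (1 + L * q) * ((1 + L * q) ^ j * \<epsilon>)"
        using Suc.IH[OF j(1)] L q0 by (intro mult_left_mono) auto
      finally show ?case by (simp only: power_Suc mult.assoc)
    qed
    from this[of ?n] have en: "?e ?n \<le> (1 + L * q) ^ ?n * \<epsilon>"
      using \<epsilon> by linarith
    \<comment> \<open>There are \<open>?n\<close> steps of length \<open>q = s / ?n\<close>, whence the bound in \<open>s\<close> alone.\<close>
    have "(1 + L * q) ^ ?n \<le> exp (L * q) ^ ?n"
      using L q0 by (intro power_mono) (auto simp: exp_ge_add_one_self)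
    also have "exp (L * q) ^ ?n = exp (real ?n * (L * q))"
      by (rule exp_of_nat_mult[symmetric])
    also have "real ?n * (L * q) = L * s"
      by (simp add: q_def)
    finally have "(1 + L * q) ^ ?n * \<epsilon> \<le> exp (L * s) * \<epsilon>"
      using \<epsilon> by (intro mult_right_mono) auto
    note order_trans[OF en this]
    also have "exp (L * s) * \<epsilon> \<le> exp (L * T) * \<epsilon>"
      using s L \<epsilon> by (intro mult_right_mono) (auto intro: mult_left_mono)
    also have "\<dots> = e / 2" by (simp add: \<epsilon>_def)
    finally have "?e ?n < e" using e by linarith
    moreover have "?\<tau> ?n = s" by (simp add: grid_def)
    ultimately show "norm (state_dist N (Y s \<omega>) (?x ?n) - 0) < e"
      by (simp add: state_dist_norm)
  qed
qed

lemma Y_at_meas: "t \<in> {0..T} \<Longrightarrow> Y t \<in> P \<rightarrow>\<^sub>M states N"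
  using Y_meas[of t] by simp

lemma noise_diff_AE:
  assumes "h < N" "s \<in> {0..T}" "t \<in> {0..T}"
  shows "AE \<omega> in P. noise t \<omega> h $ k - noise s \<omega> h $ k = sqrt 2 * (B h t \<omega> $ k - B h s \<omega> $ k)"
  using noise_AE by eventually_elim (use assms in \<open>simp add: algebra_simps\<close>)

text \<open>The Euler approximation of \<open>Y\<^sub>s\<close> is a function of increments before \<open>s\<close> and is thus independent of
  \<open>B\<^sub>t - B\<^sub>s\<close>, which is centred. Boundedness of \<open>\<zeta>\<close> allows to pass to the limit by dominated convergence.\<close>

lemma noise_orthogonal_bounded:
  assumes st: "0 \<le> s" "s < t" "t \<le> T" and h: "h < N"
    and \<zeta>m: "\<zeta> \<in> borel_measurable (states N)" and \<zeta>b: "\<And>x. \<bar>\<zeta> x\<bar> \<le> m"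
    and \<zeta>l: "\<And>x y. x \<in> space (states N) \<Longrightarrow> y \<in> space (states N) \<Longrightarrow> \<bar>\<zeta> x - \<zeta> y\<bar> \<le> K * state_dist N x y"
  shows "(LINT \<omega>|P. (noise t \<omega> h $ k - noise s \<omega> h $ k) * \<zeta> (Y s \<omega>)) = 0"
proof -
  define \<Delta> where "\<Delta> \<omega> = B h t \<omega> $ k - B h s \<omega> $ k" for \<omega>
  have sT: "s \<in> {0..T}" and tT: "t \<in> {0..T}" using st by auto
  note inc = brownian_motion1_increment[OF prob_space_axioms BM1[OF h, of k] st]
  have \<Delta>i: "integrable P \<Delta>" and \<Delta>0: "(LINT \<omega>|P. \<Delta> \<omega>) = 0"
    using inc by (auto simp: \<Delta>_def[abs_def])
  have [measurable]: "\<Delta> \<in> borel_measurable P" by (rule borel_measurable_integrable[OF \<Delta>i])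
  have m0: "0 \<le> m" using \<zeta>b[of undefined] by linarith
  define \<tau> where "\<tau> n = grid s t (Suc n)" for n
  define X where "X n \<omega> = \<zeta> (eul (\<tau> n) (incr (\<tau> n) \<omega>) (Suc n))" for n \<omega>
  have X: "X n \<in> borel_measurable P" "(LINT \<omega>|P. X n \<omega> * \<Delta> \<omega>) = 0" for n
  proof -
    let ?J = "{..<N} \<times> (UNIV :: 'd set) \<times> {..<Suc (Suc n)}"
    let ?A = "{..<N} \<times> (UNIV :: 'd set) \<times> {..<Suc n}"
    let ?C = "{(h, k, Suc n)}"
    have mono: "mono_on {..Suc (Suc n)} (\<tau> n)"
    proof (rule mono_onI)
      fix i j assume ij: "i \<in> {..Suc (Suc n)}" "j \<in> {..Suc (Suc n)}" "i \<le> j"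
      have le: "s * real i / real (Suc n) \<le> s" if "i \<le> Suc n" for i
      proof -
        have "s * real i \<le> s * real (Suc n)"
          using that st by (intro mult_left_mono) auto
        then show ?thesis by (simp add: pos_divide_le_eq)
      qed
      show "\<tau> n i \<le> \<tau> n j"
      proof (cases "j \<le> Suc n")
        case True
        then show ?thesis
          using ij st unfolding \<tau>_def grid_def by (auto intro!: divide_right_mono mult_left_mono)
      next
        case False
        then show ?thesis
          using le[of i] st by (auto simp: \<tau>_def grid_def)
      qed
    qed
    have img: "\<tau> n ` {..Suc (Suc n)} \<subseteq> {0..T}"
    proof
      fix x assume "x \<in> \<tau> n ` {..Suc (Suc n)}"
      then obtain j where j: "j \<le> Suc (Suc n)" "x = \<tau> n j" by auto
      have "\<tau> n 0 \<le> \<tau> n j" "\<tau> n j \<le> \<tau> n (Suc (Suc n))"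
        using mono j by (auto intro!: mono_onD[OF mono])
      moreover have "\<tau> n 0 = 0" "\<tau> n (Suc (Suc n)) = t" by (auto simp: \<tau>_def grid_def)
      ultimately show "x \<in> {0..T}" using j st by auto
    qed
    have "indep_vars (\<lambda>_. borel) (\<lambda>(i, k, j) \<omega>. B i (\<tau> n (Suc j)) \<omega> $ k - B i (\<tau> n j) \<omega> $ k) ?J"
      by (rule brownian_increments_indep[OF prob_space_axioms BM mono img])
    moreover have "(\<lambda>(i, k, j) \<omega>. B i (\<tau> n (Suc j)) \<omega> $ k - B i (\<tau> n j) \<omega> $ k) = (\<lambda>p \<omega>. incr (\<tau> n) \<omega> p)"
      by (auto simp: fun_eq_iff incr_def)
    ultimately have "indep_vars (\<lambda>_. borel) (\<lambda>p \<omega>. incr (\<tau> n) \<omega> p) ?J" by simp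
    then have iv: "indep_var (PiM ?A (\<lambda>_. borel)) (\<lambda>\<omega>. restrict (\<lambda>p. incr (\<tau> n) \<omega> p) ?A)
        (PiM ?C (\<lambda>_. borel)) (\<lambda>\<omega>. restrict (\<lambda>p. incr (\<tau> n) \<omega> p) ?C)"
      by (rule indep_var_restrict) (use h in auto)
    have "indep_var borel ((\<lambda>\<xi>. \<zeta> (eul (\<tau> n) \<xi> (Suc n))) \<circ> (\<lambda>\<omega>. restrict (\<lambda>p. incr (\<tau> n) \<omega> p) ?A))
        borel ((\<lambda>q. q (h, k, Suc n)) \<circ> (\<lambda>\<omega>. restrict (\<lambda>p. incr (\<tau> n) \<omega> p) ?C))"
      by (rule indep_var_compose[OF iv])
         (auto intro!: measurable_compose[OF eul_measurable \<zeta>m] measurable_component_singleton)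
    moreover have "(\<lambda>\<xi>. \<zeta> (eul (\<tau> n) \<xi> (Suc n))) \<circ> (\<lambda>\<omega>. restrict (\<lambda>p. incr (\<tau> n) \<omega> p) ?A) = X n"
      unfolding X_def o_def by (intro ext arg_cong[where f = \<zeta>] euler_cong) simp
    moreover have "(\<lambda>q. q (h, k, Suc n)) \<circ> (\<lambda>\<omega>. restrict (\<lambda>p. incr (\<tau> n) \<omega> p) ?C) = \<Delta>"
      by (auto simp: fun_eq_iff incr_def \<tau>_def grid_def \<Delta>_def)
    ultimately have ind: "indep_var borel (X n) borel \<Delta>" by simp
    then show Xm: "X n \<in> borel_measurable P" by (rule indep_var_rv1)
    have "integrable P (X n)"
      by (rule integrable_const_bound[of _ m]) (use Xm in \<open>auto simp: X_def \<zeta>b\<close>)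
    from indep_var_lebesgue_integral[OF ind this \<Delta>i] show "(LINT \<omega>|P. X n \<omega> * \<Delta> \<omega>) = 0"
      by (simp add: \<Delta>0)
  qed
  have lim: "(\<lambda>n. LINT \<omega>|P. X n \<omega> * \<Delta> \<omega>) \<longlonglongrightarrow> (LINT \<omega>|P. \<zeta> (Y s \<omega>) * \<Delta> \<omega>)"
  proof (rule integral_dominated_convergence[where w = "\<lambda>\<omega>. m * \<bar>\<Delta> \<omega>\<bar>"])
    show "(\<lambda>\<omega>. \<zeta> (Y s \<omega>) * \<Delta> \<omega>) \<in> borel_measurable P"
      using measurable_compose[OF Y_at_meas[OF sT] \<zeta>m] by measurable
    show "(\<lambda>\<omega>. X n \<omega> * \<Delta> \<omega>) \<in> borel_measurable P" for n
      using X(1)[of n] by measurable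
    show "integrable P (\<lambda>\<omega>. m * \<bar>\<Delta> \<omega>\<bar>)" using \<Delta>i by simp
    show "AE \<omega> in P. norm (X n \<omega> * \<Delta> \<omega>) \<le> m * \<bar>\<Delta> \<omega>\<bar>" for n
      by (auto simp: abs_mult X_def intro!: mult_right_mono \<zeta>b)
    show "AE \<omega> in P. (\<lambda>n. X n \<omega> * \<Delta> \<omega>) \<longlonglongrightarrow> \<zeta> (Y s \<omega>) * \<Delta> \<omega>"
      using noise_AE B0_AE AE_space
    proof eventually_elim
      case (elim \<omega>)
      have Ys: "Y s \<omega> \<in> space (states N)" using Y_space[OF elim(3), of s] sT by simp
      have sT': "s \<le> T" using st by simp
      have lim0: "(\<lambda>n. K * state_dist N (Y s \<omega>) (eul (\<tau> n) (incr (\<tau> n) \<omega>) (Suc n))) \<longlonglongrightarrow> 0"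
        unfolding \<tau>_def by (rule tendsto_mult_right_zero[OF euler_converges[OF elim(3,1,2) st(1) sT']])
      have "(\<lambda>n. \<zeta> (Y s \<omega>) - X n \<omega>) \<longlonglongrightarrow> 0"
      proof (rule Lim_null_comparison[OF _ lim0], rule always_eventually, rule allI)
        show "norm (\<zeta> (Y s \<omega>) - X n \<omega>) \<le> K * state_dist N (Y s \<omega>) (eul (\<tau> n) (incr (\<tau> n) \<omega>) (Suc n))" for n
          unfolding X_def real_norm_def by (rule \<zeta>l[OF Ys eul_space])
      qed
      from tendsto_diff[OF tendsto_const[of "\<zeta> (Y s \<omega>)"] this] have "(\<lambda>n. X n \<omega>) \<longlonglongrightarrow> \<zeta> (Y s \<omega>)"
        by simp
      then show ?case by (rule tendsto_mult_right)
    qed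
  qed
  have z: "(LINT \<omega>|P. \<zeta> (Y s \<omega>) * \<Delta> \<omega>) = 0"
    using lim unfolding X(2) by (simp add: LIMSEQ_const_iff)
  have "(LINT \<omega>|P. (noise t \<omega> h $ k - noise s \<omega> h $ k) * \<zeta> (Y s \<omega>)) = (LINT \<omega>|P. sqrt 2 * (\<zeta> (Y s \<omega>) * \<Delta> \<omega>))"
  proof (rule integral_cong_AE)
    note [measurable] = noise_meas[OF h] measurable_compose[OF Y_at_meas[OF sT] \<zeta>m]
    show "(\<lambda>\<omega>. (noise t \<omega> h $ k - noise s \<omega> h $ k) * \<zeta> (Y s \<omega>)) \<in> borel_measurable P"
      "(\<lambda>\<omega>. sqrt 2 * (\<zeta> (Y s \<omega>) * \<Delta> \<omega>)) \<in> borel_measurable P" by measurable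
    show "AE \<omega> in P. (noise t \<omega> h $ k - noise s \<omega> h $ k) * \<zeta> (Y s \<omega>) = sqrt 2 * (\<zeta> (Y s \<omega>) * \<Delta> \<omega>)"
      using noise_diff_AE[OF h sT tT, of k] by eventually_elim (simp add: \<Delta>_def)
  qed
  then show ?thesis by (simp add: z)
qed

lemma integrable_mult_of_squares:
  fixes f g :: "'w \<Rightarrow> real"
  assumes [measurable]: "f \<in> borel_measurable P" "g \<in> borel_measurable P"
    and "integrable P (\<lambda>\<omega>. (f \<omega>)\<^sup>2)" "integrable P (\<lambda>\<omega>. (g \<omega>)\<^sup>2)"
  shows "integrable P (\<lambda>\<omega>. f \<omega> * g \<omega>)"
proof (rule Bochner_Integration.integrable_bound)
  show "integrable P (\<lambda>\<omega>. (f \<omega>)\<^sup>2 + (g \<omega>)\<^sup>2)" using assms by simp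
  have "\<bar>a * b\<bar> \<le> a\<^sup>2 + b\<^sup>2" for a b :: real
    using zero_le_power2[of "a - b"] zero_le_power2[of "a + b"] zero_le_power2[of a] zero_le_power2[of b]
    by (simp add: power2_eq_square algebra_simps abs_le_iff)
  then show "AE \<omega> in P. norm (f \<omega> * g \<omega>) \<le> norm ((f \<omega>)\<^sup>2 + (g \<omega>)\<^sup>2)"
    by simp
qed simp

text \<open>The general case follows by truncation of \<open>\<zeta>\<close> at the levels \<open>\<plusminus>n\<close>.\<close>

lemma noise_orthogonal:
  assumes st: "0 \<le> s" "s \<le> t" "t \<le> T" and h: "h < N"
    and \<zeta>m: "\<zeta> \<in> borel_measurable (states N)"
    and \<zeta>l: "\<And>x y. x \<in> space (states N) \<Longrightarrow> y \<in> space (states N) \<Longrightarrow> \<bar>\<zeta> x - \<zeta> y\<bar> \<le> K * state_dist N x y"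
    and \<zeta>i: "integrable P (\<lambda>\<omega>. (\<zeta> (Y s \<omega>))\<^sup>2)"
  shows "(LINT \<omega>|P. (noise t \<omega> h $ k - noise s \<omega> h $ k) * \<zeta> (Y s \<omega>)) = 0"
proof (cases "s = t")
  case False
  then have st': "s < t" using st by simp
  have sT: "s \<in> {0..T}" and tT: "t \<in> {0..T}" using st by auto
  let ?D = "\<lambda>\<omega>. noise t \<omega> h $ k - noise s \<omega> h $ k"
  define \<zeta>n where "\<zeta>n n x = max (- real n) (min (real n) (\<zeta> x))" for n x
  have le: "\<bar>\<zeta>n n x\<bar> \<le> \<bar>\<zeta> x\<bar>" for n x
    by (auto simp: \<zeta>n_def)
  have \<zeta>nm: "\<zeta>n n \<in> borel_measurable (states N)" for n
    unfolding \<zeta>n_def[abs_def] using \<zeta>m by measurable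
  note [measurable] = noise_meas[OF h] measurable_compose[OF Y_at_meas[OF sT] \<zeta>m] measurable_compose[OF Y_at_meas[OF sT] \<zeta>nm]
  have "integrable P (\<lambda>\<omega>. (?D \<omega>)\<^sup>2)"
  proof (rule Bochner_Integration.integrable_bound)
    show "integrable P (\<lambda>\<omega>. 2 * (noise t \<omega> h $ k)\<^sup>2 + 2 * (noise s \<omega> h $ k)\<^sup>2)"
      using noise_moments(1)[OF h tT] noise_moments(1)[OF h sT] by simp
    have "(a - b)\<^sup>2 \<le> 2 * a\<^sup>2 + 2 * b\<^sup>2" for a b :: real
      using zero_le_power2[of "a + b"] by (simp add: power2_eq_square algebra_simps)
    then show "AE \<omega> in P. norm ((?D \<omega>)\<^sup>2) \<le> norm (2 * (noise t \<omega> h $ k)\<^sup>2 + 2 * (noise s \<omega> h $ k)\<^sup>2)"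
      by simp
  qed simp
  then have DI: "integrable P (\<lambda>\<omega>. ?D \<omega> * \<zeta> (Y s \<omega>))"
    by (intro integrable_mult_of_squares \<zeta>i) simp_all
  have "(\<lambda>n. LINT \<omega>|P. ?D \<omega> * \<zeta>n n (Y s \<omega>)) \<longlonglongrightarrow> (LINT \<omega>|P. ?D \<omega> * \<zeta> (Y s \<omega>))"
  proof (rule integral_dominated_convergence[where w = "\<lambda>\<omega>. \<bar>?D \<omega> * \<zeta> (Y s \<omega>)\<bar>"])
    show "integrable P (\<lambda>\<omega>. \<bar>?D \<omega> * \<zeta> (Y s \<omega>)\<bar>)" using DI by simp
    show "AE \<omega> in P. norm (?D \<omega> * \<zeta>n n (Y s \<omega>)) \<le> \<bar>?D \<omega> * \<zeta> (Y s \<omega>)\<bar>" for n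
      by (auto simp: abs_mult intro!: mult_left_mono le)
    show "AE \<omega> in P. (\<lambda>n. ?D \<omega> * \<zeta>n n (Y s \<omega>)) \<longlonglongrightarrow> ?D \<omega> * \<zeta> (Y s \<omega>)"
    proof (intro AE_I2 tendsto_mult_left)
      fix \<omega>
      have "\<forall>\<^sub>F n in sequentially. \<zeta>n n (Y s \<omega>) = \<zeta> (Y s \<omega>)"
      proof -
        obtain n0 where "\<bar>\<zeta> (Y s \<omega>)\<bar> < real n0" using reals_Archimedean2 by blast
        then have "\<zeta>n n (Y s \<omega>) = \<zeta> (Y s \<omega>)" if "n0 \<le> n" for n
          using that by (auto simp: \<zeta>n_def)
        then show ?thesis unfolding eventually_sequentially by blast
      qed
      then show "(\<lambda>n. \<zeta>n n (Y s \<omega>)) \<longlonglongrightarrow> \<zeta> (Y s \<omega>)"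
        by (rule tendsto_eventually)
    qed
  qed simp_all
  moreover have "(LINT \<omega>|P. ?D \<omega> * \<zeta>n n (Y s \<omega>)) = 0" for n
  proof (rule noise_orthogonal_bounded[OF st(1) st' st(3) h \<zeta>nm])
    show "\<bar>\<zeta>n n x\<bar> \<le> real n" for x by (auto simp: \<zeta>n_def)
    show "\<bar>\<zeta>n n x - \<zeta>n n y\<bar> \<le> K * state_dist N x y" if "x \<in> space (states N)" "y \<in> space (states N)" for x y
      by (rule order_trans[OF _ \<zeta>l[OF that]]) (auto simp: \<zeta>n_def)
  qed
  ultimately show ?thesis
    by (simp add: LIMSEQ_const_iff)
qed simp

end

section \<open>Ito's formula in expectation\<close>

context controlled_sde
begin

interpretation Q: pair_sigma_finite lborel P
  by (intro pair_sigma_finite.intro sigma_finite_lborel sigma_finite_measure_axioms)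

text \<open>Integrands for which the time integral over any \<open>{0..t}\<close> may be exchanged with the
  expectation, and whose expectation exists at every time.\<close>

definition time_integrable :: "(real \<Rightarrow> 'w \<Rightarrow> real) \<Rightarrow> bool" where
  "time_integrable f \<longleftrightarrow> integrable (lborel \<Otimes>\<^sub>M P) (\<lambda>p. indicator {0..T} (fst p) * f (fst p) (snd p))
     \<and> (\<forall>s\<in>{0..T}. integrable P (f s))"

lemma time_integrable_integrable: "time_integrable f \<Longrightarrow> s \<in> {0..T} \<Longrightarrow> integrable P (f s)"
  by (simp add: time_integrable_def)

lemma time_integrable_add: "time_integrable f \<Longrightarrow> time_integrable g \<Longrightarrow> time_integrable (\<lambda>s \<omega>. f s \<omega> + g s \<omega>)"
  unfolding time_integrable_def distrib_left by auto

lemma time_integrable_diff: "time_integrable f \<Longrightarrow> time_integrable g \<Longrightarrow> time_integrable (\<lambda>s \<omega>. f s \<omega> - g s \<omega>)"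
  unfolding time_integrable_def right_diff_distrib by auto

lemma time_integrable_zero: "time_integrable (\<lambda>s \<omega>. 0)"
  unfolding time_integrable_def by simp

lemma time_integrable_sum: "(\<And>i. i \<in> J \<Longrightarrow> time_integrable (f i)) \<Longrightarrow> time_integrable (\<lambda>s \<omega>. \<Sum>i\<in>J. f i s \<omega>)"
  by (induction J rule: infinite_finite_induct) (auto intro: time_integrable_add time_integrable_zero)

lemma time_integrable_scale:
  assumes f: "time_integrable f" and p: "continuous_on {0..T} p"
  shows "time_integrable (\<lambda>s \<omega>. p s * f s \<omega>)"
  unfolding time_integrable_def
proof
  have "compact (p ` {0..T})" by (rule compact_continuous_image[OF p]) simp
  from compact_imp_bounded[OF this] obtain C where "\<forall>x\<in>p ` {0..T}. norm x \<le> C"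
    unfolding bounded_iff by blast
  then have C: "\<bar>p s\<bar> \<le> C" if "s \<in> {0..T}" for s
    using that by simp
  have i: "integrable (lborel \<Otimes>\<^sub>M P) (\<lambda>q. indicator {0..T} (fst q) * f (fst q) (snd q))"
    using f by (simp add: time_integrable_def)
  have pc: "(\<lambda>s. p (clamp_time s)) \<in> borel_measurable borel"
    by (intro borel_measurable_continuous_onI continuous_on_compose2[OF p clamp_time_cont]) (use clamp_time_in in blast)
  show "integrable (lborel \<Otimes>\<^sub>M P) (\<lambda>q. indicator {0..T} (fst q) * (p (fst q) * f (fst q) (snd q)))"
  proof (rule Bochner_Integration.integrable_bound)
    show "integrable (lborel \<Otimes>\<^sub>M P) (\<lambda>q. C * (indicator {0..T} (fst q) * f (fst q) (snd q)))"
      by (rule integrable_mult_right[OF i])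
    have e: "(\<lambda>q. indicator {0..T} (fst q) * (p (fst q) * f (fst q) (snd q)))
       = (\<lambda>q. p (clamp_time (fst q)) * (indicator {0..T} (fst q) * f (fst q) (snd q)))"
      by (auto simp: fun_eq_iff indicator_def)
    have "(\<lambda>q. p (clamp_time (fst q))) \<in> borel_measurable (lborel \<Otimes>\<^sub>M P)"
      by (rule measurable_compose[OF _ pc]) simp
    then show "(\<lambda>q. indicator {0..T} (fst q) * (p (fst q) * f (fst q) (snd q))) \<in> borel_measurable (lborel \<Otimes>\<^sub>M P)"
      unfolding e by (rule borel_measurable_times[OF _ borel_measurable_integrable[OF i]])
    have "\<bar>p s * f s \<omega>\<bar> \<le> \<bar>C * f s \<omega>\<bar>" if "s \<in> {0..T}" for s \<omega>
      using C[OF that] by (auto simp: abs_mult intro!: mult_right_mono)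
    then show "AE q in lborel \<Otimes>\<^sub>M P. norm (indicator {0..T} (fst q) * (p (fst q) * f (fst q) (snd q)))
        \<le> norm (C * (indicator {0..T} (fst q) * f (fst q) (snd q)))"
      by (auto simp: indicator_def)
  qed
  show "\<forall>s\<in>{0..T}. integrable P (\<lambda>\<omega>. p s * f s \<omega>)"
    using f by (auto simp: time_integrable_def)
qed

lemma time_integrable_fubini:
  assumes f: "time_integrable f" and t: "t \<in> {0..T}"
  shows "(LINT \<omega>|P. (LINT s:{0..t}|lborel. f s \<omega>)) = (LINT s:{0..t}|lborel. LINT \<omega>|P. f s \<omega>)"
    and "integrable P (\<lambda>\<omega>. LINT s:{0..t}|lborel. f s \<omega>)"
    and "set_integrable lborel {0..t} (\<lambda>s. LINT \<omega>|P. f s \<omega>)"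
proof -
  have i: "integrable (lborel \<Otimes>\<^sub>M P) (\<lambda>q. indicator {0..T} (fst q) * f (fst q) (snd q))"
    using f by (simp add: time_integrable_def)
  have e: "(\<lambda>(s, \<omega>). indicator {0..t} s * f s \<omega>) = (\<lambda>q. indicator {0..t} (fst q) * (indicator {0..T} (fst q) * f (fst q) (snd q)))"
    using t by (auto simp: fun_eq_iff indicator_def)
  have it: "integrable (lborel \<Otimes>\<^sub>M P) (\<lambda>(s, \<omega>). indicator {0..t} s * f s \<omega>)"
  proof (rule Bochner_Integration.integrable_bound[OF i])
    have "(\<lambda>q. indicator {0..t} (fst q) :: real) \<in> borel_measurable (lborel \<Otimes>\<^sub>M P)"
      by measurable
    then show "(\<lambda>(s, \<omega>). indicator {0..t} s * f s \<omega>) \<in> borel_measurable (lborel \<Otimes>\<^sub>M P)"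
      unfolding e by (rule borel_measurable_times[OF _ borel_measurable_integrable[OF i]])
    show "AE q in lborel \<Otimes>\<^sub>M P. norm (case q of (s, \<omega>) \<Rightarrow> indicator {0..t} s * f s \<omega>)
        \<le> norm (indicator {0..T} (fst q) * f (fst q) (snd q))"
      using t by (auto simp: indicator_def)
  qed
  have "(LINT \<omega>|P. (LINT s|lborel. indicator {0..t} s * f s \<omega>)) = (LINT s|lborel. (LINT \<omega>|P. indicator {0..t} s * f s \<omega>))"
    by (rule Q.Fubini_integral[OF it])
  then show "(LINT \<omega>|P. (LINT s:{0..t}|lborel. f s \<omega>)) = (LINT s:{0..t}|lborel. LINT \<omega>|P. f s \<omega>)"
    by (simp add: set_lebesgue_integral_def)
  show "integrable P (\<lambda>\<omega>. LINT s:{0..t}|lborel. f s \<omega>)"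
    using Q.integrable_snd[OF it] by (simp add: set_lebesgue_integral_def)
  show "set_integrable lborel {0..t} (\<lambda>s. LINT \<omega>|P. f s \<omega>)"
    using Q.integrable_fst'[OF it] by (simp add: set_integrable_def)
qed

text \<open>Processes whose second moments are bounded uniformly in time; products of two of them are
  integrable in the above sense.\<close>

definition sq_integrable :: "(real \<Rightarrow> 'w \<Rightarrow> real) \<Rightarrow> bool" where
  "sq_integrable u \<longleftrightarrow> (\<lambda>p. u (fst p) (snd p)) \<in> borel_measurable (borel \<Otimes>\<^sub>M P)
     \<and> (\<exists>G. \<forall>s\<in>{0..T}. integrable P (\<lambda>\<omega>. (u s \<omega>)\<^sup>2) \<and> (LINT \<omega>|P. (u s \<omega>)\<^sup>2) \<le> G)"

lemma sq_integrable_meas: "sq_integrable u \<Longrightarrow> u s \<in> borel_measurable P"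
proof -
  assume "sq_integrable u"
  then have m: "(\<lambda>p. u (fst p) (snd p)) \<in> borel_measurable (borel \<Otimes>\<^sub>M P)"
    by (simp add: sq_integrable_def)
  have "(\<lambda>\<omega>. (s, \<omega>)) \<in> P \<rightarrow>\<^sub>M borel \<Otimes>\<^sub>M P" by measurable
  from measurable_compose[OF this m] show ?thesis by simp
qed

lemma sq_integrable_square: "sq_integrable u \<Longrightarrow> s \<in> {0..T} \<Longrightarrow> integrable P (\<lambda>\<omega>. (u s \<omega>)\<^sup>2)"
  by (auto simp: sq_integrable_def)

lemma sq_integrable_diff:
  assumes "sq_integrable u" "sq_integrable v"
  shows "sq_integrable (\<lambda>s \<omega>. u s \<omega> - v s \<omega>)"
proof -
  obtain Gu Gv where G: "\<And>s. s \<in> {0..T} \<Longrightarrow> (LINT \<omega>|P. (u s \<omega>)\<^sup>2) \<le> Gu" "\<And>s. s \<in> {0..T} \<Longrightarrow> (LINT \<omega>|P. (v s \<omega>)\<^sup>2) \<le> Gv"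
    using assms unfolding sq_integrable_def by blast
  have le: "(a - b)\<^sup>2 \<le> 2 * a\<^sup>2 + 2 * b\<^sup>2" for a b :: real
    using zero_le_power2[of "a + b"] by (simp add: power2_eq_square algebra_simps)
  show ?thesis
    unfolding sq_integrable_def
  proof (intro conjI exI ballI)
    show "(\<lambda>p. u (fst p) (snd p) - v (fst p) (snd p)) \<in> borel_measurable (borel \<Otimes>\<^sub>M P)"
      using assms by (auto simp: sq_integrable_def)
    fix s assume s: "s \<in> {0..T}"
    note [measurable] = sq_integrable_meas[OF assms(1)] sq_integrable_meas[OF assms(2)]
    have i: "integrable P (\<lambda>\<omega>. 2 * (u s \<omega>)\<^sup>2 + 2 * (v s \<omega>)\<^sup>2)"
      using sq_integrable_square[OF assms(1) s] sq_integrable_square[OF assms(2) s] by simp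
    show j: "integrable P (\<lambda>\<omega>. (u s \<omega> - v s \<omega>)\<^sup>2)"
      by (rule Bochner_Integration.integrable_bound[OF i]) (auto intro!: AE_I2 order_trans[OF le])
    have "(LINT \<omega>|P. (u s \<omega> - v s \<omega>)\<^sup>2) \<le> (LINT \<omega>|P. 2 * (u s \<omega>)\<^sup>2 + 2 * (v s \<omega>)\<^sup>2)"
      by (rule integral_mono[OF j i le])
    also have "\<dots> = 2 * (LINT \<omega>|P. (u s \<omega>)\<^sup>2) + 2 * (LINT \<omega>|P. (v s \<omega>)\<^sup>2)"
      using sq_integrable_square[OF assms(1) s] sq_integrable_square[OF assms(2) s] by simp
    also have "\<dots> \<le> 2 * Gu + 2 * Gv"
      using G[OF s] by simp
    finally show "(LINT \<omega>|P. (u s \<omega> - v s \<omega>)\<^sup>2) \<le> 2 * Gu + 2 * Gv" .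
  qed
qed

lemma sq_integrable_at:
  assumes "sq_integrable u" "t \<in> {0..T}"
  shows "sq_integrable (\<lambda>_. u t)"
  unfolding sq_integrable_def
proof (intro conjI exI ballI)
  show "(\<lambda>p. u t (snd p)) \<in> borel_measurable (borel \<Otimes>\<^sub>M P)"
    by (rule measurable_compose[OF measurable_snd sq_integrable_meas[OF assms(1)]])
qed (use sq_integrable_square[OF assms] in auto)

lemma sq_integrable_growth:
  assumes m: "(\<lambda>p. u (fst p) (snd p)) \<in> borel_measurable (borel \<Otimes>\<^sub>M P)"
    and le: "\<And>s \<omega>. \<omega> \<in> space P \<Longrightarrow> \<bar>u s \<omega>\<bar> \<le> a + b * state_size s \<omega>"
    and ab: "0 \<le> a" "0 \<le> b"
  shows "sq_integrable u"
  unfolding sq_integrable_def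
proof (intro conjI exI ballI m)
  fix s assume s: "s \<in> {0..T}"
  have "(\<lambda>\<omega>. (s, \<omega>)) \<in> P \<rightarrow>\<^sub>M borel \<Otimes>\<^sub>M P" by measurable
  from measurable_compose[OF this m] have um: "u s \<in> borel_measurable P" by simp
  have sq: "(u s \<omega>)\<^sup>2 \<le> 2 * a\<^sup>2 + 2 * b\<^sup>2 * (state_size s \<omega>)\<^sup>2" if "\<omega> \<in> space P" for \<omega>
  proof -
    have "\<bar>u s \<omega>\<bar>\<^sup>2 \<le> (a + b * state_size s \<omega>)\<^sup>2"
      by (intro power_mono le that) simp
    also have "\<dots> \<le> 2 * a\<^sup>2 + 2 * b\<^sup>2 * (state_size s \<omega>)\<^sup>2"
      using zero_le_power2[of "a - b * state_size s \<omega>"] by (simp add: power2_eq_square algebra_simps)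
    finally show ?thesis by simp
  qed
  have i: "integrable P (\<lambda>\<omega>. 2 * a\<^sup>2 + 2 * b\<^sup>2 * (state_size s \<omega>)\<^sup>2)"
    using state_size_square_moment[OF s] by simp
  show j: "integrable P (\<lambda>\<omega>. (u s \<omega>)\<^sup>2)"
  proof (rule Bochner_Integration.integrable_bound[OF i])
    show "(\<lambda>\<omega>. (u s \<omega>)\<^sup>2) \<in> borel_measurable P" using um by simp
    show "AE \<omega> in P. norm ((u s \<omega>)\<^sup>2) \<le> norm (2 * a\<^sup>2 + 2 * b\<^sup>2 * (state_size s \<omega>)\<^sup>2)"
      using sq by (intro AE_I2) simp
  qed
  have "(LINT \<omega>|P. (u s \<omega>)\<^sup>2) \<le> (LINT \<omega>|P. 2 * a\<^sup>2 + 2 * b\<^sup>2 * (state_size s \<omega>)\<^sup>2)"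
    by (rule integral_mono[OF j i sq])
  also have "\<dots> = 2 * a\<^sup>2 + 2 * b\<^sup>2 * (LINT \<omega>|P. (state_size s \<omega>)\<^sup>2)"
    using state_size_square_moment[OF s] by (simp add: prob_space)
  also have "\<dots> \<le> 2 * a\<^sup>2 + 2 * b\<^sup>2 * moment_bound"
    using state_size_square_moment[OF s] by (intro add_left_mono mult_left_mono) auto
  finally show "(LINT \<omega>|P. (u s \<omega>)\<^sup>2) \<le> 2 * a\<^sup>2 + 2 * b\<^sup>2 * moment_bound" .
qed

lemma time_integrable_mult:
  assumes u: "sq_integrable u" and v: "sq_integrable v"
  shows "time_integrable (\<lambda>s \<omega>. u s \<omega> * v s \<omega>)"
  unfolding time_integrable_def
proof
  obtain Gu Gv where G: "\<And>s. s \<in> {0..T} \<Longrightarrow> (LINT \<omega>|P. (u s \<omega>)\<^sup>2) \<le> Gu" "\<And>s. s \<in> {0..T} \<Longrightarrow> (LINT \<omega>|P. (v s \<omega>)\<^sup>2) \<le> Gv"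
    using assms unfolding sq_integrable_def by blast
  have p: "integrable P (\<lambda>\<omega>. u s \<omega> * v s \<omega>)" if "s \<in> {0..T}" for s
    by (intro integrable_mult_of_squares sq_integrable_meas sq_integrable_square u v that)
  then show "\<forall>s\<in>{0..T}. integrable P (\<lambda>\<omega>. u s \<omega> * v s \<omega>)" by blast
  have le: "\<bar>a * b\<bar> \<le> a\<^sup>2 + b\<^sup>2" for a b :: real
    using zero_le_power2[of "a - b"] zero_le_power2[of "a + b"] zero_le_power2[of a] zero_le_power2[of b]
    by (simp add: power2_eq_square algebra_simps abs_le_iff)
  have b: "(LINT \<omega>|P. \<bar>u s \<omega> * v s \<omega>\<bar>) \<le> Gu + Gv" if s: "s \<in> {0..T}" for s
  proof -
    have "(LINT \<omega>|P. \<bar>u s \<omega> * v s \<omega>\<bar>) \<le> (LINT \<omega>|P. (u s \<omega>)\<^sup>2 + (v s \<omega>)\<^sup>2)"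
      using p[OF s] sq_integrable_square[OF u s] sq_integrable_square[OF v s] by (intro integral_mono le) auto
    also have "\<dots> \<le> Gu + Gv"
      using sq_integrable_square[OF u s] sq_integrable_square[OF v s] G[OF s] by simp
    finally show ?thesis .
  qed
  let ?f = "\<lambda>q. indicator {0..T} (fst q) * (u (fst q) (snd q) * v (fst q) (snd q))"
  have uv: "(\<lambda>q. u (fst q) (snd q) * v (fst q) (snd q)) \<in> borel_measurable (lborel \<Otimes>\<^sub>M P)"
  proof -
    have e: "borel_measurable (lborel \<Otimes>\<^sub>M P) = (borel_measurable (borel \<Otimes>\<^sub>M P) :: (real \<times> 'w \<Rightarrow> real) set)"
      by (intro measurable_cong_sets sets_pair_measure_cong) auto
    show ?thesis
      unfolding e using u v unfolding sq_integrable_def by (intro borel_measurable_times) auto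
  qed
  have fm: "?f \<in> borel_measurable (lborel \<Otimes>\<^sub>M P)"
  proof -
    have "(\<lambda>q. indicator {0..T} (fst q) :: real) \<in> borel_measurable (lborel \<Otimes>\<^sub>M P)" by measurable
    then show ?thesis using uv by (rule borel_measurable_times)
  qed
  show "integrable (lborel \<Otimes>\<^sub>M P) ?f"
  proof (rule Q.Fubini_integrable[OF fm])
    show "integrable lborel (\<lambda>s. LINT \<omega>|P. norm (?f (s, \<omega>)))"
    proof (rule Bochner_Integration.integrable_bound)
      show "integrable lborel (\<lambda>s. indicator {0..T} s * (Gu + Gv))"
        using borel_integrable_atLeastAtMost'[OF continuous_on_const, of 0 T "Gu + Gv"]
        by (simp add: set_integrable_def)
      show "(\<lambda>s. LINT \<omega>|P. norm (?f (s, \<omega>))) \<in> borel_measurable lborel"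
      proof (rule borel_measurable_lebesgue_integral)
        show "(\<lambda>(s, \<omega>). norm (?f (s, \<omega>))) \<in> borel_measurable (lborel \<Otimes>\<^sub>M P)"
          using measurable_compose[OF fm borel_measurable_norm] by (simp add: case_prod_beta)
      qed
      show "AE s in lborel. norm (LINT \<omega>|P. norm (?f (s, \<omega>))) \<le> norm (indicator {0..T} s * (Gu + Gv))"
      proof (rule AE_I2)
        fix s :: real
        show "norm (LINT \<omega>|P. norm (?f (s, \<omega>))) \<le> norm (indicator {0..T} s * (Gu + Gv))"
        proof (cases "s \<in> {0..T}")
          case True
          have "norm (LINT \<omega>|P. norm (?f (s, \<omega>))) = (LINT \<omega>|P. \<bar>u s \<omega> * v s \<omega>\<bar>)"
            using True by (simp add: abs_of_nonneg)
          also have "\<dots> \<le> \<bar>Gu + Gv\<bar>" using b[OF True] by linarith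
          finally show ?thesis using True by simp
        qed simp
      qed
    qed
    show "AE s in lborel. integrable P (\<lambda>\<omega>. ?f (s, \<omega>))"
      using p by (auto intro!: AE_I2 simp: indicator_def)
  qed
qed

lemma sq_integrable_state: "h < N \<Longrightarrow> sq_integrable (\<lambda>t \<omega>. Y (clamp_time t) \<omega> h $ k)"
  by (rule sq_integrable_growth[where a = 0 and b = 1])
     (auto simp: state_size_def comp_le_state_norm
        intro!: measurable_compose[OF measurable_compose[OF Y_joint measurable_states_comp] vec_nth_borel])

lemma sq_integrable_drift: "h < N \<Longrightarrow> sq_integrable (\<lambda>t \<omega>. drift t \<omega> h $ k)"
  by (rule sq_integrable_growth[where a = R and b = L])
     (auto simp: R L intro!: order_trans[OF comp_le_state_norm drift_le]
         measurable_compose[OF measurable_compose[OF drift_joint measurable_states_comp] vec_nth_borel])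

lemma sq_integrable_noise:
  assumes h: "h < N"
  shows "sq_integrable (\<lambda>t \<omega>. noise t \<omega> h $ k)"
  unfolding sq_integrable_def
proof (intro conjI exI ballI)
  show "(\<lambda>p. noise (fst p) (snd p) h $ k) \<in> borel_measurable (borel \<Otimes>\<^sub>M P)"
    by (rule measurable_compose[OF noise_joint[OF h] vec_nth_borel])
  fix s assume s: "s \<in> {0..T}"
  show "integrable P (\<lambda>\<omega>. (noise s \<omega> h $ k)\<^sup>2)" by (rule noise_moments[OF h s])
  show "(LINT \<omega>|P. (noise s \<omega> h $ k)\<^sup>2) \<le> 2 * T" using noise_moments(2)[OF h s] s by simp
qed

lemma drift_path_eq: "drift_path t \<omega> h $ k = Y (clamp_time t) \<omega> h $ k - noise t \<omega> h $ k"
  by (simp add: noise_def)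

lemma sq_integrable_acc: "h < N \<Longrightarrow> sq_integrable (\<lambda>t \<omega>. drift_path t \<omega> h $ k)"
  unfolding drift_path_eq by (intro sq_integrable_diff sq_integrable_state sq_integrable_noise)

lemma drift_comp_set_integrable:
  assumes "\<omega> \<in> space P" "h < N"
  shows "set_integrable lborel {0..t} (\<lambda>s. drift s \<omega> h $ k)"
  using integrable_bounded_linear[OF bounded_linear_vec_nth drift_set_integrable[OF assms, unfolded set_integrable_def]]
  by (simp add: set_integrable_def)

lemma drift_path_comp:
  assumes "\<omega> \<in> space P" "h < N" "t \<in> {0..T}"
  shows "drift_path t \<omega> h $ k = x0 h $ k + (LINT s:{0..t}|lborel. drift s \<omega> h $ k)"
  using integral_bounded_linear[OF bounded_linear_vec_nth drift_set_integrable[OF assms(1,2), of 0 t, unfolded set_integrable_def], of k] assms(3)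
  by (simp add: drift_path_def set_lebesgue_integral_def)

lemma noise_product:
  assumes h: "h < N" "h' < N" and t: "t \<in> {0..T}"
  shows "(LINT \<omega>|P. noise t \<omega> h $ k * noise t \<omega> h' $ k) = (if h = h' then 2 * t else 0)"
proof (cases "h = h'")
  case True
  then show ?thesis using noise_moments(2)[OF h(1) t, of k] by (simp add: power2_eq_square)
next
  case False
  have t': "0 \<le> t" "t \<le> T" using t by auto
  have ind: "indep_vars (\<lambda>_. Pi\<^sub>M {0..T} (\<lambda>_. borel)) (\<lambda>i. paths {0..T} (B i)) {..<N}"
    using BM by (simp add: independent_brownian_motions_def)
  have "(\<lambda>p::real \<Rightarrow> real ^ 'd. p t) \<in> borel_measurable (Pi\<^sub>M {0..T} (\<lambda>_. borel))"
    by (rule measurable_component_singleton) (use t in auto)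
  from measurable_compose[OF this vec_nth_borel[of k]]
  have "indep_vars (\<lambda>_. borel) (\<lambda>i \<omega>. paths {0..T} (B i) \<omega> t $ k) {..<N}"
    by (intro indep_vars_compose2[OF ind, of "\<lambda>_ p. p t $ k" "\<lambda>_. borel"])
  then have "indep_vars (\<lambda>_. borel) (\<lambda>i \<omega>. B i t \<omega> $ k) {..<N}"
    using t by (simp add: paths_def)
  then have iv: "indep_vars (\<lambda>_. borel) (\<lambda>i \<omega>. B i t \<omega> $ k) {h, h'}"
    by (rule indep_vars_subset) (use h in auto)
  note m = brownian_motion1_moments[OF prob_space_axioms BM1[OF h(1), of k] t']
  note m' = brownian_motion1_moments[OF prob_space_axioms BM1[OF h(2), of k] t']
  have "(LINT \<omega>|P. (\<Prod>i\<in>{h, h'}. B i t \<omega> $ k)) = (\<Prod>i\<in>{h, h'}. LINT \<omega>|P. B i t \<omega> $ k)"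
    by (rule indep_vars_lebesgue_integral[OF _ iv]) (use m(4) m'(4) in auto)
  then have z: "(LINT \<omega>|P. B h t \<omega> $ k * B h' t \<omega> $ k) = 0"
    using False m(2) by simp
  have "(LINT \<omega>|P. noise t \<omega> h $ k * noise t \<omega> h' $ k) = (LINT \<omega>|P. 2 * (B h t \<omega> $ k * B h' t \<omega> $ k))"
  proof (rule integral_cong_AE)
    note [measurable] = noise_meas[OF h(1)] noise_meas[OF h(2)] borel_measurable_integrable[OF m(4)] borel_measurable_integrable[OF m'(4)]
    show "(\<lambda>\<omega>. noise t \<omega> h $ k * noise t \<omega> h' $ k) \<in> borel_measurable P"
      "(\<lambda>\<omega>. 2 * (B h t \<omega> $ k * B h' t \<omega> $ k)) \<in> borel_measurable P" by measurable
    show "AE \<omega> in P. noise t \<omega> h $ k * noise t \<omega> h' $ k = 2 * (B h t \<omega> $ k * B h' t \<omega> $ k)"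
      using noise_AE by eventually_elim (use h t in simp)
  qed
  then show ?thesis using False z by simp
qed

text \<open>The noise at time \<open>t\<close> may be replaced by the noise at time \<open>s\<close> under the integral because the
  increment in between is orthogonal to the drift at time \<open>s\<close>.\<close>

lemma drift_path_noise:
  assumes h: "h < N" "h' < N" and t: "t \<in> {0..T}"
  shows "(LINT \<omega>|P. drift_path t \<omega> h $ k * noise t \<omega> h' $ k) = (LINT s:{0..t}|lborel. LINT \<omega>|P. drift s \<omega> h $ k * noise s \<omega> h' $ k)"
proof -
  have q: "time_integrable (\<lambda>s \<omega>. drift s \<omega> h $ k * noise t \<omega> h' $ k)"
    by (rule time_integrable_mult[OF sq_integrable_drift[OF h(1)] sq_integrable_at[OF sq_integrable_noise[OF h(2)] t]])
  have "(LINT \<omega>|P. drift_path t \<omega> h $ k * noise t \<omega> h' $ k)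
      = (LINT \<omega>|P. x0 h $ k * noise t \<omega> h' $ k + (LINT s:{0..t}|lborel. drift s \<omega> h $ k * noise t \<omega> h' $ k))"
    by (intro Bochner_Integration.integral_cong) (auto simp: drift_path_comp[OF _ h(1) t] distrib_right)
  also have "\<dots> = x0 h $ k * (LINT \<omega>|P. noise t \<omega> h' $ k) + (LINT \<omega>|P. (LINT s:{0..t}|lborel. drift s \<omega> h $ k * noise t \<omega> h' $ k))"
    using noise_moments(3)[OF h(2) t] time_integrable_fubini(2)[OF q t] by (subst Bochner_Integration.integral_add) auto
  also have "\<dots> = (LINT s:{0..t}|lborel. LINT \<omega>|P. drift s \<omega> h $ k * noise t \<omega> h' $ k)"
    using noise_moments(4)[OF h(2) t] time_integrable_fubini(1)[OF q t] by simp
  also have "\<dots> = (LINT s:{0..t}|lborel. LINT \<omega>|P. drift s \<omega> h $ k * noise s \<omega> h' $ k)"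
  proof (rule set_lebesgue_integral_cong)
    show "\<forall>s. s \<in> {0..t} \<longrightarrow> (LINT \<omega>|P. drift s \<omega> h $ k * noise t \<omega> h' $ k) = (LINT \<omega>|P. drift s \<omega> h $ k * noise s \<omega> h' $ k)"
    proof (intro allI impI)
      fix s assume s: "s \<in> {0..t}"
      then have sT: "s \<in> {0..T}" using t by auto
      have dr: "drift s \<omega> = \<alpha> s (Y s \<omega>)" for \<omega> using sT by (simp add: drift_def)
      have "(LINT \<omega>|P. (noise t \<omega> h' $ k - noise s \<omega> h' $ k) * (\<alpha> s (Y s \<omega>) h $ k)) = 0"
      proof (rule noise_orthogonal[OF _ _ _ h(2), where K = L])
        show "(\<lambda>x. \<alpha> s x h $ k) \<in> borel_measurable (states N)"
          by (rule measurable_compose[OF measurable_compose[OF \<alpha>_meas1[OF sT] measurable_states_comp[OF h(1)]] vec_nth_borel])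
        show "\<bar>\<alpha> s x h $ k - \<alpha> s y h $ k\<bar> \<le> L * state_dist N x y" if "x \<in> space (states N)" "y \<in> space (states N)" for x y
          using comp_le_state_norm[OF h(1), of "\<lambda>h. \<alpha> s x h - \<alpha> s y h" k] \<alpha>_lip[OF sT that]
          by (simp add: state_dist_norm)
        show "integrable P (\<lambda>\<omega>. (\<alpha> s (Y s \<omega>) h $ k)\<^sup>2)"
          using sq_integrable_square[OF sq_integrable_drift[OF h(1), of k] sT] by (simp add: dr)
      qed (use s t in auto)
      then have z: "(LINT \<omega>|P. drift s \<omega> h $ k * noise t \<omega> h' $ k - drift s \<omega> h $ k * noise s \<omega> h' $ k) = 0"
        by (simp add: dr algebra_simps)
      have i1: "integrable P (\<lambda>\<omega>. drift s \<omega> h $ k * noise t \<omega> h' $ k)"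
        by (rule time_integrable_integrable[OF q sT])
      have i2: "integrable P (\<lambda>\<omega>. drift s \<omega> h $ k * noise s \<omega> h' $ k)"
        by (rule time_integrable_integrable[OF time_integrable_mult[OF sq_integrable_drift[OF h(1)] sq_integrable_noise[OF h(2)]] sT])
      show "(LINT \<omega>|P. drift s \<omega> h $ k * noise t \<omega> h' $ k) = (LINT \<omega>|P. drift s \<omega> h $ k * noise s \<omega> h' $ k)"
        using z unfolding Bochner_Integration.integral_diff[OF i1 i2] by simp
    qed
  qed simp
  finally show ?thesis .
qed

lemma drift_path_acc:
  assumes h: "h < N" "h' < N" and t: "t \<in> {0..T}"
  shows "(LINT \<omega>|P. drift_path t \<omega> h $ k * drift_path t \<omega> h' $ k) = x0 h $ k * x0 h' $ k
    + (LINT s:{0..t}|lborel. LINT \<omega>|P. drift s \<omega> h $ k * drift_path s \<omega> h' $ k + drift_path s \<omega> h $ k * drift s \<omega> h' $ k)"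
proof -
  have q: "time_integrable (\<lambda>s \<omega>. drift s \<omega> h $ k * drift_path s \<omega> h' $ k + drift_path s \<omega> h $ k * drift s \<omega> h' $ k)"
    by (intro time_integrable_add time_integrable_mult sq_integrable_drift sq_integrable_acc h)
  have "(LINT \<omega>|P. drift_path t \<omega> h $ k * drift_path t \<omega> h' $ k) = (LINT \<omega>|P. x0 h $ k * x0 h' $ k
      + (LINT s:{0..t}|lborel. drift s \<omega> h $ k * drift_path s \<omega> h' $ k + drift_path s \<omega> h $ k * drift s \<omega> h' $ k))"
  proof (rule Bochner_Integration.integral_cong)
    fix \<omega> assume \<omega>: "\<omega> \<in> space P"
    show "drift_path t \<omega> h $ k * drift_path t \<omega> h' $ k = x0 h $ k * x0 h' $ k
      + (LINT s:{0..t}|lborel. drift s \<omega> h $ k * drift_path s \<omega> h' $ k + drift_path s \<omega> h $ k * drift s \<omega> h' $ k)"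
      by (rule AC_by_parts(1)[OF drift_comp_set_integrable[OF \<omega> h(1)] drift_comp_set_integrable[OF \<omega> h(2)]])
         (use drift_path_comp[OF \<omega>] h t in auto)
  qed simp
  also have "\<dots> = x0 h $ k * x0 h' $ k
      + (LINT \<omega>|P. (LINT s:{0..t}|lborel. drift s \<omega> h $ k * drift_path s \<omega> h' $ k + drift_path s \<omega> h $ k * drift s \<omega> h' $ k))"
    using time_integrable_fubini(2)[OF q t] by (subst Bochner_Integration.integral_add) (auto simp: prob_space)
  finally show ?thesis
    by (simp only: time_integrable_fubini(1)[OF q t])
qed

text \<open>Expand the product of the two sums of drift path and noise. The product of the drift paths is
  integrated by parts, the mixed products are given by \<open>drift_path_noise\<close>, and the product of
  the noises contributes the correction term \<open>2\<close> on the diagonal.\<close>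

lemma ito_product:
  fixes k :: 'd
  assumes h: "h < N" "h' < N" and t: "t \<in> {0..T}"
  defines "n \<equiv> \<lambda>s. (LINT \<omega>|P. drift s \<omega> h $ k * Y (clamp_time s) \<omega> h' $ k + Y (clamp_time s) \<omega> h $ k * drift s \<omega> h' $ k) + (if h = h' then 2 else 0)"
  shows "(LINT \<omega>|P. Y (clamp_time t) \<omega> h $ k * Y (clamp_time t) \<omega> h' $ k) = x0 h $ k * x0 h' $ k + (LINT s:{0..t}|lborel. n s)"
    and "set_integrable lborel {0..t} n"
proof -
  let ?b = "\<lambda>h s \<omega>. drift s \<omega> h $ k" and ?a = "\<lambda>h s \<omega>. drift_path s \<omega> h $ k" and ?w = "\<lambda>h s \<omega>. noise s \<omega> h $ k"
  note sq = sq_integrable_drift[OF h(1), of k] sq_integrable_drift[OF h(2), of k] sq_integrable_acc[OF h(1), of k] sq_integrable_acc[OF h(2), of k]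
    sq_integrable_noise[OF h(1), of k] sq_integrable_noise[OF h(2), of k]
  have Y: "Y (clamp_time s) \<omega> h $ k = ?a h s \<omega> + ?w h s \<omega>" for s \<omega> h
    by (simp add: drift_path_eq)
  define n1 where "n1 s = (LINT \<omega>|P. ?b h s \<omega> * ?a h' s \<omega> + ?a h s \<omega> * ?b h' s \<omega>)" for s
  define n2 where "n2 s = (LINT \<omega>|P. ?b h s \<omega> * ?w h' s \<omega>)" for s
  define n3 where "n3 s = (LINT \<omega>|P. ?b h' s \<omega> * ?w h s \<omega>)" for s
  define n4 where "n4 (s::real) = (if h = h' then 2 else 0 :: real)" for s
  have q: "time_integrable (\<lambda>s \<omega>. ?b h s \<omega> * ?a h' s \<omega> + ?a h s \<omega> * ?b h' s \<omega>)" "time_integrable (\<lambda>s \<omega>. ?b h s \<omega> * ?w h' s \<omega>)" "time_integrable (\<lambda>s \<omega>. ?b h' s \<omega> * ?w h s \<omega>)"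
    by (intro time_integrable_add time_integrable_mult sq)+
  have i1: "set_integrable lborel {0..t} n1" "set_integrable lborel {0..t} n2" "set_integrable lborel {0..t} n3"
    unfolding n1_def n2_def n3_def by (rule time_integrable_fubini(3)[OF _ t], rule q)+
  have i4: "set_integrable lborel {0..t} n4"
    unfolding n4_def by (intro borel_integrable_atLeastAtMost' continuous_intros)
  have n_eq: "n s = n1 s + n2 s + (n3 s + n4 s)" if s: "s \<in> {0..t}" for s
  proof -
    have sT: "s \<in> {0..T}" using s t by auto
    have "(LINT \<omega>|P. ?b h s \<omega> * Y (clamp_time s) \<omega> h' $ k + Y (clamp_time s) \<omega> h $ k * ?b h' s \<omega>)
      = (LINT \<omega>|P. (?b h s \<omega> * ?a h' s \<omega> + ?a h s \<omega> * ?b h' s \<omega>) + (?b h s \<omega> * ?w h' s \<omega> + ?b h' s \<omega> * ?w h s \<omega>))"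
      unfolding Y by (simp add: algebra_simps)
    also have "\<dots> = n1 s + (n2 s + n3 s)"
      unfolding n1_def n2_def n3_def
      using q[THEN time_integrable_integrable, OF sT] by (subst Bochner_Integration.integral_add; simp)+
    finally show ?thesis by (simp add: n_def n4_def)
  qed
  have i: "set_integrable lborel {0..t} (\<lambda>s. n1 s + n2 s + (n3 s + n4 s))"
    by (intro set_integral_add(1) i1 i4)
  then show "set_integrable lborel {0..t} n"
    by (subst set_integrable_cong[OF refl refl n_eq]) auto
  have "(LINT s:{0..t}|lborel. n s) = (LINT s:{0..t}|lborel. n1 s + n2 s + (n3 s + n4 s))"
    using n_eq by (intro set_lebesgue_integral_cong) auto
  also have "\<dots> = (LINT s:{0..t}|lborel. n1 s) + (LINT s:{0..t}|lborel. n2 s) + ((LINT s:{0..t}|lborel. n3 s) + (LINT s:{0..t}|lborel. n4 s))"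
    using i1 i4 by (simp add: set_integral_add)
  also have "(LINT s:{0..t}|lborel. n4 s) = (if h = h' then 2 * t else 0)"
    using t by (simp add: n4_def set_lebesgue_integral_def)
  finally have N: "(LINT s:{0..t}|lborel. n s) = (LINT s:{0..t}|lborel. n1 s) + (LINT s:{0..t}|lborel. n2 s) + ((LINT s:{0..t}|lborel. n3 s) + (if h = h' then 2 * t else 0))" .
  have j: "integrable P (\<lambda>\<omega>. ?a h t \<omega> * ?a h' t \<omega>)" "integrable P (\<lambda>\<omega>. ?a h t \<omega> * ?w h' t \<omega>)" 
     "integrable P (\<lambda>\<omega>. ?a h' t \<omega> * ?w h t \<omega>)" "integrable P (\<lambda>\<omega>. ?w h t \<omega> * ?w h' t \<omega>)"
    by (intro integrable_mult_of_squares sq_integrable_meas sq sq_integrable_square t)+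
  have "(LINT \<omega>|P. Y (clamp_time t) \<omega> h $ k * Y (clamp_time t) \<omega> h' $ k)
     = (LINT \<omega>|P. (?a h t \<omega> * ?a h' t \<omega> + ?a h t \<omega> * ?w h' t \<omega>) + (?a h' t \<omega> * ?w h t \<omega> + ?w h t \<omega> * ?w h' t \<omega>))"
    unfolding Y by (simp add: algebra_simps)
  also have "\<dots> = ((LINT \<omega>|P. ?a h t \<omega> * ?a h' t \<omega>) + (LINT \<omega>|P. ?a h t \<omega> * ?w h' t \<omega>))
     + ((LINT \<omega>|P. ?a h' t \<omega> * ?w h t \<omega>) + (LINT \<omega>|P. ?w h t \<omega> * ?w h' t \<omega>))"
    using j by simp
  also have "(LINT \<omega>|P. ?a h t \<omega> * ?a h' t \<omega>) = x0 h $ k * x0 h' $ k + (LINT s:{0..t}|lborel. n1 s)"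
    unfolding n1_def by (rule drift_path_acc[OF h t])
  also have "(LINT \<omega>|P. ?a h t \<omega> * ?w h' t \<omega>) = (LINT s:{0..t}|lborel. n2 s)"
    unfolding n2_def by (rule drift_path_noise[OF h t])
  also have "(LINT \<omega>|P. ?a h' t \<omega> * ?w h t \<omega>) = (LINT s:{0..t}|lborel. n3 s)"
    unfolding n3_def by (rule drift_path_noise[OF h(2,1) t])
  also have "(LINT \<omega>|P. ?w h t \<omega> * ?w h' t \<omega>) = (if h = h' then 2 * t else 0)"
    by (rule noise_product[OF h t])
  finally show "(LINT \<omega>|P. Y (clamp_time t) \<omega> h $ k * Y (clamp_time t) \<omega> h' $ k) = x0 h $ k * x0 h' $ k + (LINT s:{0..t}|lborel. n s)"
    using N by simp
qed

lemma ito_weighted: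
  assumes h: "h < N" "h' < N"
    and p: "\<And>t. t \<in> {0..T} \<Longrightarrow> (p has_real_derivative p' t) (at t within {0..T})"
    and p': "continuous_on {0..T} p'"
  shows "p T * (LINT \<omega>|P. Y T \<omega> h $ k * Y T \<omega> h' $ k) = p 0 * (x0 h $ k * x0 h' $ k)
    + (LINT s:{0..T}|lborel. (LINT \<omega>|P. p' s * (Y (clamp_time s) \<omega> h $ k * Y (clamp_time s) \<omega> h' $ k)
         + p s * (drift s \<omega> h $ k * Y (clamp_time s) \<omega> h' $ k + Y (clamp_time s) \<omega> h $ k * drift s \<omega> h' $ k)) + p s * (if h = h' then 2 else 0))"
    (is "_ = _ + (LINT s:{0..T}|lborel. ?m s)")
    and "set_integrable lborel {0..T} (\<lambda>s. (LINT \<omega>|P. p' s * (Y (clamp_time s) \<omega> h $ k * Y (clamp_time s) \<omega> h' $ k)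
         + p s * (drift s \<omega> h $ k * Y (clamp_time s) \<omega> h' $ k + Y (clamp_time s) \<omega> h $ k * drift s \<omega> h' $ k)) + p s * (if h = h' then 2 else 0))"
proof -
  define m where "m t = (LINT \<omega>|P. Y (clamp_time t) \<omega> h $ k * Y (clamp_time t) \<omega> h' $ k)" for t
  define n where "n s = (LINT \<omega>|P. drift s \<omega> h $ k * Y (clamp_time s) \<omega> h' $ k + Y (clamp_time s) \<omega> h $ k * drift s \<omega> h' $ k) + (if h = h' then 2 else 0)" for s
  have TT: "T \<in> {0..T}" using T by simp
  have pe: "p s = p 0 + (LINT r:{0..s}|lborel. p' r)" if s: "s \<in> {0..T}" for s
  proof -
    have c: "continuous_on {0..s} p'" by (rule continuous_on_subset[OF p']) (use s in auto)
    have "(p' has_integral (p s - p 0)) {0..s}"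
    proof (rule fundamental_theorem_of_calculus)
      show "(p has_vector_derivative p' x) (at x within {0..s})" if "x \<in> {0..s}" for x
        using has_field_derivative_subset[OF p, of x "{0..s}"] that s
        by (auto simp: has_real_derivative_iff_has_vector_derivative)
    qed (use s in auto)
    then show ?thesis
      using set_borel_integral_eq_integral(2)[OF borel_integrable_atLeastAtMost'[OF c]] by (simp add: integral_unique)
  qed
  have p'i: "set_integrable lborel {0..T} p'"
    by (rule borel_integrable_atLeastAtMost'[OF p'])
  have ni: "set_integrable lborel {0..T} n"
    unfolding n_def[abs_def] by (rule ito_product(2)[OF h TT])
  have me: "m s = x0 h $ k * x0 h' $ k + (LINT r:{0..s}|lborel. n r)" if "s \<in> {0..T}" for s
    unfolding m_def n_def by (rule ito_product(1)[OF h that])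
  have m_eq: "?m s = p' s * m s + p s * n s" if s: "s \<in> {0..T}" for s
  proof -
    have i: "integrable P (\<lambda>\<omega>. Y (clamp_time s) \<omega> h $ k * Y (clamp_time s) \<omega> h' $ k)"
      "integrable P (\<lambda>\<omega>. drift s \<omega> h $ k * Y (clamp_time s) \<omega> h' $ k + Y (clamp_time s) \<omega> h $ k * drift s \<omega> h' $ k)"
      by (intro Bochner_Integration.integrable_add integrable_mult_of_squares sq_integrable_meas[OF sq_integrable_state] sq_integrable_meas[OF sq_integrable_drift]
          sq_integrable_square[OF sq_integrable_state] sq_integrable_square[OF sq_integrable_drift] h s)+
    have j: "integrable P (\<lambda>\<omega>. p' s * (Y (clamp_time s) \<omega> h $ k * Y (clamp_time s) \<omega> h' $ k))"
      "integrable P (\<lambda>\<omega>. p s * (drift s \<omega> h $ k * Y (clamp_time s) \<omega> h' $ k + Y (clamp_time s) \<omega> h $ k * drift s \<omega> h' $ k))"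
      using i by (auto intro: integrable_mult_right)
    show ?thesis
      unfolding m_def n_def Bochner_Integration.integral_add[OF j] integral_mult_right_zero
      by (simp only: distrib_left add.assoc)
  qed
  have T0: "0 \<le> T" using T by simp
  have bp: "p T * m T = p 0 * (x0 h $ k * x0 h' $ k) + (LINT s:{0..T}|lborel. p' s * m s + p s * n s)"
    by (rule AC_by_parts(1)[OF p'i ni pe me T0])
  have "set_integrable lborel {0..T} (\<lambda>s. p' s * m s + p s * n s)"
    by (rule AC_by_parts(2)[OF p'i ni pe me T0])
  then show "set_integrable lborel {0..T} ?m"
    by (subst set_integrable_cong[OF refl refl m_eq]) auto
  have "(LINT s:{0..T}|lborel. ?m s) = (LINT s:{0..T}|lborel. p' s * m s + p s * n s)"
    by (rule set_lebesgue_integral_cong) (use m_eq in auto)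
  with bp show "p T * (LINT \<omega>|P. Y T \<omega> h $ k * Y T \<omega> h' $ k) = p 0 * (x0 h $ k * x0 h' $ k) + (LINT s:{0..T}|lborel. ?m s)"
    using T by (simp add: m_def)
qed

end

section \<open>Quadratic forms along the cycle of players\<close>

text \<open>The error made by using the coefficients of the infinite system in the equation of the
  \<open>N\<close>-player game: the part of the cyclic convolution in which the index wraps around.\<close>

definition residual :: "nat \<Rightarrow> (nat \<Rightarrow> nat \<Rightarrow> real) \<Rightarrow> nat \<Rightarrow> nat \<Rightarrow> real" where
  "residual N C h k = (\<Sum>j\<in>{h<..<N}. C 0 (N + h - j) * C j k) + (\<Sum>j\<in>{k<..<N}. C 0 (N + k - j) * C j h)"

lemma cyclic_sum:
  fixes v :: "nat \<Rightarrow> real"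
  assumes h: "h < N"
  shows "(\<Sum>j<N. a j * v ((h + j) mod N)) = (\<Sum>m<N. (if h \<le> m then a (m - h) else a (N + m - h)) * v m)"
proof -
  have m: "(h + j) mod N = (if h + j < N then h + j else h + j - N)" if "j < N" for j
    using that h by (auto simp: mod_if)
  show ?thesis
    by (rule sum.reindex_bij_witness[of _ "\<lambda>m. if h \<le> m then m - h else N + m - h" "\<lambda>j. (h + j) mod N"])
       (use h in \<open>auto simp: m\<close>)
qed

text \<open>Along a dynamics in which everybody but player \<open>0\<close> uses the feedback, the time derivative of the
  quadratic form with coefficients \<open>C\<close> is the completed square of the deviation of player \<open>0\<close>, minus
  the running cost, minus the residual. For the proof, \<open>b\<close> is the linear feedback \<open>\<beta>\<close> plus the deviation
  \<open>b 0 + p\<close> in coordinate \<open>0\<close>; the matrix of \<open>\<beta>\<close> is circulant, and the part of it that does not wrap around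
  reproduces the convolutions of the Riccati system.\<close>

lemma riccati_quadratic:
  fixes v b :: "nat \<Rightarrow> real" and C D f :: "nat \<Rightarrow> nat \<Rightarrow> real"
  assumes N: "0 < N" and sym: "\<And>h k. C h k = C k h"
    and D: "\<And>h k. D h k = (\<Sum>j=0..h. C 0 (h - j) * C j k) + (\<Sum>j=0..k. C 0 (k - j) * C j h) - C 0 h * C 0 k - f h k"
    and b: "\<And>m. 0 < m \<Longrightarrow> m < N \<Longrightarrow> b m = - (\<Sum>j<N. C 0 j * v ((m + j) mod N))"
  shows "(\<Sum>h<N. \<Sum>k<N. D h k * (v h * v k) + C h k * (b h * v k + v h * b k))
    = (b 0 + (\<Sum>k<N. C 0 k * v k))\<^sup>2 - (b 0)\<^sup>2 - (\<Sum>h<N. \<Sum>k<N. f h k * (v h * v k))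
      - (\<Sum>h<N. \<Sum>k<N. residual N C h k * (v h * v k))"
proof -
  \<comment> \<open>The circulant matrix of the feedback.\<close>
  define A where "A h m = (if h \<le> m then C 0 (m - h) else C 0 (N + m - h))" for h m
  define p where "p = (\<Sum>k<N. C 0 k * v k)"
  define \<beta> where "\<beta> m = - (\<Sum>k<N. A m k * v k)" for m
  define M where "M h k = (\<Sum>j<N. A j h * C j k)" for h k
  have \<beta>0: "\<beta> 0 = - p" by (simp add: \<beta>_def p_def A_def)
  have b\<beta>: "b m = \<beta> m + (if m = 0 then b 0 + p else 0)" if "m < N" for m
  proof (cases "m = 0")
    case False
    then show ?thesis
      using b[of m] cyclic_sum[OF that, of "C 0" v] that by (simp add: \<beta>_def A_def)
  qed (simp add: \<beta>0)
  have cross: "(\<Sum>h<N. \<Sum>k<N. C h k * (\<beta> h * v k)) = - (\<Sum>h<N. \<Sum>k<N. M h k * (v h * v k))"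
  proof -
    have "(\<Sum>h<N. \<Sum>k<N. C h k * (\<beta> h * v k)) = - (\<Sum>h<N. \<Sum>k<N. \<Sum>m<N. A h m * C h k * (v m * v k))"
      unfolding \<beta>_def by (simp add: sum_distrib_left sum_distrib_right sum_negf mult_ac)
    also have "(\<Sum>h<N. \<Sum>k<N. \<Sum>m<N. A h m * C h k * (v m * v k)) = (\<Sum>h<N. \<Sum>m<N. \<Sum>k<N. A h m * C h k * (v m * v k))"
      by (intro sum.cong refl sum.swap)
    also have "\<dots> = (\<Sum>m<N. \<Sum>h<N. \<Sum>k<N. A h m * C h k * (v m * v k))"
      by (rule sum.swap)
    also have "\<dots> = (\<Sum>m<N. \<Sum>k<N. \<Sum>h<N. A h m * C h k * (v m * v k))"
      by (intro sum.cong refl sum.swap)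
    also have "\<dots> = (\<Sum>m<N. \<Sum>k<N. M m k * (v m * v k))"
      by (simp add: M_def sum_distrib_right)
    finally show ?thesis .
  qed
  have row: "(\<Sum>k<N. C 0 k * (x * v k)) = x * p" for x
    by (simp add: p_def sum_distrib_left mult_ac)
  have half: "(\<Sum>h<N. \<Sum>k<N. C h k * (b h * v k)) = - (\<Sum>h<N. \<Sum>k<N. M h k * (v h * v k)) + (b 0 + p) * p"
  proof -
    have "(\<Sum>h<N. \<Sum>k<N. C h k * (b h * v k))
      = (\<Sum>h<N. \<Sum>k<N. C h k * (\<beta> h * v k)) + (\<Sum>h<N. \<Sum>k<N. C h k * ((if h = 0 then b 0 + p else 0) * v k))"
      unfolding sum.distrib[symmetric]
      by (intro sum.cong refl) (subst b\<beta>, auto simp: algebra_simps)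
    also have "(\<Sum>h<N. \<Sum>k<N. C h k * ((if h = 0 then b 0 + p else 0) * v k))
      = (\<Sum>h<N. if h = 0 then (b 0 + p) * p else 0)"
      by (intro sum.cong refl) (simp add: row)
    also have "\<dots> = (b 0 + p) * p"
      using N by simp
    finally show ?thesis using cross by simp
  qed
  have half': "(\<Sum>h<N. \<Sum>k<N. C h k * (v h * b k)) = (\<Sum>h<N. \<Sum>k<N. C h k * (b h * v k))"
    by (subst sum.swap) (intro sum.cong refl, simp add: sym mult_ac)
  have halfM: "(\<Sum>h<N. \<Sum>k<N. M k h * (v h * v k)) = (\<Sum>h<N. \<Sum>k<N. M h k * (v h * v k))"
    by (subst sum.swap) (intro sum.cong refl, simp add: mult_ac)
  have MD: "D h k - M h k - M k h = - (C 0 h * C 0 k) - f h k - residual N C h k" if hk: "h < N" "k < N" for h k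
  proof -
    have split: "M h k = (\<Sum>j=0..h. C 0 (h - j) * C j k) + (\<Sum>j\<in>{h<..<N}. C 0 (N + h - j) * C j k)" if "h < N" for h k
    proof -
      have e: "{..<N} = {0..h} \<union> {h<..<N}" using that by auto
      show ?thesis
        unfolding M_def e by (subst sum.union_disjoint) (auto simp: A_def intro!: sum.cong arg_cong2[where f = "(+)"])
    qed
    show ?thesis
      unfolding D split[OF hk(1)] split[OF hk(2)] residual_def by simp
  qed
  have "(\<Sum>h<N. \<Sum>k<N. D h k * (v h * v k) + C h k * (b h * v k + v h * b k))
    = (\<Sum>h<N. \<Sum>k<N. D h k * (v h * v k)) + 2 * (\<Sum>h<N. \<Sum>k<N. C h k * (b h * v k))"
    using half' by (simp add: sum.distrib distrib_left)
  also have "\<dots> = (\<Sum>h<N. \<Sum>k<N. D h k * (v h * v k)) - (\<Sum>h<N. \<Sum>k<N. M h k * (v h * v k)) - (\<Sum>h<N. \<Sum>k<N. M k h * (v h * v k))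
     + 2 * ((b 0 + p) * p)"
    unfolding half halfM by simp
  also have "(\<Sum>h<N. \<Sum>k<N. D h k * (v h * v k)) - (\<Sum>h<N. \<Sum>k<N. M h k * (v h * v k)) - (\<Sum>h<N. \<Sum>k<N. M k h * (v h * v k))
     = (\<Sum>h<N. \<Sum>k<N. (D h k - M h k - M k h) * (v h * v k))"
    by (simp add: left_diff_distrib sum_subtractf)
  also have "\<dots> = (\<Sum>h<N. \<Sum>k<N. (- (C 0 h * C 0 k) - f h k - residual N C h k) * (v h * v k))"
    by (intro sum.cong refl) (simp add: MD)
  also have "\<dots> = - (\<Sum>h<N. \<Sum>k<N. (C 0 h * v h) * (C 0 k * v k)) - (\<Sum>h<N. \<Sum>k<N. f h k * (v h * v k))
     - (\<Sum>h<N. \<Sum>k<N. residual N C h k * (v h * v k))"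
  proof -
    have "(- (C 0 h * C 0 k) - f h k - residual N C h k) * (v h * v k)
        = - ((C 0 h * v h) * (C 0 k * v k)) - f h k * (v h * v k) - residual N C h k * (v h * v k)" for h k
      by (simp add: algebra_simps)
    then show ?thesis by (simp only: sum_subtractf sum_negf)
  qed
  also have "(\<Sum>h<N. \<Sum>k<N. (C 0 h * v h) * (C 0 k * v k)) = p\<^sup>2"
    by (simp add: p_def power2_eq_square sum_product)
  finally show ?thesis
    unfolding p_def[symmetric] by (simp add: power2_eq_square algebra_simps)
qed

text \<open>In every term \<open>C 0 (N + h - j) * C j k\<close> the indices add up to \<open>N + h + k\<close>.\<close>

lemma residual_bound:
  assumes K: "0 \<le> K" and q: "1 \<le> q" and dec: "\<And>h k. \<bar>C h k\<bar> * q ^ (h + k) \<le> K" and hk: "h < N" "k < N"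
  shows "\<bar>residual N C h k\<bar> \<le> 2 * real N * (K\<^sup>2 / q ^ N)"
proof -
  have entry: "\<bar>C 0 (N + h - j) * C j k\<bar> \<le> K\<^sup>2 / q ^ N" if j: "j \<in> {h<..<N}" for h k j
  proof -
    have "\<bar>C 0 (N + h - j) * C j k\<bar> * q ^ N \<le> \<bar>C 0 (N + h - j) * C j k\<bar> * q ^ (N + h + k)"
      using q by (intro mult_left_mono power_increasing) auto
    also have "N + h + k = (N + h - j) + (j + k)" using j by simp
    also have "\<bar>C 0 (N + h - j) * C j k\<bar> * q ^ ((N + h - j) + (j + k))
       = (\<bar>C 0 (N + h - j)\<bar> * q ^ (0 + (N + h - j))) * (\<bar>C j k\<bar> * q ^ (j + k))"
      by (simp add: power_add abs_mult mult_ac)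
    also have "\<dots> \<le> K * K"
      using K q by (intro mult_mono dec) auto
    finally show ?thesis
      using q by (simp add: pos_le_divide_eq power2_eq_square)
  qed
  have sum: "\<bar>\<Sum>j\<in>{h<..<N}. C 0 (N + h - j) * C j k\<bar> \<le> real N * (K\<^sup>2 / q ^ N)" for h k
  proof -
    have "\<bar>\<Sum>j\<in>{h<..<N}. C 0 (N + h - j) * C j k\<bar> \<le> (\<Sum>j\<in>{h<..<N}. K\<^sup>2 / q ^ N)"
      by (rule order_trans[OF sum_abs sum_mono[OF entry]])
    also have "\<dots> = real (card {h<..<N}) * (K\<^sup>2 / q ^ N)" by simp
    also have "\<dots> \<le> real N * (K\<^sup>2 / q ^ N)"
      using q by (intro mult_right_mono) auto
    finally show ?thesis .
  qed
  show ?thesis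
    unfolding residual_def using sum[of h k] sum[of k h] by linarith
qed

lemma quadratic_form_bound:
  fixes v :: "nat \<Rightarrow> real"
  assumes E: "\<And>h k. h < N \<Longrightarrow> k < N \<Longrightarrow> \<bar>E h k\<bar> \<le> \<epsilon>" and \<epsilon>: "0 \<le> \<epsilon>"
  shows "\<bar>\<Sum>h<N. \<Sum>k<N. E h k * (v h * v k)\<bar> \<le> \<epsilon> * real N * (\<Sum>h<N. (v h)\<^sup>2)"
proof -
  have "\<bar>\<Sum>h<N. \<Sum>k<N. E h k * (v h * v k)\<bar> \<le> (\<Sum>h<N. \<Sum>k<N. \<bar>E h k * (v h * v k)\<bar>)"
    by (rule order_trans[OF sum_abs sum_mono[OF sum_abs]])
  also have "\<dots> \<le> (\<Sum>h<N. \<Sum>k<N. \<epsilon> * (((v h)\<^sup>2 + (v k)\<^sup>2) / 2))"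
  proof (intro sum_mono)
    fix h k assume "h \<in> {..<N}" "k \<in> {..<N}"
    then have "\<bar>E h k\<bar> \<le> \<epsilon>" using E by simp
    moreover have "\<bar>v h * v k\<bar> \<le> ((v h)\<^sup>2 + (v k)\<^sup>2) / 2"
      using zero_le_power2[of "v h - v k"] zero_le_power2[of "v h + v k"]
      by (simp add: power2_eq_square algebra_simps abs_le_iff)
    ultimately show "\<bar>E h k * (v h * v k)\<bar> \<le> \<epsilon> * (((v h)\<^sup>2 + (v k)\<^sup>2) / 2)"
      unfolding abs_mult[of "E h k"] using \<epsilon> by (intro mult_mono) auto
  qed
  also have "\<dots> = (\<epsilon> / 2) * (\<Sum>h<N. \<Sum>k<N. (v h)\<^sup>2 + (v k)\<^sup>2)"
    by (simp add: sum_distrib_left)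
  also have "(\<Sum>h<N. \<Sum>k<N. (v h)\<^sup>2 + (v k)\<^sup>2) = 2 * (real N * (\<Sum>h<N. (v h)\<^sup>2))"
    by (simp add: sum.distrib sum_distrib_left)
  finally show ?thesis by simp
qed

text \<open>Seen from player \<open>i\<close>, the player at distance \<open>a\<close>. In these coordinates the costs of player \<open>i\<close> and
  the feedback have the form that they have for player \<open>0\<close>.\<close>

definition rot :: "nat \<Rightarrow> nat \<Rightarrow> nat \<Rightarrow> nat" where "rot N i a = (i + a) mod N"

lemma rot_less: "0 < N \<Longrightarrow> rot N i a < N" by (simp add: rot_def)

lemma rot_bij:
  assumes "i < N"
  shows "bij_betw (rot N i) {..<N} {..<N}"
proof (rule bij_betwI[where g = "\<lambda>m. if i \<le> m then m - i else N + m - i"])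
  show "rot N i \<in> {..<N} \<rightarrow> {..<N}" using assms by (auto simp: rot_def)
qed (use assms in \<open>auto simp: rot_def mod_if\<close>)

lemma rot_zero: "i < N \<Longrightarrow> rot N i 0 = i" by (simp add: rot_def)

lemma rot_rot: "rot N i ((m + j) mod N) = (rot N i m + j) mod N"
  by (simp add: rot_def mod_simps add.assoc)

lemma rot_neq: "i < N \<Longrightarrow> 0 < m \<Longrightarrow> m < N \<Longrightarrow> rot N i m \<noteq> i"
  by (auto simp: rot_def mod_if)

lemma shifted_rot:
  assumes "i < N" "a < N" "b < N"
  shows "shifted N i g (rot N i a) (rot N i b) = g a b"
proof -
  have "nat ((int (rot N i a) - int i) mod int N) = a" if "a < N" for a
  proof -
    have "(int (rot N i a) - int i) mod int N = (int (i + a) - int i) mod int N"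
      unfolding rot_def by (simp add: zmod_int mod_simps)
    then show ?thesis using that by simp
  qed
  then show ?thesis using assms by (simp add: shifted_def)
qed

lemma tensor_quadratic:
  assumes i: "i < N"
  shows "state_inner N (tensor_Id N (shifted N i g) x) x
    = (\<Sum>k\<in>UNIV. \<Sum>a<N. \<Sum>b<N. g a b * (x (rot N i a) $ k * x (rot N i b) $ k))"
proof -
  have "state_inner N (tensor_Id N (shifted N i g) x) x = (\<Sum>h<N. \<Sum>m<N. \<Sum>k\<in>UNIV. shifted N i g h m * (x h $ k * x m $ k))"
    unfolding state_inner_def
  proof (rule sum.cong[OF refl])
    fix h assume "h \<in> {..<N}"
    then have "tensor_Id N (shifted N i g) x h \<bullet> x h = (\<Sum>m<N. shifted N i g h m * (x m \<bullet> x h))"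
      by (simp add: tensor_Id_def inner_sum_left)
    also have "\<dots> = (\<Sum>m<N. \<Sum>k\<in>UNIV. shifted N i g h m * (x h $ k * x m $ k))"
    proof (rule sum.cong[OF refl])
      fix m
      have "x m \<bullet> x h = (\<Sum>k\<in>UNIV. x h $ k * x m $ k)"
        by (simp add: inner_vec_def mult.commute)
      then show "shifted N i g h m * (x m \<bullet> x h) = (\<Sum>k\<in>UNIV. shifted N i g h m * (x h $ k * x m $ k))"
        by (simp add: sum_distrib_left)
    qed
    finally show "tensor_Id N (shifted N i g) x h \<bullet> x h = (\<Sum>m<N. \<Sum>k\<in>UNIV. shifted N i g h m * (x h $ k * x m $ k))" .
  qed
  also have "\<dots> = (\<Sum>a<N. \<Sum>m<N. \<Sum>k\<in>UNIV. shifted N i g (rot N i a) m * (x (rot N i a) $ k * x m $ k))"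
    by (rule sum.reindex_bij_betw[OF rot_bij[OF i], symmetric])
  also have "\<dots> = (\<Sum>a<N. \<Sum>b<N. \<Sum>k\<in>UNIV. shifted N i g (rot N i a) (rot N i b) * (x (rot N i a) $ k * x (rot N i b) $ k))"
    by (intro sum.cong refl sum.reindex_bij_betw[OF rot_bij[OF i], symmetric])
  also have "\<dots> = (\<Sum>a<N. \<Sum>b<N. \<Sum>k\<in>UNIV. g a b * (x (rot N i a) $ k * x (rot N i b) $ k))"
    by (intro sum.cong refl) (simp add: shifted_rot[OF i])
  also have "\<dots> = (\<Sum>a<N. \<Sum>k\<in>UNIV. \<Sum>b<N. g a b * (x (rot N i a) $ k * x (rot N i b) $ k))"
    by (intro sum.cong refl sum.swap)
  also have "\<dots> = (\<Sum>k\<in>UNIV. \<Sum>a<N. \<Sum>b<N. g a b * (x (rot N i a) $ k * x (rot N i b) $ k))"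
    by (rule sum.swap)
  finally show ?thesis .
qed

lemma alpha_star_cyclic:
  assumes m: "m < N"
  shows "alpha_star N c t x m = - (\<Sum>j<N. c 0 j t *\<^sub>R x ((m + j) mod N))"
proof -
  have e: "{..<N} = {0..N - m - 1} \<union> {N - m..N - 1}"
  proof (rule set_eqI)
    show "j \<in> {..<N} \<longleftrightarrow> j \<in> {0..N - m - 1} \<union> {N - m..N - 1}" for j
      unfolding Un_iff lessThan_iff atLeastAtMost_iff using m by linarith
  qed
  have d: "{0..N - m - 1} \<inter> {N - m..N - 1} = {}"
  proof (rule equals0I)
    fix j assume "j \<in> {0..N - m - 1} \<inter> {N - m..N - 1}"
    then show False
      unfolding Int_iff atLeastAtMost_iff using m by linarith
  qed
  have "(\<Sum>j<N. c 0 j t *\<^sub>R x ((m + j) mod N))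
      = (\<Sum>j\<in>{0..N - m - 1}. c 0 j t *\<^sub>R x ((m + j) mod N)) + (\<Sum>j\<in>{N - m..N - 1}. c 0 j t *\<^sub>R x ((m + j) mod N))"
    unfolding e by (rule sum.union_disjoint[OF _ _ d]) simp_all
  also have "(\<Sum>j\<in>{0..N - m - 1}. c 0 j t *\<^sub>R x ((m + j) mod N)) = (\<Sum>j\<in>{0..N - m - 1}. c 0 j t *\<^sub>R x (j + m))"
  proof (rule sum.cong[OF refl])
    fix j assume "j \<in> {0..N - m - 1}"
    then have "m + j < N" unfolding atLeastAtMost_iff using m by linarith
    then have "(m + j) mod N = j + m" by simp
    then show "c 0 j t *\<^sub>R x ((m + j) mod N) = c 0 j t *\<^sub>R x (j + m)" by (simp only:)
  qed
  also have "(\<Sum>j\<in>{N - m..N - 1}. c 0 j t *\<^sub>R x ((m + j) mod N)) = (\<Sum>j\<in>{N - m..N - 1}. c 0 j t *\<^sub>R x (j + m - N))"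
  proof (rule sum.cong[OF refl])
    fix j assume "j \<in> {N - m..N - 1}"
    then have "N \<le> m + j" "m + j - N < N" unfolding atLeastAtMost_iff using m by linarith+
    then have "(m + j) mod N = j + m - N" by (simp only: le_mod_geq mod_less add.commute)
    then show "c 0 j t *\<^sub>R x ((m + j) mod N) = c 0 j t *\<^sub>R x (j + m - N)" by (simp only:)
  qed
  finally show ?thesis using m by (simp add: alpha_star_def)
qed

lemma alpha_star_extensional: "alpha_star N c t x \<in> extensional {..<N}"
  by (simp add: alpha_star_def)

lemma alpha_star_rot:
  assumes i: "i < N" and m: "m < N"
  shows "alpha_star N c t x (rot N i m) $ k = - (\<Sum>j<N. c 0 j t * x (rot N i ((m + j) mod N)) $ k)"
  using rot_less[of N i m] i by (simp add: alpha_star_cyclic rot_rot)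

lemma state_norm_rot:
  assumes "j < N"
  shows "state_norm N (\<lambda>m. z ((m + j) mod N)) = state_norm N z"
proof -
  have "(\<Sum>m<N. (norm (z (rot N j m)))\<^sup>2) = (\<Sum>m<N. (norm (z m))\<^sup>2)"
    by (rule sum.reindex_bij_betw[OF rot_bij[OF assms]])
  then show ?thesis by (simp add: state_norm_def L2_set_def rot_def add.commute)
qed

lemma state_norm_sum: "finite J \<Longrightarrow> state_norm N (\<lambda>m. \<Sum>j\<in>J. u j m) \<le> (\<Sum>j\<in>J. state_norm N (u j))"
proof (induction J rule: finite_induct)
  case empty
  then show ?case by (simp add: state_norm_def L2_set_def)
next
  case (insert j J)
  then show ?case
    using state_norm_triangle[of N "u j" "\<lambda>m. \<Sum>j\<in>J. u j m"] by simp
qed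

definition riccati_rhs :: "(nat \<Rightarrow> nat \<Rightarrow> real) \<Rightarrow> (nat \<Rightarrow> nat \<Rightarrow> real) \<Rightarrow> nat \<Rightarrow> nat \<Rightarrow> real" where
  "riccati_rhs f C h k = (\<Sum>j=0..h. C 0 (h - j) * C j k) + (\<Sum>j=0..k. C 0 (k - j) * C j h) - C 0 h * C 0 k - f h k"

lemma riccati_deriv:
  assumes "riccati_solution T f g c" "t \<in> {0..T}"
  shows "(c h k has_real_derivative riccati_rhs f (\<lambda>h k. c h k t) h k) (at t within {0..T})"
proof -
  obtain c' where c': "(c h k has_real_derivative c') (at t within {0..T})"
      "- c' - c 0 h t * c 0 k t + (\<Sum>j=0..h. c 0 (h - j) t * c j k t)
          + (\<Sum>j=0..k. c 0 (k - j) t * c j h t) = f h k"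
    using assms unfolding riccati_solution_def by blast
  then have "c' = riccati_rhs f (\<lambda>h k. c h k t) h k"
    by (simp add: riccati_rhs_def)
  with c' show ?thesis by simp
qed

lemma riccati_continuous:
  assumes "riccati_solution T f g c"
  shows "continuous_on {0..T} (c h k)"
  by (rule DERIV_continuous_on[OF riccati_deriv[OF assms]])

lemma riccati_rhs_continuous:
  assumes "riccati_solution T f g c"
  shows "continuous_on {0..T} (\<lambda>t. riccati_rhs f (\<lambda>h k. c h k t) h k)"
  unfolding riccati_rhs_def
  by (intro continuous_on_diff continuous_on_add continuous_on_sum continuous_on_mult continuous_on_const
        riccati_continuous[OF assms])

definition residual_form :: "nat \<Rightarrow> nat \<Rightarrow> (nat \<Rightarrow> nat \<Rightarrow> real) \<Rightarrow> (nat \<Rightarrow> real ^ 'd::finite) \<Rightarrow> real" where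
  "residual_form N i C y = (\<Sum>k\<in>UNIV. \<Sum>a<N. \<Sum>b<N. residual N C a b * (y (rot N i a) $ k * y (rot N i b) $ k))"

text \<open>The scalar identity \<open>riccati_quadratic\<close>, seen from player \<open>i\<close> and summed over the
  coordinates of \<open>\<real>\<^sup>d\<close>.\<close>

lemma state_identity:
  fixes y w :: "nat \<Rightarrow> real ^ 'd::finite"
  assumes i: "i < N" and ric: "riccati_solution T f g c" and t: "t \<in> {0..T}"
    and w: "\<And>m. m < N \<Longrightarrow> m \<noteq> i \<Longrightarrow> w m = alpha_star N c t y m"
  shows "(\<Sum>k\<in>UNIV. \<Sum>a<N. \<Sum>b<N. riccati_rhs f (\<lambda>h k. c h k t) a b * (y (rot N i a) $ k * y (rot N i b) $ k)
        + c a b t * (w (rot N i a) $ k * y (rot N i b) $ k + y (rot N i a) $ k * w (rot N i b) $ k))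
    = (norm (w i - alpha_star N c t y i))\<^sup>2 - (norm (w i))\<^sup>2
      - state_inner N (tensor_Id N (shifted N i f) y) y - residual_form N i (\<lambda>h k. c h k t) y"
proof -
  have N: "0 < N" using i by simp
  have sym: "c h k t = c k h t" for h k
    using ric t by (simp add: riccati_solution_def)
  have p: "(\<Sum>k'<N. c 0 k' t * y (rot N i k') $ k) = - alpha_star N c t y i $ k" for k
  proof -
    have "alpha_star N c t y (rot N i 0) $ k = - (\<Sum>j<N. c 0 j t * y (rot N i ((0 + j) mod N)) $ k)"
      by (rule alpha_star_rot[OF i N])
    then show ?thesis by (simp add: rot_zero[OF i])
  qed
  have "(\<Sum>k\<in>UNIV. \<Sum>a<N. \<Sum>b<N. riccati_rhs f (\<lambda>h k. c h k t) a b * (y (rot N i a) $ k * y (rot N i b) $ k)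
        + c a b t * (w (rot N i a) $ k * y (rot N i b) $ k + y (rot N i a) $ k * w (rot N i b) $ k))
    = (\<Sum>k\<in>UNIV. (w i $ k - alpha_star N c t y i $ k)\<^sup>2 - (w i $ k)\<^sup>2
       - (\<Sum>a<N. \<Sum>b<N. f a b * (y (rot N i a) $ k * y (rot N i b) $ k))
       - (\<Sum>a<N. \<Sum>b<N. residual N (\<lambda>h k. c h k t) a b * (y (rot N i a) $ k * y (rot N i b) $ k)))"
  proof (rule sum.cong[OF refl])
    fix k :: 'd
    have "(\<Sum>a<N. \<Sum>b<N. riccati_rhs f (\<lambda>h k. c h k t) a b * (y (rot N i a) $ k * y (rot N i b) $ k)
        + c a b t * (w (rot N i a) $ k * y (rot N i b) $ k + y (rot N i a) $ k * w (rot N i b) $ k))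
      = (w (rot N i 0) $ k + (\<Sum>k'<N. c 0 k' t * y (rot N i k') $ k))\<^sup>2 - (w (rot N i 0) $ k)\<^sup>2
        - (\<Sum>a<N. \<Sum>b<N. f a b * (y (rot N i a) $ k * y (rot N i b) $ k))
        - (\<Sum>a<N. \<Sum>b<N. residual N (\<lambda>h k. c h k t) a b * (y (rot N i a) $ k * y (rot N i b) $ k))"
    proof (rule riccati_quadratic[OF N sym riccati_rhs_def])
      fix m assume m: "0 < m" "m < N"
      have "w (rot N i m) = alpha_star N c t y (rot N i m)"
        by (rule w[OF rot_less[OF N] rot_neq[OF i m]])
      then show "w (rot N i m) $ k = - (\<Sum>j<N. c 0 j t * y (rot N i ((m + j) mod N)) $ k)"
        using alpha_star_rot[OF i m(2)] by simp
    qed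
    then show "(\<Sum>a<N. \<Sum>b<N. riccati_rhs f (\<lambda>h k. c h k t) a b * (y (rot N i a) $ k * y (rot N i b) $ k)
        + c a b t * (w (rot N i a) $ k * y (rot N i b) $ k + y (rot N i a) $ k * w (rot N i b) $ k))
      = (w i $ k - alpha_star N c t y i $ k)\<^sup>2 - (w i $ k)\<^sup>2
       - (\<Sum>a<N. \<Sum>b<N. f a b * (y (rot N i a) $ k * y (rot N i b) $ k))
       - (\<Sum>a<N. \<Sum>b<N. residual N (\<lambda>h k. c h k t) a b * (y (rot N i a) $ k * y (rot N i b) $ k))"
      unfolding p rot_zero[OF i] by simp
  qed
  also have "\<dots> = (norm (w i - alpha_star N c t y i))\<^sup>2 - (norm (w i))\<^sup>2
      - state_inner N (tensor_Id N (shifted N i f) y) y - residual_form N i (\<lambda>h k. c h k t) y"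
  proof -
    have n: "(norm u)\<^sup>2 = (\<Sum>k\<in>UNIV. (u $ k)\<^sup>2)" for u :: "real ^ 'd"
      unfolding power2_norm_eq_inner by (simp add: inner_vec_def power2_eq_square)
    show ?thesis
      unfolding tensor_quadratic[OF i] residual_form_def n sum_subtractf vector_minus_component ..
  qed
  finally show ?thesis .
qed

lemma residual_form_bound:
  assumes i: "i < N" and K: "0 \<le> K" and q: "1 \<le> q" and dec: "\<And>h k. \<bar>C h k\<bar> * q ^ (h + k) \<le> K"
  shows "\<bar>residual_form N i C y\<bar> \<le> 2 * (real N)\<^sup>2 * (K\<^sup>2 / q ^ N) * (state_norm N y)\<^sup>2"
proof -
  let ?\<epsilon> = "2 * real N * (K\<^sup>2 / q ^ N)"
  have "\<bar>residual_form N i C y\<bar> \<le> (\<Sum>k\<in>UNIV. \<bar>\<Sum>a<N. \<Sum>b<N. residual N C a b * (y (rot N i a) $ k * y (rot N i b) $ k)\<bar>)"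
    unfolding residual_form_def by (rule sum_abs)
  also have "\<dots> \<le> (\<Sum>k\<in>UNIV. ?\<epsilon> * real N * (\<Sum>a<N. (y (rot N i a) $ k)\<^sup>2))"
    by (intro sum_mono quadratic_form_bound residual_bound K q dec) (use q in auto)
  also have "\<dots> = ?\<epsilon> * real N * (\<Sum>k\<in>UNIV. \<Sum>a<N. (y (rot N i a) $ k)\<^sup>2)"
    by (simp add: sum_distrib_left)
  also have "(\<Sum>k\<in>UNIV. \<Sum>a<N. (y (rot N i a) $ k)\<^sup>2) = (\<Sum>a<N. \<Sum>k\<in>UNIV. (y (rot N i a) $ k)\<^sup>2)"
    by (rule sum.swap)
  also have "\<dots> = (\<Sum>h<N. \<Sum>k\<in>UNIV. (y h $ k)\<^sup>2)"
    by (rule sum.reindex_bij_betw[OF rot_bij[OF i]])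
  also have "\<dots> = (state_norm N y)\<^sup>2"
    by (rule state_norm_square_comp[symmetric])
  finally show ?thesis by (simp add: power2_eq_square mult_ac)
qed

text \<open>The feedback is a combination of cyclic shifts, which are isometries, with coefficients \<open>c\<^sub>0\<^sub>j\<close>. This
  is the reason for measuring admissibility in \<open>\<ell>\<^sup>1\<close>.\<close>

lemma alpha_star_lipschitz:
  assumes L: "(\<Sum>j<N. \<bar>c 0 j t\<bar>) \<le> L"
  shows "state_dist N (alpha_star N c t x) (alpha_star N c t y) \<le> L * state_dist N x y"
proof -
  let ?z = "\<lambda>h. x h - y h"
  have "state_dist N (alpha_star N c t x) (alpha_star N c t y)
     = state_norm N (\<lambda>m. \<Sum>j<N. (- c 0 j t) *\<^sub>R ?z ((m + j) mod N))"
    unfolding state_dist_norm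
  proof (rule state_norm_cong)
    fix m assume "m < N"
    then show "alpha_star N c t x m - alpha_star N c t y m = (\<Sum>j<N. (- c 0 j t) *\<^sub>R ?z ((m + j) mod N))"
      by (simp add: alpha_star_cyclic scaleR_diff_right sum_subtractf sum_negf)
  qed
  also have "\<dots> \<le> (\<Sum>j<N. state_norm N (\<lambda>m. (- c 0 j t) *\<^sub>R ?z ((m + j) mod N)))"
    by (rule state_norm_sum) simp
  also have "\<dots> = (\<Sum>j<N. \<bar>c 0 j t\<bar> * state_norm N ?z)"
  proof (rule sum.cong[OF refl])
    fix j assume "j \<in> {..<N}"
    then show "state_norm N (\<lambda>m. (- c 0 j t) *\<^sub>R ?z ((m + j) mod N)) = \<bar>c 0 j t\<bar> * state_norm N ?z"
      using state_norm_rot[of j N ?z] by (simp only: state_norm_scaleR abs_minus_cancel lessThan_iff)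
  qed
  also have "\<dots> \<le> L * state_norm N ?z"
    unfolding sum_distrib_right[symmetric] by (rule mult_right_mono[OF L]) simp
  finally show ?thesis by (simp add: state_dist_norm)
qed

lemma alpha_star_controls:
  assumes ric: "riccati_solution T f g c" and R: "0 \<le> R"
    and L: "\<And>t. t \<in> {0..T} \<Longrightarrow> (\<Sum>j<N. \<bar>c 0 j t\<bar>) \<le> L"
  shows "(alpha_star N c :: real \<Rightarrow> (nat \<Rightarrow> real ^ 'd::finite) \<Rightarrow> _) \<in> controls N T R L"
  unfolding controls_def mem_Collect_eq
proof (intro conjI ballI)
  show "(\<lambda>(t, x :: nat \<Rightarrow> real ^ 'd). alpha_star N c t x) \<in> restrict_space borel {0..T} \<Otimes>\<^sub>M states N \<rightarrow>\<^sub>M states N"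
  proof (rule measurable_into_states)
    fix h assume h: "h < N"
    have cm: "c 0 j \<in> borel_measurable (restrict_space borel {0..T})" for j
      by (rule borel_measurable_continuous_on_restrict[OF riccati_continuous[OF ric]])
    have "(\<lambda>p :: real \<times> (nat \<Rightarrow> real ^ 'd). - (\<Sum>j<N. c 0 j (fst p) *\<^sub>R snd p ((h + j) mod N)))
        \<in> borel_measurable (restrict_space borel {0..T} \<Otimes>\<^sub>M states N)"
      using h by (intro borel_measurable_uminus borel_measurable_sum borel_measurable_scaleR
          measurable_compose[OF measurable_fst cm] measurable_compose[OF measurable_snd measurable_states_comp]) auto
    then show "(\<lambda>p. (case p of (t, x :: nat \<Rightarrow> real ^ 'd) \<Rightarrow> alpha_star N c t x) h) \<in> borel_measurable (restrict_space borel {0..T} \<Otimes>\<^sub>M states N)"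
      using h by (simp add: case_prod_beta alpha_star_cyclic)
  qed (auto simp: space_states alpha_star_extensional)
  fix t assume t: "t \<in> {0..T}"
  have "alpha_star N c t (zero_state N :: nat \<Rightarrow> real ^ 'd) h = 0" if h: "h < N" for h
    unfolding alpha_star_cyclic[OF h] using h by (simp add: zero_state_def)
  then have "state_norm N (alpha_star N c t (zero_state N :: nat \<Rightarrow> real ^ 'd)) = state_norm N (\<lambda>_. 0 :: real ^ 'd)"
    by (intro state_norm_cong) simp
  then show "state_norm N (alpha_star N c t (zero_state N :: nat \<Rightarrow> real ^ 'd)) \<le> R"
    using R by (simp add: state_norm_def L2_set_def)
  show "state_dist N (alpha_star N c t x) (alpha_star N c t y) \<le> L * state_dist N x y" for x y :: "nat \<Rightarrow> real ^ 'd"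
    by (rule alpha_star_lipschitz[where c = c, OF L[OF t]])
qed

section \<open>The cost of a deviation\<close>

lemma set_integral_sum:
  fixes f :: "'i \<Rightarrow> 'a \<Rightarrow> real"
  assumes "\<And>i. i \<in> J \<Longrightarrow> set_integrable M A (f i)"
  shows "(LINT s:A|M. (\<Sum>i\<in>J. f i s)) = (\<Sum>i\<in>J. (LINT s:A|M. f i s))"
    and "set_integrable M A (\<lambda>s. \<Sum>i\<in>J. f i s)"
  using assms unfolding set_integrable_def set_lebesgue_integral_def
  by (auto simp: sum_distrib_left intro!: Bochner_Integration.integral_sum)

context controlled_sde
begin

lemma time_integrable_cong:
  assumes "time_integrable f" and "\<And>s \<omega>. s \<in> {0..T} \<Longrightarrow> \<omega> \<in> space P \<Longrightarrow> f s \<omega> = g s \<omega>"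
  shows "time_integrable g"
proof -
  have "integrable (lborel \<Otimes>\<^sub>M P) (\<lambda>p. indicator {0..T} (fst p) * f (fst p) (snd p))
      = integrable (lborel \<Otimes>\<^sub>M P) (\<lambda>p. indicator {0..T} (fst p) * g (fst p) (snd p))"
    by (rule Bochner_Integration.integrable_cong) (use assms(2) in \<open>auto simp: indicator_def space_pair_measure\<close>)
  moreover have "integrable P (f s) = integrable P (g s)" if "s \<in> {0..T}" for s
    by (rule Bochner_Integration.integrable_cong) (use assms(2) that in auto)
  ultimately show ?thesis using assms(1) by (simp add: time_integrable_def)
qed

text \<open>Twice the initial value of the quadratic value function, together with the trace term that stems
  from the noise. It depends on the initial state but not on the control.\<close>

definition value_const :: "(nat \<Rightarrow> nat \<Rightarrow> real \<Rightarrow> real) \<Rightarrow> nat \<Rightarrow> real" where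
  "value_const c i = (\<Sum>k\<in>UNIV. \<Sum>a<N. \<Sum>b<N. c a b 0 * (x0 (rot N i a) $ k * x0 (rot N i b) $ k))
    + (LINT s:{0..T}|lborel. (\<Sum>k\<in>(UNIV :: 'd set). \<Sum>a<N. \<Sum>b<N. c a b s * (if rot N i a = rot N i b then 2 else 0)))"

lemma terminal_cost:
  assumes ric: "riccati_solution T f g c" and i: "i < N"
  defines "Z \<equiv> \<lambda>s \<omega>. \<Sum>k\<in>UNIV. \<Sum>a<N. \<Sum>b<N.
      riccati_rhs f (\<lambda>h k. c h k s) a b * (Y (clamp_time s) \<omega> (rot N i a) $ k * Y (clamp_time s) \<omega> (rot N i b) $ k)
      + c a b s * (drift s \<omega> (rot N i a) $ k * Y (clamp_time s) \<omega> (rot N i b) $ k + Y (clamp_time s) \<omega> (rot N i a) $ k * drift s \<omega> (rot N i b) $ k)"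
  shows "(LINT \<omega>|P. state_inner N (tensor_Id N (shifted N i g) (Y T \<omega>)) (Y T \<omega>))
      = value_const c i + (LINT s:{0..T}|lborel. (LINT \<omega>|P. Z s \<omega>))"
    and "time_integrable Z" and "integrable P (\<lambda>\<omega>. state_inner N (tensor_Id N (shifted N i g) (Y T \<omega>)) (Y T \<omega>))"
proof -
  have N: "0 < N" using i by simp
  have TT: "T \<in> {0..T}" using T by simp
  note r = rot_less[OF N, of i]
  define zz where "zz k a b s \<omega> = riccati_rhs f (\<lambda>h k. c h k s) a b * (Y (clamp_time s) \<omega> (rot N i a) $ k * Y (clamp_time s) \<omega> (rot N i b) $ k)
      + c a b s * (drift s \<omega> (rot N i a) $ k * Y (clamp_time s) \<omega> (rot N i b) $ k + Y (clamp_time s) \<omega> (rot N i a) $ k * drift s \<omega> (rot N i b) $ k)" for k :: 'd and a b s \<omega>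
  define tr where "tr a b s = c a b s * (if rot N i a = rot N i b then 2 else 0 :: real)" for a b s
  have Z: "Z s \<omega> = (\<Sum>k\<in>UNIV. \<Sum>a<N. \<Sum>b<N. zz k a b s \<omega>)" for s \<omega>
    by (simp add: Z_def zz_def)
  have qz: "time_integrable (zz k a b)" for k a b
    unfolding zz_def[abs_def]
    by (intro time_integrable_add time_integrable_scale time_integrable_mult sq_integrable_state sq_integrable_drift r riccati_rhs_continuous[OF ric] riccati_continuous[OF ric])
  show "time_integrable Z"
    unfolding Z[abs_def] by (intro time_integrable_sum qz)
  have ito: "c a b T * (LINT \<omega>|P. Y T \<omega> (rot N i a) $ k * Y T \<omega> (rot N i b) $ k)
      = c a b 0 * (x0 (rot N i a) $ k * x0 (rot N i b) $ k) + (LINT s:{0..T}|lborel. (LINT \<omega>|P. zz k a b s \<omega>) + tr a b s)"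
    "set_integrable lborel {0..T} (\<lambda>s. (LINT \<omega>|P. zz k a b s \<omega>) + tr a b s)" for k a b
    unfolding zz_def tr_def
    by (rule ito_weighted[OF r r riccati_deriv[OF ric] riccati_rhs_continuous[OF ric]], assumption)+
  have yy: "integrable P (\<lambda>\<omega>. Y T \<omega> (rot N i a) $ k * Y T \<omega> (rot N i b) $ k)" for k a b
    using time_integrable_integrable[OF time_integrable_mult[OF sq_integrable_state[OF r[of a], where k = k] sq_integrable_state[OF r[of b], where k = k]] TT] TT by simp
  have gT: "g a b = c a b T" for a b
    using ric by (simp add: riccati_solution_def)
  show "integrable P (\<lambda>\<omega>. state_inner N (tensor_Id N (shifted N i g) (Y T \<omega>)) (Y T \<omega>))"
    unfolding tensor_quadratic[OF i] by (intro Bochner_Integration.integrable_sum integrable_mult_right yy)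
  have tri: "set_integrable lborel {0..T} (tr a b)" for a b
    unfolding tr_def[abs_def]
    by (intro borel_integrable_atLeastAtMost' continuous_on_mult_right riccati_continuous[OF ric])
  have zi: "set_integrable lborel {0..T} (\<lambda>s. LINT \<omega>|P. zz k a b s \<omega>)" for k a b
    by (rule time_integrable_fubini(3)[OF qz TT])
  have "(LINT \<omega>|P. state_inner N (tensor_Id N (shifted N i g) (Y T \<omega>)) (Y T \<omega>))
     = (\<Sum>k\<in>UNIV. \<Sum>a<N. \<Sum>b<N. c a b T * (LINT \<omega>|P. Y T \<omega> (rot N i a) $ k * Y T \<omega> (rot N i b) $ k))"
    unfolding tensor_quadratic[OF i] gT
    by (simp add: Bochner_Integration.integral_sum Bochner_Integration.integrable_sum yy)
  also have "\<dots> = (\<Sum>k\<in>UNIV. \<Sum>a<N. \<Sum>b<N. c a b 0 * (x0 (rot N i a) $ k * x0 (rot N i b) $ k)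
      + ((LINT s:{0..T}|lborel. tr a b s) + (LINT s:{0..T}|lborel. (LINT \<omega>|P. zz k a b s \<omega>))))"
    unfolding ito(1) using zi tri by (simp add: set_integral_add(2) add.commute)
  also have "\<dots> = (\<Sum>k\<in>UNIV. \<Sum>a<N. \<Sum>b<N. c a b 0 * (x0 (rot N i a) $ k * x0 (rot N i b) $ k))
      + ((\<Sum>k\<in>(UNIV :: 'd set). \<Sum>a<N. \<Sum>b<N. (LINT s:{0..T}|lborel. tr a b s))
      + (\<Sum>k\<in>UNIV. \<Sum>a<N. \<Sum>b<N. (LINT s:{0..T}|lborel. (LINT \<omega>|P. zz k a b s \<omega>))))"
    by (simp only: sum.distrib)
  also have "(\<Sum>k\<in>(UNIV :: 'd set). \<Sum>a<N. \<Sum>b<N. (LINT s:{0..T}|lborel. tr a b s))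
      = (LINT s:{0..T}|lborel. (\<Sum>k\<in>(UNIV :: 'd set). \<Sum>a<N. \<Sum>b<N. tr a b s))"
    by (simp only: set_integral_sum tri)
  also have "(\<Sum>k\<in>UNIV. \<Sum>a<N. \<Sum>b<N. (LINT s:{0..T}|lborel. (LINT \<omega>|P. zz k a b s \<omega>)))
      = (LINT s:{0..T}|lborel. (\<Sum>k\<in>UNIV. \<Sum>a<N. \<Sum>b<N. (LINT \<omega>|P. zz k a b s \<omega>)))"
    by (simp only: set_integral_sum zi)
  also have "(LINT s:{0..T}|lborel. (\<Sum>k\<in>UNIV. \<Sum>a<N. \<Sum>b<N. (LINT \<omega>|P. zz k a b s \<omega>)))
      = (LINT s:{0..T}|lborel. (LINT \<omega>|P. Z s \<omega>))"
  proof (rule set_lebesgue_integral_cong)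
    show "\<forall>s. s \<in> {0..T} \<longrightarrow> (\<Sum>k\<in>UNIV. \<Sum>a<N. \<Sum>b<N. (LINT \<omega>|P. zz k a b s \<omega>)) = (LINT \<omega>|P. Z s \<omega>)"
      unfolding Z using time_integrable_integrable[OF qz]
      by (simp add: Bochner_Integration.integral_sum Bochner_Integration.integrable_sum)
  qed simp
  finally show "(LINT \<omega>|P. state_inner N (tensor_Id N (shifted N i g) (Y T \<omega>)) (Y T \<omega>))
      = value_const c i + (LINT s:{0..T}|lborel. (LINT \<omega>|P. Z s \<omega>))"
    by (simp add: value_const_def tr_def add.assoc)
qed

text \<open>Completing the square: Ito's formula expresses the terminal cost by the initial value and the time
  integral of the form in \<open>state_identity\<close>, whose running cost cancels the one in the cost functional.\<close>

lemma cost_identity: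
  assumes ric: "riccati_solution T f g c" and i: "i < N"
    and other: "\<And>t x m. t \<in> {0..T} \<Longrightarrow> m < N \<Longrightarrow> m \<noteq> i \<Longrightarrow> \<alpha> t x m = alpha_star N c t x m"
  shows "2 * cost P T N f g i \<alpha> Y = value_const c i
      + (LINT s:{0..T}|lborel. (LINT \<omega>|P. (norm (drift s \<omega> i - alpha_star N c (clamp_time s) (Y (clamp_time s) \<omega>) i))\<^sup>2))
      - (LINT s:{0..T}|lborel. (LINT \<omega>|P. residual_form N i (\<lambda>h k. c h k s) (Y (clamp_time s) \<omega>)))"
    and "time_integrable (\<lambda>s \<omega>. residual_form N i (\<lambda>h k. c h k s) (Y (clamp_time s) \<omega>))"
proof -
  have N: "0 < N" using i by simp
  have TT: "T \<in> {0..T}" using T by simp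
  note r = rot_less[OF N, of i]
  let ?F = "\<lambda>s \<omega>. state_inner N (tensor_Id N (shifted N i f) (Y (clamp_time s) \<omega>)) (Y (clamp_time s) \<omega>)"
  let ?n = "\<lambda>s \<omega>. (norm (drift s \<omega> i))\<^sup>2"
  let ?d = "\<lambda>s \<omega>. (norm (drift s \<omega> i - alpha_star N c (clamp_time s) (Y (clamp_time s) \<omega>) i))\<^sup>2"
  let ?e = "\<lambda>s \<omega>. residual_form N i (\<lambda>h k. c h k s) (Y (clamp_time s) \<omega>)"
  define Z where "Z s \<omega> = (\<Sum>k\<in>UNIV. \<Sum>a<N. \<Sum>b<N.
      riccati_rhs f (\<lambda>h k. c h k s) a b * (Y (clamp_time s) \<omega> (rot N i a) $ k * Y (clamp_time s) \<omega> (rot N i b) $ k)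
      + c a b s * (drift s \<omega> (rot N i a) $ k * Y (clamp_time s) \<omega> (rot N i b) $ k + Y (clamp_time s) \<omega> (rot N i a) $ k * drift s \<omega> (rot N i b) $ k))" for s \<omega>
  note tc = terminal_cost[OF ric i, folded Z_def]
  have qF: "time_integrable ?F"
    unfolding tensor_quadratic[OF i]
    by (intro time_integrable_sum time_integrable_scale[where p = "\<lambda>_. f _ _"] time_integrable_mult sq_integrable_state r continuous_on_const)
  have qn: "time_integrable ?n"
  proof -
    have "?n = (\<lambda>s \<omega>. \<Sum>k\<in>UNIV. drift s \<omega> i $ k * drift s \<omega> i $ k)"
      unfolding power2_norm_eq_inner by (simp add: inner_vec_def)
    then show ?thesis by (simp only:) (intro time_integrable_sum time_integrable_mult sq_integrable_drift i)
  qed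
  have qe: "time_integrable ?e"
    unfolding residual_form_def
  proof (intro time_integrable_sum time_integrable_scale time_integrable_mult sq_integrable_state r)
    show "continuous_on {0..T} (\<lambda>s. residual N (\<lambda>h k. c h k s) a b)" for a b
      unfolding residual_def
      by (intro continuous_on_add continuous_on_sum continuous_on_mult riccati_continuous[OF ric])
  qed
  then show "time_integrable ?e" .
  have Zeq: "Z s \<omega> = ?d s \<omega> - ?n s \<omega> - ?F s \<omega> - ?e s \<omega>" if s: "s \<in> {0..T}" for s \<omega>
    unfolding Z_def
    using state_identity[OF i ric s, of "drift s \<omega>" "Y (clamp_time s) \<omega>"] other[OF s] s by (simp add: drift_def)
  have qd: "time_integrable ?d"
    by (rule time_integrable_cong[OF time_integrable_add[OF time_integrable_add[OF time_integrable_add[OF tc(2) qn] qF] qe]]) (simp add: Zeq)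
  have ZE: "(LINT \<omega>|P. Z s \<omega>) = (LINT \<omega>|P. ?d s \<omega>) - (LINT \<omega>|P. ?n s \<omega> + ?F s \<omega>) - (LINT \<omega>|P. ?e s \<omega>)"
    if s: "s \<in> {0..T}" for s
  proof -
    have "(LINT \<omega>|P. Z s \<omega>) = (LINT \<omega>|P. (?d s \<omega> - (?n s \<omega> + ?F s \<omega>)) - ?e s \<omega>)"
      by (intro Bochner_Integration.integral_cong refl) (simp add: Zeq[OF s])
    also have "\<dots> = (LINT \<omega>|P. ?d s \<omega> - (?n s \<omega> + ?F s \<omega>)) - (LINT \<omega>|P. ?e s \<omega>)"
      by (rule Bochner_Integration.integral_diff[OF time_integrable_integrable[OF time_integrable_diff[OF qd time_integrable_add[OF qn qF]] s] time_integrable_integrable[OF qe s]])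
    also have "(LINT \<omega>|P. ?d s \<omega> - (?n s \<omega> + ?F s \<omega>)) = (LINT \<omega>|P. ?d s \<omega>) - (LINT \<omega>|P. ?n s \<omega> + ?F s \<omega>)"
      by (rule Bochner_Integration.integral_diff[OF time_integrable_integrable[OF qd s] time_integrable_integrable[OF time_integrable_add[OF qn qF] s]])
    finally show ?thesis .
  qed
  note fd = time_integrable_fubini(3)[OF qd TT] and fn = time_integrable_fubini(3)[OF time_integrable_add[OF qn qF] TT] and fe = time_integrable_fubini(3)[OF qe TT]
  have ZI: "(LINT s:{0..T}|lborel. (LINT \<omega>|P. Z s \<omega>)) = (LINT s:{0..T}|lborel. (LINT \<omega>|P. ?d s \<omega>))
      - (LINT s:{0..T}|lborel. (LINT \<omega>|P. ?n s \<omega> + ?F s \<omega>)) - (LINT s:{0..T}|lborel. (LINT \<omega>|P. ?e s \<omega>))"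
  proof -
    have "(LINT s:{0..T}|lborel. (LINT \<omega>|P. Z s \<omega>)) = (LINT s:{0..T}|lborel. (LINT \<omega>|P. ?d s \<omega>) - (LINT \<omega>|P. ?n s \<omega> + ?F s \<omega>) - (LINT \<omega>|P. ?e s \<omega>))"
      by (rule set_lebesgue_integral_cong) (use ZE in auto)
    then show ?thesis
      by (simp only: set_integral_diff(2)[OF set_integral_diff(1)[OF fd fn] fe] set_integral_diff(2)[OF fd fn])
  qed
  have "2 * cost P T N f g i \<alpha> Y = (LINT \<omega>|P. (LINT s:{0..T}|lborel. ?n s \<omega> + ?F s \<omega>)
      + state_inner N (tensor_Id N (shifted N i g) (Y T \<omega>)) (Y T \<omega>))"
  proof -
    have "(LINT s:{0..T}|lborel. (norm (\<alpha> s (Y s \<omega>) i))\<^sup>2 + state_inner N (tensor_Id N (shifted N i f) (Y s \<omega>)) (Y s \<omega>))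
        = (LINT s:{0..T}|lborel. ?n s \<omega> + ?F s \<omega>)" for \<omega>
      by (rule set_lebesgue_integral_cong) (auto simp: drift_def)
    then show ?thesis by (simp add: cost_def)
  qed
  also have "\<dots> = (LINT \<omega>|P. (LINT s:{0..T}|lborel. ?n s \<omega> + ?F s \<omega>))
      + (LINT \<omega>|P. state_inner N (tensor_Id N (shifted N i g) (Y T \<omega>)) (Y T \<omega>))"
    by (rule Bochner_Integration.integral_add[OF time_integrable_fubini(2)[OF time_integrable_add[OF qn qF] TT] tc(3)])
  also have "(LINT \<omega>|P. (LINT s:{0..T}|lborel. ?n s \<omega> + ?F s \<omega>)) = (LINT s:{0..T}|lborel. (LINT \<omega>|P. ?n s \<omega> + ?F s \<omega>))"
    by (rule time_integrable_fubini(1)[OF time_integrable_add[OF qn qF] TT])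
  finally show "2 * cost P T N f g i \<alpha> Y = value_const c i + (LINT s:{0..T}|lborel. (LINT \<omega>|P. ?d s \<omega>))
      - (LINT s:{0..T}|lborel. (LINT \<omega>|P. ?e s \<omega>))"
    unfolding tc(1) ZI by simp
qed

lemma residual_cost_bound:
  assumes q: "time_integrable (\<lambda>s \<omega>. residual_form N i (\<lambda>h k. c h k s) (Y (clamp_time s) \<omega>))"
    and \<epsilon>: "0 \<le> \<epsilon>"
    and le: "\<And>s y. s \<in> {0..T} \<Longrightarrow> \<bar>residual_form N i (\<lambda>h k. c h k s) (y :: nat \<Rightarrow> real ^ 'd)\<bar> \<le> \<epsilon> * (state_norm N y)\<^sup>2"
  shows "\<bar>LINT s:{0..T}|lborel. (LINT \<omega>|P. residual_form N i (\<lambda>h k. c h k s) (Y (clamp_time s) \<omega>))\<bar> \<le> T * (\<epsilon> * moment_bound)"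
proof -
  let ?e = "\<lambda>s \<omega>. residual_form N i (\<lambda>h k. c h k s) (Y (clamp_time s) \<omega>)"
  have TT: "T \<in> {0..T}" using T by simp
  have b: "\<bar>LINT \<omega>|P. ?e s \<omega>\<bar> \<le> \<epsilon> * moment_bound" if s: "s \<in> {0..T}" for s
  proof -
    have "\<bar>LINT \<omega>|P. ?e s \<omega>\<bar> \<le> (LINT \<omega>|P. \<bar>?e s \<omega>\<bar>)"
      by (rule integral_abs_bound)
    also have "\<dots> \<le> (LINT \<omega>|P. \<epsilon> * (state_size s \<omega>)\<^sup>2)"
      using time_integrable_integrable[OF q s] state_size_square_moment[OF s] le[OF s]
      by (intro integral_mono integrable_abs integrable_mult_right) (auto simp: state_size_def)
    also have "\<dots> \<le> \<epsilon> * moment_bound"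
      using state_size_square_moment[OF s] \<epsilon> by (simp add: mult_left_mono)
    finally show ?thesis .
  qed
  note fe = time_integrable_fubini(3)[OF q TT]
  have ci: "set_integrable lborel {0..T} (\<lambda>_. \<epsilon> * moment_bound)"
    by (intro borel_integrable_atLeastAtMost' continuous_on_const)
  have cv: "(LINT s:{0..T}|lborel. \<epsilon> * moment_bound) = T * (\<epsilon> * moment_bound)"
    using T by (simp add: set_lebesgue_integral_def)
  have "(LINT s:{0..T}|lborel. (LINT \<omega>|P. ?e s \<omega>)) \<le> (LINT s:{0..T}|lborel. \<epsilon> * moment_bound)"
    by (rule set_integral_mono[OF fe ci]) (use b in \<open>auto simp: abs_le_iff\<close>)
  moreover have "- (LINT s:{0..T}|lborel. (LINT \<omega>|P. ?e s \<omega>)) \<le> (LINT s:{0..T}|lborel. \<epsilon> * moment_bound)"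
  proof -
    have "- (LINT s:{0..T}|lborel. (LINT \<omega>|P. ?e s \<omega>)) = (LINT s:{0..T}|lborel. - (LINT \<omega>|P. ?e s \<omega>))"
      by (simp add: set_lebesgue_integral_def)
    also have "\<dots> \<le> (LINT s:{0..T}|lborel. \<epsilon> * moment_bound)"
      using fe by (intro set_integral_mono ci) (use b in \<open>auto simp: abs_le_iff set_integrable_def\<close>)
    finally show ?thesis .
  qed
  ultimately show ?thesis unfolding cv by (simp add: abs_le_iff)
qed

end

text \<open>The candidate and the deviation have the same \<open>value_const\<close>. The square vanishes for the candidate
  and is nonnegative for the deviation, so only the two residual terms can be lost.\<close>

lemma approximate_nash:
  fixes x0 :: "nat \<Rightarrow> real ^ 'd::finite" and P :: "'w measure"
  assumes T: "0 < T" and P: "prob_space P" and BM: "independent_brownian_motions P T N B"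
    and x0: "x0 \<in> space (states N)" and ric: "riccati_solution T f g c"
    and R: "0 \<le> R" and adm: "admissible T c L" and i: "i < N"
    and \<psi>: "replace_control (alpha_star N c) i \<psi> \<in> controls N T R L"
    and X: "solves_sde P T N B x0 (alpha_star N c) X"
    and Y: "solves_sde P T N B x0 (replace_control (alpha_star N c) i \<psi>) Y"
    and K: "0 \<le> K" and q: "1 \<le> q" and dec: "\<And>h k t. t \<in> {0..T} \<Longrightarrow> \<bar>c h k t\<bar> * q ^ (h + k) \<le> K"
  defines "\<kappa> \<equiv> L * exp (L * T)"
  shows "cost P T N f g i (alpha_star N c) X \<le> cost P T N f g i (replace_control (alpha_star N c) i \<psi>) Y
     + T * (2 * (real N)\<^sup>2 * (K\<^sup>2 / q ^ N) * (3 * (((state_norm N x0 + R * T) * (1 + \<kappa> * T))\<^sup>2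
           + 2 * real N * real CARD('d) * T * (1 + (\<kappa> * T)\<^sup>2))))"
proof -
  have L: "0 \<le> L" using adm by (simp add: admissible_def)
  have rowsum: "(\<Sum>j<N. \<bar>c 0 j t\<bar>) \<le> L" if "t \<in> {0..T}" for t
    using sum_le_suminf[OF admissible_sum(1)[OF adm that], of "{..<N}"] admissible_sum(2)[OF adm that] by simp
  interpret CX: controlled_sde P T N B x0 "alpha_star N c" X R L
    by (intro controlled_sde.intro controlled_sde_axioms.intro P T BM x0 R L X alpha_star_controls[OF ric R rowsum])
  interpret CY: controlled_sde P T N B x0 "replace_control (alpha_star N c) i \<psi>" Y R L
    by (intro controlled_sde.intro controlled_sde_axioms.intro P T BM x0 R L Y \<psi>)
  define \<epsilon> where "\<epsilon> = 2 * (real N)\<^sup>2 * (K\<^sup>2 / q ^ N)"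
  have \<epsilon>: "0 \<le> \<epsilon>" using q by (simp add: \<epsilon>_def)
  have res: "\<bar>residual_form N i (\<lambda>h k. c h k s) y\<bar> \<le> \<epsilon> * (state_norm N y)\<^sup>2" if "s \<in> {0..T}" for s and y :: "nat \<Rightarrow> real ^ 'd"
    unfolding \<epsilon>_def by (rule residual_form_bound[OF i K q dec[OF that]])
  have otherX: "alpha_star N c t x m = alpha_star N c t x m" for t m and x :: "nat \<Rightarrow> real ^ 'd" ..
  have otherY: "replace_control (alpha_star N c) i \<psi> t x m = alpha_star N c t x m" if "m \<noteq> i" for t x m
    using that by (simp add: replace_control_def)
  note idX = CX.cost_identity[OF ric i otherX] and idY = CY.cost_identity[OF ric i otherY]
  have rX: "\<bar>LINT s:{0..T}|lborel. (LINT \<omega>|P. residual_form N i (\<lambda>h k. c h k s) (X (CX.clamp_time s) \<omega>))\<bar> \<le> T * (\<epsilon> * CX.moment_bound)"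
    by (rule CX.residual_cost_bound[OF idX(2) \<epsilon> res])
  have rY: "\<bar>LINT s:{0..T}|lborel. (LINT \<omega>|P. residual_form N i (\<lambda>h k. c h k s) (Y (CY.clamp_time s) \<omega>))\<bar> \<le> T * (\<epsilon> * CY.moment_bound)"
    by (rule CY.residual_cost_bound[OF idY(2) \<epsilon> res])
  have zero: "(LINT s:{0..T}|lborel. (LINT \<omega>|P. (norm (CX.drift s \<omega> i - alpha_star N c (CX.clamp_time s) (X (CX.clamp_time s) \<omega>) i))\<^sup>2)) = 0"
    by (simp add: CX.drift_def)
  have pos: "0 \<le> (LINT s:{0..T}|lborel. (LINT \<omega>|P. (norm (CY.drift s \<omega> i - alpha_star N c (CY.clamp_time s) (Y (CY.clamp_time s) \<omega>) i))\<^sup>2))"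
    unfolding set_lebesgue_integral_def by (intro Bochner_Integration.integral_nonneg) (simp add: Bochner_Integration.integral_nonneg)
  have "2 * cost P T N f g i (alpha_star N c) X \<le> 2 * cost P T N f g i (replace_control (alpha_star N c) i \<psi>) Y + 2 * (T * (\<epsilon> * CY.moment_bound))"
    using idX(1) idY(1) rX rY zero pos by linarith
  then have "cost P T N f g i (alpha_star N c) X \<le> cost P T N f g i (replace_control (alpha_star N c) i \<psi>) Y + T * (\<epsilon> * CY.moment_bound)"
    by simp
  then show ?thesis
    by (simp only: CY.moment_bound_def CY.\<kappa>_def \<kappa>_def \<epsilon>_def)
qed

section \<open>Choice of the constant\<close>

text \<open>To choose one function of the parameters it is enough to find a constant near each point: the least valid
  constant at a point is valid, as the set of valid constants is closed, and is bounded by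
  any constant that is valid in a neighbourhood.\<close>

lemma locally_uniform_constant:
  fixes V :: "'p::topological_space \<Rightarrow> real set"
  assumes nn: "\<And>p. p \<in> S \<Longrightarrow> V p \<subseteq> {0..}" and cl: "\<And>p. p \<in> S \<Longrightarrow> closed (V p)"
    and loc: "\<And>p. p \<in> S \<Longrightarrow> \<exists>U C. open U \<and> p \<in> U \<and> (\<forall>q\<in>S \<inter> U. C \<in> V q)"
  shows "\<exists>K. locally_bounded_on S K \<and> (\<forall>p\<in>S. K p \<in> V p)"
proof (intro exI conjI ballI)
  have bdd: "bdd_below (V p)" if "p \<in> S" for p
    using nn[OF that] by (intro bdd_belowI[of _ 0]) auto
  show "locally_bounded_on S (\<lambda>p. Inf (V p))"
    unfolding locally_bounded_on_def
  proof
    fix p assume p: "p \<in> S"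
    from loc[OF p] obtain U C where U: "open U" "p \<in> U" "\<forall>q\<in>S \<inter> U. C \<in> V q" by blast
    have "\<bar>Inf (V q)\<bar> \<le> C" if q: "q \<in> S \<inter> U" for q
    proof -
      have "C \<in> V q" using U q by blast
      then have "Inf (V q) \<le> C" using bdd q by (intro cInf_lower) auto
      moreover have "0 \<le> Inf (V q)"
        using \<open>C \<in> V q\<close> nn[of q] q by (intro cInf_greatest) auto
      ultimately show ?thesis by simp
    qed
    then have "bounded ((\<lambda>p. Inf (V p)) ` (S \<inter> U))"
      unfolding bounded_iff by (intro exI[of _ C]) auto
    with U show "\<exists>U. open U \<and> p \<in> U \<and> bounded ((\<lambda>p. Inf (V p)) ` (S \<inter> U))" by blast
  qed
  fix p assume p: "p \<in> S"
  from loc[OF p] p have "V p \<noteq> {}" by blast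
  then show "Inf (V p) \<in> V p"
    by (rule closed_contains_Inf[OF _ bdd[OF p] cl[OF p]])
qed

lemma square_times_geometric_bounded:
  fixes x :: real
  assumes x: "0 \<le> x" "x < 1"
  obtains S where "0 \<le> S" "\<And>n. (real n)\<^sup>2 * x ^ n \<le> S"
proof -
  have "norm (sqrt x) < 1" using x by simp
  from powser_times_n_limit_0[OF this] have "Bseq (\<lambda>n. real n * sqrt x ^ n)"
    by (intro convergent_imp_Bseq convergentI) simp
  then obtain S where S: "\<And>n. norm (real n * sqrt x ^ n) \<le> S"
    unfolding Bseq_def by auto
  show ?thesis
  proof (rule that)
    show "0 \<le> S\<^sup>2" by simp
    fix n
    have "(real n)\<^sup>2 * x ^ n = (real n * sqrt x ^ n)\<^sup>2"
      using x by (simp add: power_mult_distrib power_mult[symmetric] mult.commute[of n 2] power_mult[of "sqrt x" 2 n])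
    also have "\<dots> \<le> S\<^sup>2"
      using S[of n] by (simp add: abs_le_square_iff[symmetric])
    finally show "(real n)\<^sup>2 * x ^ n \<le> S\<^sup>2" .
  qed
qed

text \<open>The right-hand side dominates \<open>N \<delta>\<^sup>N\<close>; the remaining factor \<open>N\<^sup>2\<close> is absorbed by the gap between \<open>1 / q\<close>
  and \<open>\<delta>1\<close>.\<close>

lemma gathering_rate:
  fixes N M :: nat
  assumes N: "1 \<le> N" and q: "0 < q" and \<delta>1: "0 < \<delta>1" "\<delta>1 \<le> \<delta>"
    and S: "\<And>n. (real n)\<^sup>2 * (1 / (q * \<delta>1)) ^ n \<le> S" and S0: "0 \<le> S"
  shows "(real N) ^ 3 / q ^ N \<le> S * (\<delta> ^ M + ((1 / \<delta>) ^ M + real N) * \<delta> ^ N)"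
proof -
  have \<delta>: "0 < \<delta>" using \<delta>1 by simp
  have "(real N) ^ 3 / q ^ N = real N * \<delta>1 ^ N * ((real N)\<^sup>2 * (1 / (q * \<delta>1)) ^ N)"
    using q \<delta>1 by (simp add: power3_eq_cube power2_eq_square power_divide power_mult_distrib field_simps)
  also have "\<dots> \<le> real N * \<delta>1 ^ N * S"
    using \<delta>1 by (intro mult_left_mono S) auto
  also have "\<dots> \<le> real N * \<delta> ^ N * S"
    using \<delta>1 S0 by (intro mult_right_mono mult_left_mono power_mono) auto
  also have "\<dots> \<le> (\<delta> ^ M + ((1 / \<delta>) ^ M + real N) * \<delta> ^ N) * S"
    using \<delta> S0 by (intro mult_right_mono) (auto simp: distrib_right)
  finally show ?thesis by (simp add: mult.commute)
qed

text \<open>Bounds what remains of the second moments of a solution after division by \<open>3 N (1 + |x\<^sub>0|\<^sup>2)\<close>. It is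
  nondecreasing in \<open>R\<close>, \<open>L\<close> and \<open>T\<close>, hence locally bounded.\<close>

definition moment_factor :: "nat \<Rightarrow> real \<Rightarrow> real \<Rightarrow> real \<Rightarrow> real" where
  "moment_factor d R L T = 2 * (1 + (R * T)\<^sup>2) * (1 + L * exp (L * T) * T)\<^sup>2 + 2 * real d * T * (1 + (L * exp (L * T) * T)\<^sup>2)"

lemma moment_factor_bound:
  assumes N: "1 \<le> N" and T: "0 \<le> T" and L: "0 \<le> L"
  shows "((x + R * T) * (1 + L * exp (L * T) * T))\<^sup>2 + 2 * real N * real d * T * (1 + (L * exp (L * T) * T)\<^sup>2)
    \<le> real N * (1 + x\<^sup>2) * moment_factor d R L T"
proof -
  define u where "u = (1 + L * exp (L * T) * T)\<^sup>2"
  define w where "w = 2 * real d * T * (1 + (L * exp (L * T) * T)\<^sup>2)"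
  have w0: "0 \<le> w" using T by (simp add: w_def)
  have u0: "0 \<le> u" by (simp add: u_def)
  have "(x + R * T)\<^sup>2 \<le> 2 * (1 + (R * T)\<^sup>2) * (1 + x\<^sup>2)"
  proof -
    have "(x + y)\<^sup>2 \<le> 2 * (1 + y\<^sup>2) * (1 + x\<^sup>2)" for y :: real
    proof -
      have "(x + y)\<^sup>2 \<le> 2 * x\<^sup>2 + 2 * y\<^sup>2"
        using zero_le_power2[of "x - y"] by (simp add: power2_eq_square algebra_simps)
      also have "\<dots> \<le> 2 * (1 + y\<^sup>2) * (1 + x\<^sup>2)"
        by (simp add: algebra_simps)
      finally show ?thesis .
    qed
    then show ?thesis .
  qed
  then have "(x + R * T)\<^sup>2 * u \<le> 2 * (1 + (R * T)\<^sup>2) * (1 + x\<^sup>2) * u"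
    using u0 by (rule mult_right_mono)
  also have "\<dots> \<le> real N * (2 * (1 + (R * T)\<^sup>2) * (1 + x\<^sup>2) * u)"
    using N u0 mult_right_mono[of 1 "real N" "2 * (1 + (R * T)\<^sup>2) * (1 + x\<^sup>2) * u"] by simp
  finally have 1: "(x + R * T)\<^sup>2 * u \<le> real N * (2 * (1 + (R * T)\<^sup>2) * (1 + x\<^sup>2) * u)" .
  have 2: "real N * w \<le> real N * ((1 + x\<^sup>2) * w)"
    using w0 by (intro mult_left_mono) (auto simp: distrib_right)
  have "((x + R * T) * (1 + L * exp (L * T) * T))\<^sup>2 + 2 * real N * real d * T * (1 + (L * exp (L * T) * T)\<^sup>2)
     = (x + R * T)\<^sup>2 * u + real N * w"
    by (simp add: u_def w_def power_mult_distrib)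
  also have "\<dots> \<le> real N * (1 + x\<^sup>2) * (2 * (1 + (R * T)\<^sup>2) * u + w)"
    using 1 2 by (simp add: algebra_simps)
  finally show ?thesis by (simp add: moment_factor_def u_def w_def)
qed

lemma moment_factor_mono:
  assumes "0 \<le> R" "R \<le> R'" "0 \<le> L" "L \<le> L'" "0 \<le> T" "T \<le> T'"
  shows "moment_factor d R L T \<le> moment_factor d R' L' T'"
proof -
  have e: "L * exp (L * T) * T \<le> L' * exp (L' * T') * T'"
  proof -
    have "L * T \<le> L' * T'" using assms by (intro mult_mono) auto
    then have "exp (L * T) \<le> exp (L' * T')" by simp
    then show ?thesis using assms by (intro mult_mono) auto
  qed
  have "0 \<le> L * exp (L * T) * T" using assms by simp
  moreover have "2 * (1 + (R * T)\<^sup>2) * (1 + e)\<^sup>2 + 2 * real d * T * (1 + e\<^sup>2)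
      \<le> 2 * (1 + (R' * T')\<^sup>2) * (1 + e')\<^sup>2 + 2 * real d * T' * (1 + e'\<^sup>2)"
    if "0 \<le> e" "e \<le> e'" for e e' :: real
    using assms that by (intro add_mono mult_mono power_mono order_refl) auto
  ultimately show ?thesis
    unfolding moment_factor_def using e by blast
qed

theorem theorem2p31:
  fixes l :: nat and \<rho> :: real and f g :: "nat \<Rightarrow> nat \<Rightarrow> real" and I :: "real set"
  assumes "\<rho> > 1"
    and "sym_matrix l f" and "sym_matrix l g"
    and "is_interval I"
    and "strongly_gathering l \<rho> f"
    and "compatible l \<rho> f g I"
    and "pos_semidef l f" and "pos_semidef l g"
  shows "\<exists>K :: real \<times> real \<times> real \<times> real \<Rightarrow> real.
    locally_bounded_on
      {(R, L, T, \<delta>). 0 \<le> R \<and> 0 \<le> L \<and> 0 < T \<and> {0..T} \<subseteq> I \<and> 1 / \<rho> < \<delta> \<and> \<delta> < 1} K \<and>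
    (\<forall>(T::real) (N::nat) (P :: 'w measure) (B :: nat \<Rightarrow> real \<Rightarrow> 'w \<Rightarrow> real ^ 'd::finite)
        (x0 :: nat \<Rightarrow> real ^ 'd) (c :: nat \<Rightarrow> nat \<Rightarrow> real \<Rightarrow> real) (R::real) (L::real) (i::nat)
        (\<psi> :: real \<Rightarrow> (nat \<Rightarrow> real ^ 'd) \<Rightarrow> real ^ 'd)
        (X :: real \<Rightarrow> 'w \<Rightarrow> nat \<Rightarrow> real ^ 'd) (Y :: real \<Rightarrow> 'w \<Rightarrow> nat \<Rightarrow> real ^ 'd)
        (\<delta>::real) (M::nat).
       0 < T \<longrightarrow> {0..T} \<subseteq> I \<longrightarrow> l < N \<longrightarrow>
       prob_space P \<longrightarrow> independent_brownian_motions P T N B \<longrightarrow>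
       x0 \<in> space (states N) \<longrightarrow>
       riccati_solution T f g c \<longrightarrow>
       0 \<le> R \<longrightarrow> admissible T c L \<longrightarrow> i < N \<longrightarrow>
       replace_control (alpha_star N c) i \<psi> \<in> controls N T R L \<longrightarrow>
       solves_sde P T N B x0 (alpha_star N c) X \<longrightarrow>
       solves_sde P T N B x0 (replace_control (alpha_star N c) i \<psi>) Y \<longrightarrow>
       1 / \<rho> < \<delta> \<longrightarrow> \<delta> < 1 \<longrightarrow> l \<le> M \<longrightarrow>
       cost P T N f g i (alpha_star N c) X
         \<le> cost P T N f g i (replace_control (alpha_star N c) i \<psi>) Y
           + K (R, L, T, \<delta>) * (1 + (state_norm N x0)\<^sup>2)
             * (\<delta> ^ M + ((1 / \<delta>) ^ M + real N) * \<delta> ^ N))"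
proof -
  define S :: "(real \<times> real \<times> real \<times> real) set"
    where "S = {(R, L, T, \<delta>). 0 \<le> R \<and> 0 \<le> L \<and> 0 < T \<and> {0..T} \<subseteq> I \<and> 1 / \<rho> < \<delta> \<and> \<delta> < 1}"
  define game :: "real \<Rightarrow> real \<Rightarrow> real \<Rightarrow> nat \<Rightarrow> 'w measure \<Rightarrow> (nat \<Rightarrow> real \<Rightarrow> 'w \<Rightarrow> real ^ 'd) \<Rightarrow> (nat \<Rightarrow> real ^ 'd) \<Rightarrow>
      (nat \<Rightarrow> nat \<Rightarrow> real \<Rightarrow> real) \<Rightarrow> nat \<Rightarrow> (real \<Rightarrow> (nat \<Rightarrow> real ^ 'd) \<Rightarrow> real ^ 'd) \<Rightarrow>
      (real \<Rightarrow> 'w \<Rightarrow> nat \<Rightarrow> real ^ 'd) \<Rightarrow> (real \<Rightarrow> 'w \<Rightarrow> nat \<Rightarrow> real ^ 'd) \<Rightarrow> bool"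
    where "game R L T N P B x0 c i \<psi> X Y \<longleftrightarrow> 
       prob_space P \<and> independent_brownian_motions P T N B \<and> x0 \<in> space (states N) \<and>
       riccati_solution T f g c \<and> admissible T c L \<and> i < N \<and>
       replace_control (alpha_star N c) i \<psi> \<in> controls N T R L \<and>
       solves_sde P T N B x0 (alpha_star N c) X \<and>
       solves_sde P T N B x0 (replace_control (alpha_star N c) i \<psi>) Y"
    for R L T N P B x0 c i \<psi> X Y
  define V where "V = (\<lambda>(R, L, T, \<delta>). {C::real. 0 \<le> C \<and> (\<forall>N P B x0 c i \<psi> X Y M.
      game R L T N P B x0 c i \<psi> X Y \<longrightarrow>
      cost P T N f g i (alpha_star N c) X
         \<le> cost P T N f g i (replace_control (alpha_star N c) i \<psi>) Y
           + C * (1 + (state_norm N x0)\<^sup>2) * (\<delta> ^ M + ((1 / \<delta>) ^ M + real N) * \<delta> ^ N))})"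
  have "\<exists>K. locally_bounded_on S K \<and> (\<forall>p\<in>S. K p \<in> V p)"
  proof (rule locally_uniform_constant)
    show "V p \<subseteq> {0..}" for p by (auto simp: V_def)
    show "closed (V p)" for p
      unfolding V_def case_prod_beta
      by (intro closed_Collect_conj closed_Collect_all closed_Collect_imp closed_Collect_le open_Collect_const continuous_intros)
    fix p assume "p \<in> S"
    then obtain R L T \<delta> where p: "p = (R, L, T, \<delta>)"
      and h: "0 \<le> R" "0 \<le> L" "0 < T" "{0..T} \<subseteq> I" "1 / \<rho> < \<delta>" "\<delta> < 1"
      by (auto simp: S_def)
    \<comment> \<open>Radii \<open>1 / \<delta> < 1 / \<delta>1 < q < r < \<rho>\<close>: the first row decays at rate \<open>r\<close>, the whole
      matrix at rate \<open>q\<close>, and \<open>\<delta>1\<close> serves all \<open>\<delta>\<close> in a neighbourhood.\<close>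
    obtain \<delta>1 where \<delta>1: "1 / \<rho> < \<delta>1" "\<delta>1 < \<delta>" using dense[OF h(5)] by blast
    have \<rho>0: "0 < 1 / \<rho>" using assms(1) by simp
    then have \<delta>10: "0 < \<delta>1" using \<delta>1 by linarith
    have "1 / \<delta>1 < \<rho>"
      using \<delta>1(1) \<delta>10 assms(1) by (simp add: field_simps)
    then obtain r where r: "1 / \<delta>1 < r" "r < \<rho>" using dense by blast
    then obtain q where q: "1 / \<delta>1 < q" "q < r" using dense by blast
    have q1: "1 < q"
    proof -
      have "1 < 1 / \<delta>1" using \<delta>1 \<delta>10 h by simp
      then show ?thesis using q by linarith
    qed
    have q\<delta>: "1 < q * \<delta>1"
      using q(1) \<delta>10 by (simp add: field_simps)
    obtain Sg where Sg: "0 \<le> Sg" "\<And>n. (real n)\<^sup>2 * (1 / (q * \<delta>1)) ^ n \<le> Sg"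
      by (rule square_times_geometric_bounded[of "1 / (q * \<delta>1)"]) (use q\<delta> in auto)
    \<comment> \<open>A horizon \<open>T1\<close> inside \<open>I\<close> that dominates all nearby ones. If \<open>T\<close> is itself the longest
      horizon allowed by \<open>I\<close>, all nearby horizons are at most \<open>T\<close>.\<close>
    obtain T1 TU where T1: "0 < T1" "{0..T1} \<subseteq> I" "T < TU" "\<And>T'. T' < TU \<Longrightarrow> 0 < T' \<Longrightarrow> {0..T'} \<subseteq> I \<Longrightarrow> T' \<le> T1"
    proof (cases "\<exists>T0>T. {0..T0} \<subseteq> I")
      case True
      then obtain T0 where "T < T0" "{0..T0} \<subseteq> I" by blast
      then show ?thesis using h by (intro that[of T0 T0]) auto
    next
      case False
      then show ?thesis using h by (intro that[of T "T + 1"]) (auto simp: not_less)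
    qed
    obtain C1 where C1: "0 \<le> C1" "\<And>T c L k t. T \<le> T1 \<Longrightarrow> riccati_solution T f g c \<Longrightarrow> admissible T c L \<Longrightarrow> t \<in> {0..T} \<Longrightarrow>
       \<bar>c 0 k t\<bar> \<le> C1 / r ^ k"
      by (rule riccati_first_row_decay[OF assms(2,3,5,6) T1(2) less_imp_le[OF T1(1)] _ r(2) assms(1)])
         (use q1 q in auto)
    define m where "m = (\<Sum>h<l. \<Sum>k<l. q ^ (h + k) * (\<bar>g h k\<bar> + T1 * \<bar>f h k\<bar>)) + T1 * C1\<^sup>2"
    define \<kappa> where "\<kappa> = 2 * (C1 * (r / (r - q)))"
    define K where "K = m + \<kappa> * exp (\<kappa> * T1) * (T1 * m)"
    have m0: "0 \<le> m" unfolding m_def using q1 T1 by (intro add_nonneg_nonneg sum_nonneg) auto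
    have \<kappa>0: "0 \<le> \<kappa>" unfolding \<kappa>_def using C1 q q1 by auto
    have K0: "0 \<le> K" unfolding K_def using m0 \<kappa>0 T1 by simp
    define H where "H = moment_factor (CARD('d)) (R + 1) (L + 1) T1"
    define C where "C = T1 * (2 * K\<^sup>2 * (3 * H)) * Sg"
    have H0: "0 \<le> H" unfolding H_def moment_factor_def using T1 by simp
    have C0: "0 \<le> C" unfolding C_def using T1 H0 Sg by simp
    show "\<exists>U C. open U \<and> p \<in> U \<and> (\<forall>p'\<in>S \<inter> U. C \<in> V p')"
    proof (intro exI conjI ballI)
      let ?U = "{..<R + 1} \<times> {..<L + 1} \<times> {..<TU} \<times> {\<delta>1<..}"
      show "open ?U" by (intro open_Times open_lessThan open_greaterThan)
      show "p \<in> ?U" using p T1 \<delta>1 by auto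
      fix p' assume p': "p' \<in> S \<inter> ?U"
      obtain R' L' T' \<delta>' where e: "p' = (R', L', T', \<delta>')" by (cases p')
      have h': "0 \<le> R'" "0 \<le> L'" "0 < T'" "{0..T'} \<subseteq> I" "1 / \<rho> < \<delta>'" "\<delta>' < 1"
          "R' \<le> R + 1" "L' \<le> L + 1" "T' < TU" "\<delta>1 \<le> \<delta>'"
        using p' by (auto simp: e S_def)
      have T': "T' \<le> T1" by (rule T1(4)[OF h'(9,3,4)])
      show "C \<in> V p'"
        unfolding V_def e case_prod_conv mem_Collect_eq
      proof (intro conjI C0 allI impI)
        fix N and P :: "'w measure" and B x0 c i \<psi> X Y M
        assume "game R' L' T' N P B x0 c i \<psi> X Y"
        then have gm: "prob_space P" "independent_brownian_motions P T' N B" "x0 \<in> space (states N)"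
          "riccati_solution T' f g c" "admissible T' c L'" "i < N"
          "replace_control (alpha_star N c) i \<psi> \<in> controls N T' R' L'"
          "solves_sde P T' N B x0 (alpha_star N c) X"
          "solves_sde P T' N B x0 (replace_control (alpha_star N c) i \<psi>) Y"
          by (auto simp: game_def)
        have N1: "1 \<le> N" using gm(6) by simp
        have dec: "\<bar>c h k t\<bar> * q ^ (h + k) \<le> K" if "t \<in> {0..T'}" for h k t
          unfolding K_def m_def \<kappa>_def
        proof (rule riccati_decay[OF assms(2,3) C1(1) _ q(2) gm(4) C1(2)[OF T' gm(4,5)] _ T' that])
        qed (use q1 h' in auto)
        have "cost P T' N f g i (alpha_star N c) X \<le> cost P T' N f g i (replace_control (alpha_star N c) i \<psi>) Y
          + T' * (2 * (real N)\<^sup>2 * (K\<^sup>2 / q ^ N) * (3 * (((state_norm N x0 + R' * T') * (1 + L' * exp (L' * T') * T'))\<^sup>2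
             + 2 * real N * real CARD('d) * T' * (1 + (L' * exp (L' * T') * T')\<^sup>2))))"
          by (rule approximate_nash[OF h'(3) gm(1-4) h'(1) gm(5-9) K0 less_imp_le[OF q1] dec])
        also have "T' * (2 * (real N)\<^sup>2 * (K\<^sup>2 / q ^ N) * (3 * (((state_norm N x0 + R' * T') * (1 + L' * exp (L' * T') * T'))\<^sup>2
             + 2 * real N * real CARD('d) * T' * (1 + (L' * exp (L' * T') * T')\<^sup>2))))
          \<le> T1 * (2 * (real N)\<^sup>2 * (K\<^sup>2 / q ^ N) * (3 * (real N * (1 + (state_norm N x0)\<^sup>2) * H)))"
        proof (intro mult_mono order_refl T')
          have "((state_norm N x0 + R' * T') * (1 + L' * exp (L' * T') * T'))\<^sup>2
             + 2 * real N * real CARD('d) * T' * (1 + (L' * exp (L' * T') * T')\<^sup>2)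
             \<le> real N * (1 + (state_norm N x0)\<^sup>2) * moment_factor (CARD('d)) R' L' T'"
            by (rule moment_factor_bound[OF N1]) (use h' in auto)
          also have "\<dots> \<le> real N * (1 + (state_norm N x0)\<^sup>2) * H"
            unfolding H_def by (intro mult_left_mono moment_factor_mono) (use h' T' in auto)
          finally show "((state_norm N x0 + R' * T') * (1 + L' * exp (L' * T') * T'))\<^sup>2
             + 2 * real N * real CARD('d) * T' * (1 + (L' * exp (L' * T') * T')\<^sup>2) \<le> real N * (1 + (state_norm N x0)\<^sup>2) * H" .
        qed (use T1 q1 h' in auto)
        also have "\<dots> = (T1 * (2 * K\<^sup>2 * (3 * H)) * (1 + (state_norm N x0)\<^sup>2)) * ((real N) ^ 3 / q ^ N)"
          by (simp add: power3_eq_cube power2_eq_square)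
        also have "\<dots> \<le> (T1 * (2 * K\<^sup>2 * (3 * H)) * (1 + (state_norm N x0)\<^sup>2)) * (Sg * (\<delta>' ^ M + ((1 / \<delta>') ^ M + real N) * \<delta>' ^ N))"
          using T1 H0 by (intro mult_left_mono gathering_rate[OF N1 _ \<delta>10 h'(10) Sg(2) Sg(1)]) (use q1 in auto)
        also have "\<dots> = C * (1 + (state_norm N x0)\<^sup>2) * (\<delta>' ^ M + ((1 / \<delta>') ^ M + real N) * \<delta>' ^ N)"
          by (simp add: C_def mult_ac)
        finally show "cost P T' N f g i (alpha_star N c) X
         \<le> cost P T' N f g i (replace_control (alpha_star N c) i \<psi>) Y
           + C * (1 + (state_norm N x0)\<^sup>2) * (\<delta>' ^ M + ((1 / \<delta>') ^ M + real N) * \<delta>' ^ N)"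
          by simp
      qed
    qed
  qed
  then obtain K where K: "locally_bounded_on S K" "\<And>p. p \<in> S \<Longrightarrow> K p \<in> V p" by blast
  show ?thesis
  proof (intro exI conjI allI impI)
    show "locally_bounded_on {(R, L, T, \<delta>). 0 \<le> R \<and> 0 \<le> L \<and> 0 < T \<and> {0..T} \<subseteq> I \<and> 1 / \<rho> < \<delta> \<and> \<delta> < 1} K"
      using K(1) by (simp only: S_def)
    fix T :: real and N and P :: "'w measure" and B :: "nat \<Rightarrow> real \<Rightarrow> 'w \<Rightarrow> real ^ 'd" and x0 c R L i \<psi> X Y \<delta> M
    assume a: "0 < T" "{0..T} \<subseteq> I" "l < N" "prob_space P" "independent_brownian_motions P T N B"
       "x0 \<in> space (states N)" "riccati_solution T f g c" "0 \<le> R" "admissible T c L" "i < N"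
       "replace_control (alpha_star N c) i \<psi> \<in> controls N T R L"
       "solves_sde P T N B x0 (alpha_star N c) X"
       "solves_sde P T N B x0 (replace_control (alpha_star N c) i \<psi>) Y"
       "1 / \<rho> < \<delta>" "\<delta> < 1"
    have "(R, L, T, \<delta>) \<in> S"
      using a by (auto simp: S_def admissible_def)
    from K(2)[OF this] have v: "\<And>N P B x0 c i \<psi> X Y M. game R L T N P B x0 c i \<psi> X Y \<Longrightarrow>
      cost P T N f g i (alpha_star N c) X
         \<le> cost P T N f g i (replace_control (alpha_star N c) i \<psi>) Y
           + K (R, L, T, \<delta>) * (1 + (state_norm N x0)\<^sup>2) * (\<delta> ^ M + ((1 / \<delta>) ^ M + real N) * \<delta> ^ N)"
      unfolding V_def by simp
    show "cost P T N f g i (alpha_star N c) X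
         \<le> cost P T N f g i (replace_control (alpha_star N c) i \<psi>) Y
           + K (R, L, T, \<delta>) * (1 + (state_norm N x0)\<^sup>2) * (\<delta> ^ M + ((1 / \<delta>) ^ M + real N) * \<delta> ^ N)"
      by (rule v) (use a in \<open>simp add: game_def\<close>)
  qed
qed

end
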